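(* Let $(M,\mathbf{F})$ be a Finsler manifold of dimension $n>2$. Then the following statements are equivalent: (1) $M$ is a Landsberg manifold with vanishing $S$-curvature; (2) $M$ is a Landsberg manifold and the Cartan-type form $\eta$ is exact; (3) $M$ is a Landsberg manifold and $d\eta=0$; (4) $M$ is a Berwald manifold.
   Context: Finsler manifold: $M$ is a smooth manifold of dimension $n$, $TM_0$ is $TM$ minus the zero section, with local coordinates $(x^i,y^i)$ induced by coordinates $x^i$ of $M$. A Finsler structure is a continuous function $\mathbf{F}:TM\to\mathbb{R}$, smooth on $TM_0$, whose restriction to each $T_pM$ is a Minkowski norm: nonnegative, $\mathbf{F}(\lambda y)=\lambda\mathbf{F}(y)$ for $\lambda>0$, and $g_{ij}:=\frac12[F^2]_{y^iy^j}$ positive definite for $y\ne0$ ($F$ is $\mathbf{F}$ in coordinates). Set $(g^{ij})=(g_{ij})^{-1}$, $G^i=\frac14g^{ij}([F^2]_{y^jx^k}y^k-[F^2]_{x^j})$, $N^i_j=\partial G^i/\partial y^j$, $\frac{\delta}{\delta x^i}=\frac{\partial}{\partial x^i}-N^j_i\frac{\partial}{\partial y^j}$, $\delta y^i=\frac1F(dy^i+N^i_jdx^j)$, $A_{ijk}=\frac14F[F^2]_{y^iy^jy^k}$. The horizontal bundle $H(TM_0)$ is spanned by the $\frac{\delta}{\delta x^i}$. Cartan-type form: the one-form $\eta=g^{ij}A_{ijk}\,\delta y^k$ on $TM_0$. Chern connection: the connection $\nabla^{\rm Ch}$ on $H(TM_0)$, $\nabla^{\rm Ch}\frac{\delta}{\delta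 x^j}=\omega_j^i\frac{\delta}{\delta x^i}$, determined by $dx^j\wedge\omega_j^i=0$ and $dg_{ij}-g_{kj}\omega_i^k-g_{ik}\omega_j^k=2A_{ijk}\delta y^k$. Its curvature forms are $\Omega_j^i=d\omega_j^i-\omega_j^k\wedge\omega_k^i=\frac12R_{j\ kl}^{\ i}dx^k\wedge dx^l+P_{j\ kl}^{\ i}dx^k\wedge\delta y^l$. $(M,\mathbf{F})$ is a Berwald manifold if $P=0$ (all $P_{j\ kl}^{\ i}=0$), and a Landsberg manifold if the Landsberg curvature $L=\frac{y^j}{F}P_{j\ kl}^{\ i}(dx^k\wedge\delta y^l)\otimes\frac{\delta}{\delta x^i}$ vanishes. $S$-curvature: let $dV_M=\sigma(x)dx^1\wedge\cdots\wedge dx^n$ be any volume form on $M$. The distortion of $(M,\mathbf{F})$ is the function $\tau=\ln\frac{\sqrt{\det(g_{ij})}}{\sigma(x)}$ on $TM_0$, and the $S$-curvature of $(M,\mathbf{F})$ is $S=\mathbf{G}(\tau)$, where $\mathbf{G}=y^i\frac{\partial}{\partial x^i}-2G^i\frac{\partial}{\partial y^i}$.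
   Formalization: In (1), "vanishing S-curvature" is read as: S = 0 for some volume form (positive smooth density) on M; for an arbitrary fixed dV_M, (4)⇒(1) fails, e.g. Euclidean space with a non-constant density. *)

theory Defs
  imports "HOL-Analysis.Analysis"
begin

section \<open>Smooth maps between Euclidean spaces\<close>

text \<open>Both notions are meant for open sets \<open>S\<close>.\<close>

fun Ck_on :: "nat \<Rightarrow> 'a::euclidean_space set \<Rightarrow> ('a \<Rightarrow> 'b::euclidean_space) \<Rightarrow> bool" where
  "Ck_on 0 S f \<longleftrightarrow> continuous_on S f"
| "Ck_on (Suc k) S f \<longleftrightarrow> (\<forall>x\<in>S. f differentiable (at x)) \<and>
      (\<forall>v. Ck_on k S (\<lambda>x. frechet_derivative f (at x) v))"

definition smooth_on :: "'a::euclidean_space set \<Rightarrow> ('a \<Rightarrow> 'b::euclidean_space) \<Rightarrow> bool" where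
  "smooth_on S f \<longleftrightarrow> (\<forall>k. Ck_on k S f)"

section \<open>Smooth manifolds and the tangent bundle\<close>

text \<open>A chart \<open>(U, \<phi>)\<close> consists of its domain and its coordinate map; the dimension of the
  manifold is \<open>CARD('n)\<close>. The values of \<open>\<phi>\<close> outside \<open>U\<close> are irrelevant. The smooth structure is
  the one generated by the atlas \<open>A\<close>, which need not be maximal.\<close>

type_synonym ('m, 'n) chart = "'m set \<times> ('m \<Rightarrow> real ^ 'n)"

definition chart_image :: "('m, 'n::finite) chart \<Rightarrow> (real ^ 'n) set" where
  "chart_image c = snd c ` fst c"

definition transition :: "('m, 'n::finite) chart \<Rightarrow> ('m, 'n) chart \<Rightarrow> real ^ 'n \<Rightarrow> real ^ 'n" where
  "transition c d = snd d \<circ> inv_into (fst c) (snd c)"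

definition smooth_manifold :: "'m topology \<Rightarrow> ('m, 'n::finite) chart set \<Rightarrow> bool" where
  "smooth_manifold X A \<longleftrightarrow>
     Hausdorff_space X \<and> second_countable X \<and>
     (\<forall>c\<in>A. openin X (fst c) \<and> open (chart_image c) \<and>
        homeomorphic_map (subtopology X (fst c)) (top_of_set (chart_image c)) (snd c)) \<and>
     (\<Union>c\<in>A. fst c) = topspace X \<and>
     (\<forall>c\<in>A. \<forall>d\<in>A. smooth_on (snd c ` (fst c \<inter> fst d)) (transition c d))"

text \<open>A tangent vector at \<open>p\<close> is the family of its components with respect to all charts around
  \<open>p\<close>, which transform by the Jacobians of the coordinate changes. The value \<open>0\<close> at all other
  charts only makes the family unique.\<close>

type_synonym ('m, 'n) tvec = "('m, 'n) chart \<Rightarrow> real ^ 'n"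

definition tangent_space :: "('m, 'n::finite) chart set \<Rightarrow> 'm \<Rightarrow> ('m, 'n) tvec set" where
  "tangent_space A p = {v.
     (\<forall>c\<in>A. \<forall>d\<in>A. p \<in> fst c \<longrightarrow> p \<in> fst d \<longrightarrow>
        v d = frechet_derivative (transition c d) (at (snd c p)) (v c)) \<and>
     (\<forall>c. \<not> (c \<in> A \<and> p \<in> fst c) \<longrightarrow> v c = 0)}"

definition tangent_bundle ::
    "'m topology \<Rightarrow> ('m, 'n::finite) chart set \<Rightarrow> ('m \<times> ('m, 'n) tvec) set" where
  "tangent_bundle X A = {(p, v). p \<in> topspace X \<and> v \<in> tangent_space A p}"

text \<open>The coordinate expression of a function on the tangent bundle in the coordinates
  \<open>(x, y)\<close> induced by a chart.\<close>

definition in_coords ::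
    "'m topology \<Rightarrow> ('m, 'n::finite) chart set \<Rightarrow> ('m, 'n) chart \<Rightarrow>
     ('m \<times> ('m, 'n) tvec \<Rightarrow> real) \<Rightarrow> (real ^ 'n) \<times> (real ^ 'n) \<Rightarrow> real" where
  "in_coords X A c f =
     f \<circ> inv_into {t \<in> tangent_bundle X A. fst t \<in> fst c} (\<lambda>(p, v). (snd c p, v c))"

text \<open>The coordinate ranges of the parts of \<open>TM\<close> and of \<open>TM\<^sub>0\<close> over a chart.\<close>

definition tm_image :: "('m, 'n::finite) chart \<Rightarrow> ((real ^ 'n) \<times> (real ^ 'n)) set" where
  "tm_image c = chart_image c \<times> UNIV"

definition slit_image :: "('m, 'n::finite) chart \<Rightarrow> ((real ^ 'n) \<times> (real ^ 'n)) set" where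
  "slit_image c = chart_image c \<times> (UNIV - {0})"

definition smooth_on_TM0 ::
    "'m topology \<Rightarrow> ('m, 'n::finite) chart set \<Rightarrow> ('m \<times> ('m, 'n) tvec \<Rightarrow> real) \<Rightarrow> bool" where
  "smooth_on_TM0 X A f \<longleftrightarrow> (\<forall>c\<in>A. smooth_on (slit_image c) (in_coords X A c f))"

section \<open>Differential forms in the coordinates \<open>(x, y)\<close>\<close>

type_synonym 'n pt = "(real ^ 'n) \<times> (real ^ 'n)"

definition pdx :: "'n::finite \<Rightarrow> ('n pt \<Rightarrow> real) \<Rightarrow> 'n pt \<Rightarrow> real" where
  "pdx i f z = frechet_derivative f (at z) (axis i 1, 0)"

definition pdy :: "'n::finite \<Rightarrow> ('n pt \<Rightarrow> real) \<Rightarrow> 'n pt \<Rightarrow> real" where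
  "pdy i f z = frechet_derivative f (at z) (0, axis i 1)"

definition dx :: "'n::finite \<Rightarrow> 'n pt \<Rightarrow> real" where
  "dx i u = fst u $ i"

definition dy :: "'n::finite \<Rightarrow> 'n pt \<Rightarrow> real" where
  "dy i u = snd u $ i"

definition wedge :: "('n::finite pt \<Rightarrow> real) \<Rightarrow> ('n pt \<Rightarrow> real) \<Rightarrow> 'n pt \<Rightarrow> 'n pt \<Rightarrow> real" where
  "wedge \<alpha> \<beta> u v = \<alpha> u * \<beta> v - \<alpha> v * \<beta> u"

text \<open>Exterior derivative of the one-form \<open>\<alpha>\<close>, where \<open>\<alpha> z u\<close> is its value at the point \<open>z\<close> on
  the vector \<open>u\<close>; constant vector fields commute, so there is no bracket term.\<close>

definition ext_d :: "('n::finite pt \<Rightarrow> 'n pt \<Rightarrow> real) \<Rightarrow> 'n pt \<Rightarrow> 'n pt \<Rightarrow> 'n pt \<Rightarrow> real" where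
  "ext_d \<alpha> z u v =
     frechet_derivative (\<lambda>w. \<alpha> w v) (at z) u - frechet_derivative (\<lambda>w. \<alpha> w u) (at z) v"

section \<open>Local Finsler geometry\<close>

text \<open>Here \<open>F\<close> is the coordinate expression of the Finsler structure.\<close>

definition fund :: "('n::finite pt \<Rightarrow> real) \<Rightarrow> 'n pt \<Rightarrow> real ^ 'n ^ 'n" where
  "fund F z = (\<chi> i j. 1/2 * pdy j (pdy i (\<lambda>w. (F w)\<^sup>2)) z)"

definition fund_inv :: "('n::finite pt \<Rightarrow> real) \<Rightarrow> 'n pt \<Rightarrow> real ^ 'n ^ 'n" where
  "fund_inv F z = matrix_inv (fund F z)"

definition spray :: "('n::finite pt \<Rightarrow> real) \<Rightarrow> 'n \<Rightarrow> 'n pt \<Rightarrow> real" where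
  "spray F i z = 1/4 * (\<Sum>j\<in>UNIV. fund_inv F z $ i $ j *
     ((\<Sum>k\<in>UNIV. pdx k (pdy j (\<lambda>w. (F w)\<^sup>2)) z * snd z $ k) - pdx j (\<lambda>w. (F w)\<^sup>2) z))"

text \<open>\<open>nonlin F i j\<close> is \<open>N\<close> with upper index \<open>i\<close> and lower index \<open>j\<close>.\<close>

definition nonlin :: "('n::finite pt \<Rightarrow> real) \<Rightarrow> 'n \<Rightarrow> 'n \<Rightarrow> 'n pt \<Rightarrow> real" where
  "nonlin F i j = pdy j (spray F i)"

definition delta_x :: "('n::finite pt \<Rightarrow> real) \<Rightarrow> 'n pt \<Rightarrow> 'n \<Rightarrow> 'n pt" where
  "delta_x F z i = (axis i 1, - (\<Sum>j\<in>UNIV. nonlin F j i z *\<^sub>R axis j 1))"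

definition delta_y :: "('n::finite pt \<Rightarrow> real) \<Rightarrow> 'n pt \<Rightarrow> 'n \<Rightarrow> 'n pt \<Rightarrow> real" where
  "delta_y F z i u = 1 / F z * (dy i u + (\<Sum>j\<in>UNIV. nonlin F i j z * dx j u))"

definition cartan :: "('n::finite pt \<Rightarrow> real) \<Rightarrow> 'n \<Rightarrow> 'n \<Rightarrow> 'n \<Rightarrow> 'n pt \<Rightarrow> real" where
  "cartan F i j k z = 1/4 * F z * pdy k (pdy j (pdy i (\<lambda>w. (F w)\<^sup>2))) z"

definition cartan_form :: "('n::finite pt \<Rightarrow> real) \<Rightarrow> 'n pt \<Rightarrow> 'n pt \<Rightarrow> real" where
  "cartan_form F z u =
     (\<Sum>i\<in>UNIV. \<Sum>j\<in>UNIV. \<Sum>k\<in>UNIV. fund_inv F z $ i $ j * cartan F i j k z * delta_y F z k u)"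

text \<open>The Chern connection forms at \<open>z\<close>: \<open>chern F z j i\<close> has lower index \<open>j\<close> and upper index
  \<open>i\<close>. The structure equations contain no derivatives of the forms, so that they determine them
  pointwise.\<close>

definition is_chern :: "('n::finite pt \<Rightarrow> real) \<Rightarrow> 'n pt \<Rightarrow> ('n \<Rightarrow> 'n \<Rightarrow> 'n pt \<Rightarrow> real) \<Rightarrow> bool" where
  "is_chern F z \<omega> \<longleftrightarrow>
     (\<forall>i j. linear (\<omega> j i)) \<and>
     (\<forall>i u v. (\<Sum>j\<in>UNIV. wedge (dx j) (\<omega> j i) u v) = 0) \<and>
     (\<forall>i j u. frechet_derivative (\<lambda>w. fund F w $ i $ j) (at z) u
          - (\<Sum>k\<in>UNIV. fund F z $ k $ j * \<omega> i k u) - (\<Sum>k\<in>UNIV. fund F z $ i $ k * \<omega> j k u)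
        = 2 * (\<Sum>k\<in>UNIV. cartan F i j k z * delta_y F z k u))"

definition chern :: "('n::finite pt \<Rightarrow> real) \<Rightarrow> 'n pt \<Rightarrow> 'n \<Rightarrow> 'n \<Rightarrow> 'n pt \<Rightarrow> real" where
  "chern F z = (THE \<omega>. is_chern F z \<omega>)"

definition chern_curv ::
    "('n::finite pt \<Rightarrow> real) \<Rightarrow> 'n pt \<Rightarrow> 'n \<Rightarrow> 'n \<Rightarrow> 'n pt \<Rightarrow> 'n pt \<Rightarrow> real" where
  "chern_curv F z j i u v =
     ext_d (\<lambda>w. chern F w j i) z u v
     - (\<Sum>k\<in>UNIV. wedge (chern F z j k) (chern F z k i) u v)"

text \<open>\<open>P_curv F z j i k l\<close> has upper index \<open>i\<close> and lower indices \<open>j, k, l\<close>. The decomposition of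
  the curvature forms determines it, since the forms \<open>dx\<close> and \<open>\<delta>y\<close> are a coframe.\<close>

definition P_curv :: "('n::finite pt \<Rightarrow> real) \<Rightarrow> 'n pt \<Rightarrow> 'n \<Rightarrow> 'n \<Rightarrow> 'n \<Rightarrow> 'n \<Rightarrow> real" where
  "P_curv F z = (THE P. \<exists>R. \<forall>i j u v. chern_curv F z j i u v =
       1/2 * (\<Sum>k\<in>UNIV. \<Sum>l\<in>UNIV. R j i k l * wedge (dx k) (dx l) u v)
       + (\<Sum>k\<in>UNIV. \<Sum>l\<in>UNIV. P j i k l * wedge (dx k) (delta_y F z l) u v))"

definition landsberg_curv :: "('n::finite pt \<Rightarrow> real) \<Rightarrow> 'n pt \<Rightarrow> 'n pt \<Rightarrow> 'n pt \<Rightarrow> 'n pt" where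
  "landsberg_curv F z u v =
     (\<Sum>i\<in>UNIV. \<Sum>j\<in>UNIV. \<Sum>k\<in>UNIV. \<Sum>l\<in>UNIV.
        (snd z $ j / F z * P_curv F z j i k l * wedge (dx k) (delta_y F z l) u v) *\<^sub>R delta_x F z i)"

text \<open>Distortion and \<open>S\<close>-curvature with respect to \<open>\<sigma>(x) dx\<^sup>1 \<and> \<dots> \<and> dx\<^sup>n\<close>.\<close>

definition distortion :: "('n::finite pt \<Rightarrow> real) \<Rightarrow> (real ^ 'n \<Rightarrow> real) \<Rightarrow> 'n pt \<Rightarrow> real" where
  "distortion F \<sigma> z = ln (sqrt (det (fund F z)) / \<sigma> (fst z))"

definition S_curv :: "('n::finite pt \<Rightarrow> real) \<Rightarrow> (real ^ 'n \<Rightarrow> real) \<Rightarrow> 'n pt \<Rightarrow> real" where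
  "S_curv F \<sigma> z =
     (\<Sum>i\<in>UNIV. snd z $ i * pdx i (distortion F \<sigma>) z)
     - 2 * (\<Sum>i\<in>UNIV. spray F i z * pdy i (distortion F \<sigma>) z)"

section \<open>Finsler manifolds\<close>

definition finsler_structure ::
    "'m topology \<Rightarrow> ('m, 'n::finite) chart set \<Rightarrow> ('m \<times> ('m, 'n) tvec \<Rightarrow> real) \<Rightarrow> bool" where
  "finsler_structure X A \<F> \<longleftrightarrow>
     (\<forall>c\<in>A. continuous_on (tm_image c) (in_coords X A c \<F>)) \<and>
     smooth_on_TM0 X A \<F> \<and>
     (\<forall>(p, v)\<in>tangent_bundle X A. 0 \<le> \<F> (p, v)) \<and>
     (\<forall>(p, v)\<in>tangent_bundle X A. \<forall>a>0. \<F> (p, \<lambda>c. a *\<^sub>R v c) = a * \<F> (p, v)) \<and>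
     (\<forall>c\<in>A. \<forall>z\<in>slit_image c. \<forall>w. w \<noteq> 0 \<longrightarrow> 0 < w \<bullet> (fund (in_coords X A c \<F>) z *v w))"

definition finsler_manifold ::
    "'m topology \<Rightarrow> ('m, 'n::finite) chart set \<Rightarrow> ('m \<times> ('m, 'n) tvec \<Rightarrow> real) \<Rightarrow> bool" where
  "finsler_manifold X A \<F> \<longleftrightarrow> smooth_manifold X A \<and> finsler_structure X A \<F>"

definition berwald ::
    "'m topology \<Rightarrow> ('m, 'n::finite) chart set \<Rightarrow> ('m \<times> ('m, 'n) tvec \<Rightarrow> real) \<Rightarrow> bool" where
  "berwald X A \<F> \<longleftrightarrow>
     (\<forall>c\<in>A. \<forall>z\<in>slit_image c. \<forall>i j k l. P_curv (in_coords X A c \<F>) z j i k l = 0)"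

definition landsberg ::
    "'m topology \<Rightarrow> ('m, 'n::finite) chart set \<Rightarrow> ('m \<times> ('m, 'n) tvec \<Rightarrow> real) \<Rightarrow> bool" where
  "landsberg X A \<F> \<longleftrightarrow>
     (\<forall>c\<in>A. \<forall>z\<in>slit_image c. \<forall>u v. landsberg_curv (in_coords X A c \<F>) z u v = 0)"

definition cartan_form_closed ::
    "'m topology \<Rightarrow> ('m, 'n::finite) chart set \<Rightarrow> ('m \<times> ('m, 'n) tvec \<Rightarrow> real) \<Rightarrow> bool" where
  "cartan_form_closed X A \<F> \<longleftrightarrow>
     (\<forall>c\<in>A. \<forall>z\<in>slit_image c. \<forall>u v. ext_d (cartan_form (in_coords X A c \<F>)) z u v = 0)"

definition cartan_form_exact ::
    "'m topology \<Rightarrow> ('m, 'n::finite) chart set \<Rightarrow> ('m \<times> ('m, 'n) tvec \<Rightarrow> real) \<Rightarrow> bool" where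
  "cartan_form_exact X A \<F> \<longleftrightarrow>
     (\<exists>f. smooth_on_TM0 X A f \<and>
        (\<forall>c\<in>A. \<forall>z\<in>slit_image c. \<forall>u. cartan_form (in_coords X A c \<F>) z u =
            frechet_derivative (in_coords X A c f) (at z) u))"

text \<open>A volume form is a positive density: a positive coefficient \<open>\<sigma> c\<close> for every chart \<open>c\<close>, with
  the absolute value of the Jacobian in the transformation law. This is what makes the distortion
  a well-defined function on \<open>TM\<^sub>0\<close>, and it does not require \<open>M\<close> to be orientable.\<close>

definition volume_form ::
    "('m, 'n::finite) chart set \<Rightarrow> (('m, 'n) chart \<Rightarrow> real ^ 'n \<Rightarrow> real) \<Rightarrow> bool" where
  "volume_form A \<sigma> \<longleftrightarrow>
     (\<forall>c\<in>A. smooth_on (chart_image c) (\<sigma> c) \<and> (\<forall>x\<in>chart_image c. 0 < \<sigma> c x)) \<and>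
     (\<forall>c\<in>A. \<forall>d\<in>A. \<forall>p\<in>fst c \<inter> fst d. \<sigma> c (snd c p) =
        \<bar>det (matrix (frechet_derivative (transition c d) (at (snd c p))))\<bar> * \<sigma> d (snd d p))"

definition vanishing_S ::
    "'m topology \<Rightarrow> ('m, 'n::finite) chart set \<Rightarrow> ('m \<times> ('m, 'n) tvec \<Rightarrow> real) \<Rightarrow>
     (('m, 'n) chart \<Rightarrow> real ^ 'n \<Rightarrow> real) \<Rightarrow> bool" where
  "vanishing_S X A \<F> \<sigma> \<longleftrightarrow>
     (\<forall>c\<in>A. \<forall>z\<in>slit_image c. S_curv (in_coords X A c \<F>) (\<sigma> c) z = 0)"

end

theory Submission
  imports Defs
begin

text \<open>Let \<open>B = \<partial>\<Gamma>/\<partial>y\<close> be the fibre derivative of the Christoffel symbols of the Chern connection, so that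
  \<open>P = -F B\<close>. On a Landsberg manifold \<open>\<Gamma>\<close> is the fibre derivative of \<open>N\<close>, and differentiating the
  metric compatibility in \<open>y\<close> shows that \<open>B\<close> with its upper index lowered is totally symmetric. The
  form \<open>\<eta>\<close> differs from the exact form \<open>d ln \<surd>det g\<close> by \<open>H\<^sub>k dx\<^sup>k\<close> with \<open>H\<^sub>k = \<Gamma>\<^sup>m\<^sub>m\<^sub>k\<close>; if \<open>d\<eta> = 0\<close>, then \<open>H\<^sub>k\<close>
  does not depend on \<open>y\<close>, so the trace of \<open>B\<close> vanishes, and by symmetry each \<open>f = N\<^sup>i\<^sub>j\<close> solves
  \<open>g\<^sup>a\<^sup>b \<partial>\<^sub>a \<partial>\<^sub>b f = 0\<close> on every punctured tangent space. A solution that is homogeneous of degree one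
  is linear: \<open>det g \<bar>Hess f\<bar>\<^sup>2\<close> is the divergence of a vector field tangent to the level sets of \<open>F\<close>, so its
  integral over a shell is zero (this is Hilbert's argument for the Brunn--Minkowski spectral gap).
  Hence \<open>B = 0\<close>.

  Vanishing S-curvature on a Landsberg manifold gives \<open>H\<^sub>k = \<partial>\<^sub>k ln \<sigma>\<close> after differentiating \<open>S\<close> in \<open>y\<close>,
  so \<open>\<eta> = d\<tau>\<close>. Conversely, on a Berwald manifold the function \<open>max\<^sub>y ln \<surd>det g\<close> of \<open>x\<close> has the
  differential \<open>H\<^sub>k dx\<^sup>k\<close> by an envelope argument, and its exponential is a volume form with
  vanishing S-curvature whose distortion is a global primitive of \<open>\<eta>\<close>.\<close>

section \<open>Calculus of smooth functions\<close>

text \<open>Closedness of \<open>\<eta>\<close> by itself yields only local primitives, and the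
  topology of the base could obstruct a global one. The maximum over the fibre is a canonical
  choice: under a change of charts it gains the same \<open>ln |det J|\<close> as the logarithm of
  \<open>\<surd>det g\<close>, so the difference of the two is a function on the slit tangent
  bundle. Such a maximum is in general not differentiable in \<open>x\<close>, because the maximum
  point may jump; here it is, because the horizontal derivative of \<open>ln \<surd>det g\<close>
  has become independent of \<open>y\<close>.

  In the rigidity step the solutions are smooth only off the origin, which confines the integration
  to a shell. Tangency to the level sets of \<open>F\<close> takes care of the boundary: a cutoff
  that depends on \<open>F\<close> alone contributes nothing to the divergence. The computation
  rests on the metric of a fibre being a Hessian, that of \<open>F^2 / 2\<close>, so that its fibre
  derivative is symmetric in all three indices. This makes the cofactor matrix divergence free and
  lets the terms with derivatives of the metric cancel against the third derivatives of the
  solution.\<close>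

lemma Ck_on_SucD: "Ck_on (Suc k) S f \<Longrightarrow> Ck_on k S f"
proof (induction k arbitrary: f)
  case 0
  then show ?case
    by (auto intro!: continuous_at_imp_continuous_on differentiable_imp_continuous_within)
next
  case (Suc k)
  then show ?case using Ck_on.simps(2) by blast
qed

lemma smooth_onD: "smooth_on S f \<Longrightarrow> Ck_on k S f"
  by (simp add: smooth_on_def)

lemma smooth_onI: "(\<And>k. Ck_on k S f) \<Longrightarrow> smooth_on S f"
  by (simp add: smooth_on_def)

lemma smooth_on_differentiable: "smooth_on S f \<Longrightarrow> x \<in> S \<Longrightarrow> f differentiable (at x)"
  using smooth_onD[of S f "Suc 0"] by simp

lemma smooth_on_continuous: "smooth_on S f \<Longrightarrow> continuous_on S f"
  using smooth_onD[of S f 0] by simp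

lemma smooth_on_frechet: "smooth_on S f \<Longrightarrow> smooth_on S (\<lambda>x. frechet_derivative f (at x) v)"
  by (rule smooth_onI) (use smooth_onD[of S f "Suc _"] in simp)

lemma Ck_on_cong:
  assumes "open S" "\<And>x. x \<in> S \<Longrightarrow> f x = g x" "Ck_on k S f"
  shows "Ck_on k S g"
  using assms(2,3)
proof (induction k arbitrary: f g)
  case 0
  then show ?case using continuous_on_cong by (metis Ck_on.simps(1))
next
  case (Suc k)
  have D: "f differentiable (at x)" if "x \<in> S" for x using Suc.prems that by simp
  have E: "(g has_derivative frechet_derivative f (at x)) (at x)" if "x \<in> S" for x
    using has_derivative_transform_within_open[of f _ x UNIV S g] D[OF that] Suc.prems(1) assms(1) that
    by (simp add: frechet_derivative_works)
  have "frechet_derivative f (at x) = frechet_derivative g (at x)" if "x \<in> S" for x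
    using E[OF that] frechet_derivative_at by blast
  then have "Ck_on k S (\<lambda>x. frechet_derivative g (at x) v)" for v
    using Suc.IH[of "\<lambda>x. frechet_derivative f (at x) v" "\<lambda>x. frechet_derivative g (at x) v"]
      Suc.prems(2) by simp
  then show ?case using E by (auto simp: differentiable_def)
qed

text \<open>An explicit formula may stand in for \<open>frechet_derivative\<close>. Most closure
  rules below are then inductions on \<open>k\<close> that apply the hypothesis to the formula for
  the derivative.\<close>

lemma Ck_on_SucI:
  assumes "open S" "\<And>x. x \<in> S \<Longrightarrow> (f has_derivative f' x) (at x)" "\<And>v. Ck_on k S (\<lambda>x. f' x v)"
  shows "Ck_on (Suc k) S f"
proof -
  have "f' x = frechet_derivative f (at x)" if "x \<in> S" for x
    using assms(2)[OF that] frechet_derivative_at by blast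
  then have "Ck_on k S (\<lambda>x. frechet_derivative f (at x) v)" for v
    using Ck_on_cong[OF assms(1) _ assms(3)[of v], of "\<lambda>x. frechet_derivative f (at x) v"] by simp
  then show ?thesis using assms(2) by (auto simp: differentiable_def)
qed

lemma Ck_on_Suc_has_derivative:
  "Ck_on (Suc k) S f \<Longrightarrow> x \<in> S \<Longrightarrow> (f has_derivative frechet_derivative f (at x)) (at x)"
  by (simp add: frechet_derivative_works)

lemma Ck_on_const: "open S \<Longrightarrow> Ck_on k S (\<lambda>x. c)"
proof (induction k arbitrary: c)
  case (Suc k)
  then show ?case by (intro Ck_on_SucI[where f'="\<lambda>x v. 0"]) auto
qed auto

lemma Ck_on_bounded_linear:
  assumes "open S" "bounded_linear L"
  shows "Ck_on k S L"
proof (cases k)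
  case 0
  then show ?thesis using linear_continuous_on[OF assms(2)] by simp
next
  case (Suc m)
  then show ?thesis
    using Ck_on_SucI[OF assms(1) bounded_linear_imp_has_derivative[OF assms(2)]]
      Ck_on_const[OF assms(1)] by blast
qed

lemma Ck_on_linear_compose:
  assumes "open S" "bounded_linear L" "Ck_on k S f"
  shows "Ck_on k S (\<lambda>x. L (f x))"
  using assms(3)
proof (induction k arbitrary: f)
  case 0
  then show ?case using bounded_linear.continuous_on[OF assms(2)] by simp
next
  case (Suc k)
  show ?case
    by (rule Ck_on_SucI[OF assms(1) bounded_linear.has_derivative[OF assms(2)
          Ck_on_Suc_has_derivative[OF Suc.prems]]])
      (use Suc in auto)
qed

lemma Ck_on_add:
  assumes "open S" "Ck_on k S f" "Ck_on k S g"
  shows "Ck_on k S (\<lambda>x. f x + g x)"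
  using assms(2,3)
proof (induction k arbitrary: f g)
  case 0
  then show ?case by (simp add: continuous_on_add)
next
  case (Suc k)
  show ?case
    by (rule Ck_on_SucI[OF assms(1) has_derivative_add[OF
          Ck_on_Suc_has_derivative[OF Suc.prems(1)] Ck_on_Suc_has_derivative[OF Suc.prems(2)]]])
      (use Suc in auto)
qed

lemma Ck_on_sum:
  assumes "open S" "\<And>i. i \<in> I \<Longrightarrow> Ck_on k S (f i)"
  shows "Ck_on k S (\<lambda>x. \<Sum>i\<in>I. f i x)"
  using assms(2)
  by (induction I rule: infinite_finite_induct)
    (auto intro: Ck_on_add[OF assms(1)] Ck_on_const[OF assms(1)])

lemma Ck_on_mult:
  fixes f g :: "'a::euclidean_space \<Rightarrow> real"
  assumes "open S" "Ck_on k S f" "Ck_on k S g"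
  shows "Ck_on k S (\<lambda>x. f x * g x)"
  using assms(2,3)
proof (induction k arbitrary: f g)
  case 0
  then show ?case by (simp add: continuous_on_mult)
next
  case (Suc k)
  show ?case
    by (rule Ck_on_SucI[OF assms(1) has_derivative_mult[OF
          Ck_on_Suc_has_derivative[OF Suc.prems(1)] Ck_on_Suc_has_derivative[OF Suc.prems(2)]]])
      (use Suc Ck_on_SucD[OF Suc.prems(1)] Ck_on_SucD[OF Suc.prems(2)] in
        \<open>auto intro!: Ck_on_add[OF assms(1)]\<close>)
qed

lemma frechet_derivative_Basis:
  assumes "f differentiable (at x)"
  shows "frechet_derivative f (at x) v = (\<Sum>b\<in>Basis. (v \<bullet> b) *\<^sub>R frechet_derivative f (at x) b)"
proof -
  have "linear (frechet_derivative f (at x))"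
    using assms linear_frechet_derivative by blast
  then have "frechet_derivative f (at x) (\<Sum>b\<in>Basis. (v \<bullet> b) *\<^sub>R b)
      = (\<Sum>b\<in>Basis. (v \<bullet> b) *\<^sub>R frechet_derivative f (at x) b)"
    by (simp add: linear_sum linear_cmul)
  then show ?thesis by (simp add: euclidean_representation)
qed

lemma Ck_on_compose:
  fixes f :: "'a::euclidean_space \<Rightarrow> 'b::euclidean_space" and g :: "'b \<Rightarrow> real"
  assumes "open S" "Ck_on k S f" "Ck_on k T g" "f ` S \<subseteq> T"
  shows "Ck_on k S (\<lambda>x. g (f x))"
  using assms(2,3)
proof (induction k arbitrary: g)
  case 0
  then show ?case using assms(4) by (auto intro: continuous_on_compose2)
next
  case (Suc k)
  have f: "Ck_on k S f" using Suc.prems Ck_on_SucD by blast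
  have g: "(g has_derivative frechet_derivative g (at (f x))) (at (f x))" if "x \<in> S" for x
    using Ck_on_Suc_has_derivative[OF Suc.prems(2)] assms(4) that by blast
  \<comment> \<open>The chain rule evaluates the derivative of \<open>g\<close> in a direction that
    moves with \<open>x\<close>. Expanding it along \<open>Basis\<close> leaves derivatives in fixed
    directions, to which the induction hypothesis applies.\<close>
  have "((\<lambda>x. g (f x)) has_derivative
       (\<lambda>v. \<Sum>b\<in>Basis. (frechet_derivative f (at x) v \<bullet> b) * frechet_derivative g (at (f x)) b)) (at x)"
    if "x \<in> S" for x
  proof -
    have "(\<lambda>v. frechet_derivative g (at (f x)) (frechet_derivative f (at x) v)) =
       (\<lambda>v. \<Sum>b\<in>Basis. (frechet_derivative f (at x) v \<bullet> b) * frechet_derivative g (at (f x)) b)"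
      by (rule ext) (rule trans[OF frechet_derivative_Basis[OF differentiableI[OF g[OF that]]]], simp)
    then show ?thesis
      using has_derivative_compose[OF Ck_on_Suc_has_derivative[OF Suc.prems(1) that] g[OF that]]
      by simp
  qed
  then show ?case
  proof (rule Ck_on_SucI[OF assms(1)])
    fix v
    show "Ck_on k S (\<lambda>x. \<Sum>b\<in>Basis. (frechet_derivative f (at x) v \<bullet> b) * frechet_derivative g (at (f x)) b)"
    proof (intro Ck_on_sum Ck_on_mult assms(1))
      fix b :: 'b
      show "Ck_on k S (\<lambda>x. frechet_derivative f (at x) v \<bullet> b)"
        by (rule Ck_on_linear_compose[OF assms(1) bounded_linear_inner_left]) (use Suc.prems(1) in simp)
      show "Ck_on k S (\<lambda>x. frechet_derivative g (at (f x)) b)"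
        using Suc.IH[OF f, of "\<lambda>y. frechet_derivative g (at y) b"] Suc.prems(2) by simp
    qed
  qed
qed

lemma smooth_on_compose:
  fixes f :: "'a::euclidean_space \<Rightarrow> 'b::euclidean_space" and g :: "'b \<Rightarrow> real"
  assumes "open S" "smooth_on S f" "smooth_on T g" "f ` S \<subseteq> T"
  shows "smooth_on S (\<lambda>x. g (f x))"
  by (rule smooth_onI, rule Ck_on_compose[OF assms(1) smooth_onD[OF assms(2)] smooth_onD[OF assms(3)] assms(4)])

lemma smooth_on_cong:
  assumes "open S" "\<And>x. x \<in> S \<Longrightarrow> f x = g x" "smooth_on S f"
  shows "smooth_on S g"
  by (rule smooth_onI, rule Ck_on_cong[OF assms(1,2)]) (use assms(3) in \<open>auto dest: smooth_onD\<close>)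

lemma smooth_on_const: "open S \<Longrightarrow> smooth_on S (\<lambda>x. c)"
  by (rule smooth_onI, rule Ck_on_const) (auto dest: smooth_onD)

lemma smooth_on_bounded_linear: "open S \<Longrightarrow> bounded_linear L \<Longrightarrow> smooth_on S L"
  by (rule smooth_onI, rule Ck_on_bounded_linear) (auto dest: smooth_onD)

lemma smooth_on_linear_compose:
  "open S \<Longrightarrow> bounded_linear L \<Longrightarrow> smooth_on S f \<Longrightarrow> smooth_on S (\<lambda>x. L (f x))"
  by (rule smooth_onI, rule Ck_on_linear_compose) (auto dest: smooth_onD)

lemma smooth_on_add:
  "open S \<Longrightarrow> smooth_on S f \<Longrightarrow> smooth_on S g \<Longrightarrow> smooth_on S (\<lambda>x. f x + g x)"
  by (rule smooth_onI, rule Ck_on_add) (auto dest: smooth_onD)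

lemma smooth_on_sum:
  "open S \<Longrightarrow> (\<And>i. i \<in> I \<Longrightarrow> smooth_on S (f i)) \<Longrightarrow> smooth_on S (\<lambda>x. \<Sum>i\<in>I. f i x)"
  by (rule smooth_onI, rule Ck_on_sum) (auto dest: smooth_onD)

lemma smooth_on_mult:
  fixes f g :: "'a::euclidean_space \<Rightarrow> real"
  shows "open S \<Longrightarrow> smooth_on S f \<Longrightarrow> smooth_on S g \<Longrightarrow> smooth_on S (\<lambda>x. f x * g x)"
  by (rule smooth_onI, rule Ck_on_mult) (auto dest: smooth_onD)

lemma smooth_on_minus:
  "open S \<Longrightarrow> smooth_on S f \<Longrightarrow> smooth_on S (\<lambda>x. - f x)"
  by (rule smooth_on_linear_compose[OF _ bounded_linear_minus[OF bounded_linear_ident]])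

lemma smooth_on_diff:
  "open S \<Longrightarrow> smooth_on S f \<Longrightarrow> smooth_on S g \<Longrightarrow> smooth_on S (\<lambda>x. f x - g x)"
  using smooth_on_add[OF _ _ smooth_on_minus, of S f g] by simp

lemma smooth_on_prod:
  fixes f :: "'i \<Rightarrow> 'a::euclidean_space \<Rightarrow> real"
  assumes "open S" "\<And>i. i \<in> I \<Longrightarrow> smooth_on S (f i)"
  shows "smooth_on S (\<lambda>x. \<Prod>i\<in>I. f i x)"
  using assms(2)
  by (induction I rule: infinite_finite_induct)
    (auto intro: smooth_on_mult[OF assms(1)] smooth_on_const[OF assms(1)])

section \<open>Reciprocal, logarithm and exponential\<close>

lemma Ck_on_inverse_real: "Ck_on k (- {0}) (inverse :: real \<Rightarrow> real)"
proof (induction k)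
  case 0
  then show ?case by (auto intro!: continuous_intros)
next
  case (Suc k)
  have o: "open (- {0::real})" by (simp add: open_Compl)
  show ?case
  proof (rule Ck_on_SucI[OF o])
    show "(inverse has_derivative (\<lambda>v. - (inverse x * v * inverse x))) (at x)" if "x \<in> - {0}" for x :: real
      using that has_derivative_inverse'[of x UNIV] by simp
    show "Ck_on k (- {0}) (\<lambda>x. - (inverse x * v * inverse x))" for v :: real
      using Ck_on_mult[OF o Ck_on_mult[OF o Suc Ck_on_const[OF o, of k "-v"]] Suc] by simp
  qed
qed

lemma smooth_on_ln: "smooth_on {0<..} (ln :: real \<Rightarrow> real)"
  unfolding smooth_on_def
proof
  fix k show "Ck_on k {0<..} (ln :: real \<Rightarrow> real)"
  proof (cases k)
    case 0
    then show ?thesis by (auto intro!: continuous_intros)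
  next
    case (Suc m)
    have o: "open {0::real<..}" by simp
    have i: "Ck_on m {0<..} (inverse :: real \<Rightarrow> real)"
      using Ck_on_compose[OF o Ck_on_bounded_linear[OF o bounded_linear_ident] Ck_on_inverse_real] by auto
    show ?thesis unfolding Suc
    proof (rule Ck_on_SucI[OF o])
      show "(ln has_derivative (\<lambda>v. inverse x * v)) (at x)" if "x \<in> {0<..}" for x :: real
        using that DERIV_ln[of x] by (simp add: has_field_derivative_def)
    qed (rule Ck_on_mult[OF o i Ck_on_const[OF o]])
  qed
qed

lemma smooth_on_exp: "smooth_on UNIV (exp :: real \<Rightarrow> real)"
  unfolding smooth_on_def
proof
  fix k show "Ck_on k UNIV (exp :: real \<Rightarrow> real)"
  proof (induction k)
    case 0
    then show ?case by (auto intro!: continuous_intros)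
  next
    case (Suc m)
    show ?case
    proof (rule Ck_on_SucI[OF open_UNIV])
      show "(exp has_derivative (\<lambda>v. exp x * v)) (at x)" for x :: real
        using DERIV_exp[of x] by (simp add: has_field_derivative_def)
    qed (rule Ck_on_mult[OF open_UNIV Suc Ck_on_const[OF open_UNIV]])
  qed
qed

lemma smooth_on_inverse:
  fixes f :: "'a::euclidean_space \<Rightarrow> real"
  assumes "open S" "smooth_on S f" "\<And>x. x \<in> S \<Longrightarrow> f x \<noteq> 0"
  shows "smooth_on S (\<lambda>x. inverse (f x))"
proof -
  have "smooth_on (- {0}) (inverse :: real \<Rightarrow> real)"
    using Ck_on_inverse_real by (simp add: smooth_on_def)
  from smooth_on_compose[OF assms(1,2) this] show ?thesis using assms(3) by fastforce
qed

lemma smooth_on_ln_compose: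
  fixes f :: "'a::euclidean_space \<Rightarrow> real"
  assumes "open S" "smooth_on S f" "\<And>x. x \<in> S \<Longrightarrow> f x > 0"
  shows "smooth_on S (\<lambda>x. ln (f x))"
  by (rule smooth_on_compose[OF assms(1,2) smooth_on_ln]) (use assms(3) in auto)

lemma smooth_on_exp_compose:
  fixes f :: "'a::euclidean_space \<Rightarrow> real"
  assumes "open S" "smooth_on S f"
  shows "smooth_on S (\<lambda>x. exp (f x))"
  by (rule smooth_on_compose[OF assms(1,2) smooth_on_exp]) simp

text \<open>A scaled second difference at \<open>z\<close> is, by the mean value theorem applied twice, a value of
  the mixed derivative at a nearby point; swapping the order of the two directions and letting
  the scale tend to zero gives the symmetry.\<close>

lemma second_difference_mvt:
  fixes f :: "'a::euclidean_space \<Rightarrow> real"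
  assumes "h > 0"
    and S: "\<And>s t. 0 \<le> s \<Longrightarrow> s \<le> h \<Longrightarrow> 0 \<le> t \<Longrightarrow> t \<le> h \<Longrightarrow> z + s *\<^sub>R u + t *\<^sub>R v \<in> S"
    and f: "\<And>x. x \<in> S \<Longrightarrow> f differentiable (at x)"
    and f': "\<And>x. x \<in> S \<Longrightarrow> (\<lambda>x. frechet_derivative f (at x) u) differentiable (at x)"
  obtains s t where "0 \<le> s" "s \<le> h" "0 \<le> t" "t \<le> h"
    "f (z + h *\<^sub>R u + h *\<^sub>R v) - f (z + h *\<^sub>R u) - f (z + h *\<^sub>R v) + f z
      = h\<^sup>2 * frechet_derivative (\<lambda>x. frechet_derivative f (at x) u) (at (z + s *\<^sub>R u + t *\<^sub>R v)) v"
proof -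
  have line: "((\<lambda>r. g (a + r *\<^sub>R w)) has_real_derivative frechet_derivative g (at (a + r *\<^sub>R w)) w) (at r)"
    if "g differentiable (at (a + r *\<^sub>R w))" for g :: "'a \<Rightarrow> real" and a w r
  proof -
    have 1: "((\<lambda>r. a + r *\<^sub>R w) has_derivative (\<lambda>r. r *\<^sub>R w)) (at r)"
      by (auto intro!: derivative_eq_intros)
    have 2: "(g has_derivative frechet_derivative g (at (a + r *\<^sub>R w))) (at (a + r *\<^sub>R w))"
      using that frechet_derivative_works by blast
    have "((\<lambda>r. g (a + r *\<^sub>R w)) has_derivative
        (\<lambda>r'. frechet_derivative g (at (a + r *\<^sub>R w)) (r' *\<^sub>R w))) (at r)"
      using has_derivative_compose[OF 1 2] .
    moreover have "frechet_derivative g (at (a + r *\<^sub>R w)) (r' *\<^sub>R w)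
        = frechet_derivative g (at (a + r *\<^sub>R w)) w * r'" for r'
      using linear_frechet_derivative[OF that] by (simp add: linear_cmul)
    ultimately show ?thesis by (simp add: has_field_derivative_def)
  qed
  define p where "p r = f (z + h *\<^sub>R v + r *\<^sub>R u) - f (z + r *\<^sub>R u)" for r
  have p': "(p has_real_derivative frechet_derivative f (at (z + h *\<^sub>R v + r *\<^sub>R u)) u
       - frechet_derivative f (at (z + r *\<^sub>R u)) u) (at r)" if "0 \<le> r" "r \<le> h" for r
    unfolding p_def
    by (intro DERIV_diff line f)
      (use S[of r h] S[of r 0] that assms(1) in \<open>auto simp: algebra_simps\<close>)
  obtain s where s: "0 < s" "s < h" "p h - p 0 = (h - 0) * (frechet_derivative f (at (z + h *\<^sub>R v + s *\<^sub>R u)) u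
       - frechet_derivative f (at (z + s *\<^sub>R u)) u)"
    using MVT2[OF assms(1), of p "\<lambda>r. frechet_derivative f (at (z + h *\<^sub>R v + r *\<^sub>R u)) u
       - frechet_derivative f (at (z + r *\<^sub>R u)) u"] p' by blast
  define q where "q r = frechet_derivative f (at (z + s *\<^sub>R u + r *\<^sub>R v)) u" for r
  have q': "(q has_real_derivative frechet_derivative (\<lambda>x. frechet_derivative f (at x) u)
      (at (z + s *\<^sub>R u + r *\<^sub>R v)) v) (at r)" if "0 \<le> r" "r \<le> h" for r
    unfolding q_def by (rule line[OF f']) (use S[of s r] that s in auto)
  obtain t where t: "0 < t" "t < h" "q h - q 0 = (h - 0) * frechet_derivative (\<lambda>x. frechet_derivative f (at x) u)
      (at (z + s *\<^sub>R u + t *\<^sub>R v)) v"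
    using MVT2[OF assms(1), of q "\<lambda>r. frechet_derivative (\<lambda>x. frechet_derivative f (at x) u)
      (at (z + s *\<^sub>R u + r *\<^sub>R v)) v"] q' by blast
  have qq: "q h - q 0 = frechet_derivative f (at (z + h *\<^sub>R v + s *\<^sub>R u)) u
       - frechet_derivative f (at (z + s *\<^sub>R u)) u"
    unfolding q_def by (simp add: add.assoc add.commute[of "s *\<^sub>R u"])
  have pp: "p h - p 0 = f (z + h *\<^sub>R u + h *\<^sub>R v) - f (z + h *\<^sub>R u) - f (z + h *\<^sub>R v) + f z"
    unfolding p_def by (simp add: algebra_simps)
  show thesis
    by (rule that[of s t]) (use s t qq pp in \<open>auto simp: power2_eq_square\<close>)
qed

lemma frechet_derivative_commute:
  fixes f :: "'a::euclidean_space \<Rightarrow> real"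
  assumes "open S" "smooth_on S f" "z \<in> S"
  shows "frechet_derivative (\<lambda>x. frechet_derivative f (at x) u) (at z) v
       = frechet_derivative (\<lambda>x. frechet_derivative f (at x) v) (at z) u"
proof -
  define a where "a w = frechet_derivative (\<lambda>x. frechet_derivative f (at x) u) (at w) v" for w
  define b where "b w = frechet_derivative (\<lambda>x. frechet_derivative f (at x) v) (at w) u" for w
  have cont: "isCont a z" "isCont b z"
    unfolding a_def b_def
    using assms smooth_on_continuous[OF smooth_on_frechet[OF smooth_on_frechet[OF assms(2)]]]
    by (auto simp: continuous_on_eq_continuous_at)
  have "\<bar>a z - b z\<bar> \<le> e" if "e > 0" for e
  proof -
    obtain d1 where d1: "d1 > 0" "\<And>w. dist w z < d1 \<Longrightarrow> dist (a w) (a z) < e/2"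
      using cont(1) \<open>e > 0\<close> unfolding continuous_at_eps_delta by (meson half_gt_zero)
    obtain d2 where d2: "d2 > 0" "\<And>w. dist w z < d2 \<Longrightarrow> dist (b w) (b z) < e/2"
      using cont(2) \<open>e > 0\<close> unfolding continuous_at_eps_delta by (meson half_gt_zero)
    obtain d3 where d3: "d3 > 0" "ball z d3 \<subseteq> S"
      using assms(1,3) open_contains_ball by blast
    define d where "d = min d1 (min d2 d3)"
    have "d > 0" using d1 d2 d3 by (simp add: d_def)
    \<comment> \<open>Keeps the whole parallelogram within \<open>d / 2\<close> of \<open>z\<close>;
      the summand 1 keeps the denominator positive when both directions are zero.\<close>
    define h where "h = d / (2 * (norm u + norm v + 1))"
    have h: "h > 0" using \<open>d > 0\<close> unfolding h_def
      by (simp add: add_nonneg_pos)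
    have near: "dist (z + s *\<^sub>R u + t *\<^sub>R v) z < d" if "0 \<le> s" "s \<le> h" "0 \<le> t" "t \<le> h" for s t
    proof -
      have "dist (z + s *\<^sub>R u + t *\<^sub>R v) z \<le> s * norm u + t * norm v"
        using norm_triangle_ineq[of "s *\<^sub>R u" "t *\<^sub>R v"] that by (simp add: dist_norm add.assoc)
      also have "\<dots> \<le> h * norm u + h * norm v"
        using that by (intro add_mono mult_right_mono) auto
      also have "\<dots> \<le> h * (norm u + norm v + 1)" using h by (simp add: algebra_simps)
      also have "\<dots> = d / 2" unfolding h_def
        using add_nonneg_pos[of "norm u + norm v" 1] by (simp add: divide_simps)
      finally show ?thesis using \<open>d > 0\<close> by simp
    qed
    have inS: "z + s *\<^sub>R u + t *\<^sub>R v \<in> S" if "0 \<le> s" "s \<le> h" "0 \<le> t" "t \<le> h" for s t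
      using near[OF that] d3 by (auto simp: d_def dist_commute subset_iff)
    have inS': "z + s *\<^sub>R v + t *\<^sub>R u \<in> S" if "0 \<le> s" "s \<le> h" "0 \<le> t" "t \<le> h" for s t
      using inS[of t s] that by (simp add: add.assoc add.commute[of "s *\<^sub>R v"])
    have df: "\<And>x. x \<in> S \<Longrightarrow> f differentiable (at x)"
      using assms(2) smooth_on_differentiable by blast
    have df': "\<And>x w. x \<in> S \<Longrightarrow> (\<lambda>x. frechet_derivative f (at x) w) differentiable (at x)"
      using assms(2) smooth_on_differentiable smooth_on_frechet by blast
    obtain s t where st: "0 \<le> s" "s \<le> h" "0 \<le> t" "t \<le> h"
      "f (z + h *\<^sub>R u + h *\<^sub>R v) - f (z + h *\<^sub>R u) - f (z + h *\<^sub>R v) + f z = h\<^sup>2 * a (z + s *\<^sub>R u + t *\<^sub>R v)"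
      using second_difference_mvt[of h z u v S f] h inS df df' unfolding a_def by blast
    obtain s' t' where st': "0 \<le> s'" "s' \<le> h" "0 \<le> t'" "t' \<le> h"
      "f (z + h *\<^sub>R v + h *\<^sub>R u) - f (z + h *\<^sub>R v) - f (z + h *\<^sub>R u) + f z = h\<^sup>2 * b (z + s' *\<^sub>R v + t' *\<^sub>R u)"
      using second_difference_mvt[of h z v u S f] h inS' df df' unfolding b_def by blast
    have "h\<^sup>2 * a (z + s *\<^sub>R u + t *\<^sub>R v) = h\<^sup>2 * b (z + s' *\<^sub>R v + t' *\<^sub>R u)"
    proof -
      have "z + h *\<^sub>R v + h *\<^sub>R u = z + h *\<^sub>R u + h *\<^sub>R v" by (simp add: algebra_simps)
      then have "f (z + h *\<^sub>R v + h *\<^sub>R u) = f (z + h *\<^sub>R u + h *\<^sub>R v)" by (rule arg_cong)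
      then show ?thesis using st(5) st'(5) by linarith
    qed
    then have eq: "a (z + s *\<^sub>R u + t *\<^sub>R v) = b (z + s' *\<^sub>R v + t' *\<^sub>R u)" using h by simp
    have A: "dist (a (z + s *\<^sub>R u + t *\<^sub>R v)) (a z) < e/2"
      by (rule d1(2)) (use near[OF st(1-4)] in \<open>simp add: d_def\<close>)
    have B: "dist (b (z + s' *\<^sub>R v + t' *\<^sub>R u)) (b z) < e/2"
      by (rule d2(2)) (use near[OF st'(3,4,1,2)] in \<open>simp add: d_def add.assoc add.commute[of "t' *\<^sub>R u"]\<close>)
    show ?thesis using A B eq unfolding dist_real_def by linarith
  qed
  then have "\<bar>a z - b z\<bar> \<le> 0" using field_le_epsilon[of "\<bar>a z - b z\<bar>" 0] by simp
  then show ?thesis by (simp add: a_def b_def)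
qed

section \<open>Linear algebra\<close>

lemma invertible_matrix_inv:
  fixes A :: "real^'n^'n"
  assumes "invertible A"
  shows "A ** matrix_inv A = mat 1" "matrix_inv A ** A = mat 1"
proof -
  have "A ** matrix_inv A = mat 1 \<and> matrix_inv A ** A = mat 1"
    unfolding matrix_inv_def by (rule someI_ex) (use assms in \<open>simp add: invertible_def\<close>)
  then show "A ** matrix_inv A = mat 1" "matrix_inv A ** A = mat 1" by auto
qed

text \<open>Cramer's rule makes the entries of the inverse quotients of polynomials in the entries
  of \<open>A\<close>; this is the source of smoothness of the inverse metric.\<close>

lemma matrix_inv_cramer:
  fixes A :: "real^'n^'n"
  assumes "det A \<noteq> 0"
  shows "matrix_inv A $ k $ l = det (\<chi> i j. if j = k then axis l 1 $ i else A $ i $ j) / det A"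
proof -
  have "A *v (matrix_inv A *v axis l 1) = axis l 1"
    using invertible_matrix_inv(1)[of A] assms invertible_det_nz[of A]
    by (simp add: matrix_vector_mul_assoc)
  then have "matrix_inv A *v axis l 1
      = (\<chi> k. det (\<chi> i j. if j = k then axis l 1 $ i else A $ i $ j) / det A)"
    using cramer[OF assms] by blast
  moreover have "(matrix_inv A *v axis l 1) $ k = matrix_inv A $ k $ l"
    by (simp add: matrix_vector_mult_basis column_def)
  ultimately show ?thesis by simp
qed

lemma posdef_invertible:
  fixes A :: "real^'n^'n"
  assumes "\<And>w. w \<noteq> 0 \<Longrightarrow> 0 < w \<bullet> (A *v w)"
  shows "invertible A"
proof -
  have "A *v x = 0 \<Longrightarrow> x = 0" for x
    using assms[of x] by force
  then have "inj ((*v) A)"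
    by (metis (mono_tags, lifting) eq_iff_diff_eq_0 injI matrix_vector_mult_diff_distrib)
  then show ?thesis
    using matrix_left_invertible_injective invertible_left_inverse by blast
qed

text \<open>The segment from the identity to \<open>A\<close> stays among the positive definite, hence
  nonsingular, matrices, so the determinant keeps its sign.\<close>

lemma posdef_det_pos:
  fixes A :: "real^'n^'n"
  assumes "\<And>w. w \<noteq> 0 \<Longrightarrow> 0 < w \<bullet> (A *v w)"
  shows "0 < det A"
proof (rule ccontr)
  assume neg: "\<not> 0 < det A"
  define M where "M t = (1 - t) *\<^sub>R mat 1 + t *\<^sub>R A" for t :: real
  have pos: "0 < w \<bullet> (M t *v w)" if "w \<noteq> 0" "0 \<le> t" "t \<le> 1" for w t
  proof -
    have "w \<bullet> (M t *v w) = (1 - t) * (w \<bullet> w) + t * (w \<bullet> (A *v w))"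
      unfolding M_def
      by (simp add: matrix_vector_mult_add_rdistrib inner_add_right scaleR_matrix_vector_assoc[symmetric])
    moreover have "0 < w \<bullet> w" using that by simp
    moreover have "0 < w \<bullet> (A *v w)" using assms that by simp
    ultimately show ?thesis
      using that by (cases "t = 0") (auto intro: add_nonneg_pos)
  qed
  have nz: "det (M t) \<noteq> 0" if "0 \<le> t" "t \<le> 1" for t
    using posdef_invertible[of "M t"] pos that invertible_det_nz by blast
  have cont: "continuous_on {0..1} (\<lambda>t. det (M t))"
    unfolding M_def det_def by (intro continuous_intros)
  have "det (M 1) \<le> 0" "0 \<le> det (M 0)" using neg by (auto simp: M_def)
  then obtain t where "0 \<le> t" "t \<le> 1" "det (M t) = 0"
    using IVT2'[of "\<lambda>t. det (M t)" 1 0 0] cont by auto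
  then show False using nz by blast
qed

text \<open>Row \<open>k\<close> of \<open>B\<close> is a combination of the rows of
  \<open>A\<close> with coefficients from \<open>B ** matrix_inv A\<close>, and only the coefficient
  of row \<open>k\<close> itself survives in the determinant.\<close>

lemma det_row_replaced:
  fixes A B :: "real^'n^'n"
  assumes "invertible A"
  shows "det (\<chi> i j. if i = k then B $ i $ j else A $ i $ j) = (B ** matrix_inv A) $ k $ k * det A"
proof -
  define x where "x = (B ** matrix_inv A) $ k"
  have BA: "B = (B ** matrix_inv A) ** A"
    using invertible_matrix_inv[OF assms] by (simp add: matrix_mul_assoc[symmetric])
  have "B $ k = sum (\<lambda>i. x $ i *s row i A) UNIV"
  proof -
    have "B $ k $ j = (\<Sum>i\<in>UNIV. x $ i * A $ i $ j)" for j
      by (subst BA) (simp add: matrix_matrix_mult_def x_def)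
    then show ?thesis by (simp add: vec_eq_iff row_def)
  qed
  then have "(\<chi> i j. if i = k then B $ i $ j else A $ i $ j)
      = (\<chi> i. if i = k then sum (\<lambda>i. x $ i *s row i A) UNIV else row i A)"
    by (auto simp: vec_eq_iff row_def)
  then show ?thesis
    using cramer_lemma_transpose[where k = k and x = x and A = A] by (simp add: x_def)
qed

text \<open>Jacobi's formula. The product rule in the Leibniz expansion, regrouped by the row that
  is differentiated, gives determinants with one row replaced.\<close>

lemma has_derivative_det:
  fixes A :: "'a::real_normed_vector \<Rightarrow> real^'n^'n" and A' :: "'a \<Rightarrow> real^'n^'n"
  assumes "\<And>i j. ((\<lambda>w. A w $ i $ j) has_derivative (\<lambda>v. A' v $ i $ j)) (at z)" "invertible (A z)"
  shows "((\<lambda>w. det (A w)) has_derivative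
    (\<lambda>v. det (A z) * (\<Sum>i\<in>UNIV. \<Sum>j\<in>UNIV. matrix_inv (A z) $ i $ j * A' v $ j $ i))) (at z)"
proof -
  have 1: "((\<lambda>w. det (A w)) has_derivative
    (\<lambda>v. \<Sum>p | p permutes UNIV. of_int (sign p) *
       (\<Sum>k\<in>UNIV. A' v $ k $ p k * (\<Prod>i\<in>UNIV - {k}. A z $ i $ p i)))) (at z)"
    unfolding det_def
    by (intro has_derivative_sum has_derivative_mult_right has_derivative_prod assms(1))
  have "(\<Sum>p | p permutes UNIV. of_int (sign p) *
       (\<Sum>k\<in>UNIV. A' v $ k $ p k * (\<Prod>i\<in>UNIV - {k}. A z $ i $ p i)))
     = det (A z) * (\<Sum>i\<in>UNIV. \<Sum>j\<in>UNIV. matrix_inv (A z) $ i $ j * A' v $ j $ i)" for v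
  proof -
    have "(\<Sum>p | p permutes UNIV. of_int (sign p) *
         (\<Sum>k\<in>UNIV. A' v $ k $ p k * (\<Prod>i\<in>UNIV - {k}. A z $ i $ p i)))
       = (\<Sum>k\<in>UNIV. \<Sum>p | p permutes UNIV. of_int (sign p) *
         (A' v $ k $ p k * (\<Prod>i\<in>UNIV - {k}. A z $ i $ p i)))"
      unfolding sum_distrib_left by (rule sum.swap)
    also have "\<dots> = (\<Sum>k\<in>UNIV. det (\<chi> i j. if i = k then A' v $ i $ j else A z $ i $ j))"
    proof (rule sum.cong[OF refl])
      fix k :: 'n
      have "A' v $ k $ p k * (\<Prod>i\<in>UNIV - {k}. A z $ i $ p i)
         = (\<Prod>i\<in>UNIV. (\<chi> i j. if i = k then A' v $ i $ j else A z $ i $ j) $ i $ p i)" for p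
        by (subst prod.remove[of UNIV k]) (auto intro!: prod.cong)
      then show "(\<Sum>p | p permutes UNIV. of_int (sign p) *
           (A' v $ k $ p k * (\<Prod>i\<in>UNIV - {k}. A z $ i $ p i)))
         = det (\<chi> i j. if i = k then A' v $ i $ j else A z $ i $ j)"
        unfolding det_def by simp
    qed
    also have "\<dots> = (\<Sum>k\<in>UNIV. (A' v ** matrix_inv (A z)) $ k $ k * det (A z))"
      by (simp add: det_row_replaced[OF assms(2)])
    also have "\<dots> = det (A z) * (\<Sum>k\<in>UNIV. \<Sum>j\<in>UNIV. matrix_inv (A z) $ j $ k * A' v $ k $ j)"
      by (simp add: matrix_matrix_mult_def sum_distrib_left sum_distrib_right mult_ac)
    also have "(\<Sum>k\<in>UNIV. \<Sum>j\<in>UNIV. matrix_inv (A z) $ j $ k * A' v $ k $ j)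
       = (\<Sum>i\<in>UNIV. \<Sum>j\<in>UNIV. matrix_inv (A z) $ i $ j * A' v $ j $ i)"
      by (rule sum.swap)
    finally show ?thesis .
  qed
  then show ?thesis using 1 by simp
qed

text \<open>One step of Cholesky elimination: the Schur complement is again positive semidefinite and
  its row \<open>r\<close> vanishes.\<close>

lemma psd_sum_of_squares:
  fixes G :: "'n::finite \<Rightarrow> 'n \<Rightarrow> real"
  assumes "finite J" "\<And>i j. G i j = G j i" "\<And>x. 0 \<le> (\<Sum>i\<in>UNIV. \<Sum>j\<in>UNIV. G i j * x i * x j)"
    "\<And>i j. i \<notin> J \<Longrightarrow> G i j = 0"
  shows "\<exists>v::'n \<Rightarrow> 'n \<Rightarrow> real. \<forall>i j. G i j = (\<Sum>r\<in>J. v r i * v r j)"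
  using assms
proof (induction J arbitrary: G rule: finite_induct)
  case empty
  then show ?case by simp
next
  case (insert r J)
  define q where "q x y = (\<Sum>i\<in>UNIV. \<Sum>j\<in>UNIV. G i j * x i * y j)" for x y :: "'n \<Rightarrow> real"
  have q_sym: "q x y = q y x" for x y
    unfolding q_def by (subst sum.swap) (simp add: insert.prems(1) mult_ac)
  have q_add: "q (\<lambda>i. x i + t * y i) (\<lambda>i. x i + t * y i) = q x x + 2 * t * q x y + t\<^sup>2 * q y y" for x y t
  proof -
    have "q (\<lambda>i. x i + t * y i) (\<lambda>i. x i + t * y i) = q x x + t * q x y + t * q y x + t\<^sup>2 * q y y"
      unfolding q_def by (simp add: algebra_simps sum.distrib sum_distrib_left power2_eq_square)
    then show ?thesis using q_sym[of x y] by simp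
  qed
  define e where "e r' i = (if i = r' then 1 else 0 :: real)" for r' i :: 'n
  have qe: "q x (e r) = (\<Sum>i\<in>UNIV. G i r * x i)" for x
    unfolding q_def e_def by (simp add: sum.delta if_distrib cong: if_cong)
  have qee: "q (e i) (e r) = G i r" for i
    unfolding qe e_def by (simp add: sum.delta if_distrib cong: if_cong)
  have q_nonneg: "0 \<le> q x x" for x unfolding q_def using insert.prems(2) .
  show ?case
  proof (cases "G r r = 0")
    case True
    have "G i r = 0" for i
    proof (rule ccontr)
      assume nz: "G i r \<noteq> 0"
      \<comment> \<open>With \<open>G r r = 0\<close> the form is affine in \<open>t\<close> along
        \<open>e i + t * e r\<close>; this \<open>t\<close> makes its value
        \<open>- 1\<close>.\<close>
      define t where "t = - (q (e i) (e i) + 1) / (2 * G i r)"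
      have "q (\<lambda>j. e i j + t * e r j) (\<lambda>j. e i j + t * e r j) = q (e i) (e i) + 2 * t * G i r"
        using q_add[of "e i" t "e r"] qee True by simp
      also have "\<dots> = - 1" unfolding t_def using nz by (simp add: field_simps)
      finally show False using q_nonneg by (metis neg_0_le_iff_le not_one_le_zero)
    qed
    then have "G i j = 0" if "i \<notin> J" for i j
      using insert.prems that by (cases "i = r") auto
    then obtain v where v: "\<forall>i j. G i j = (\<Sum>r\<in>J. v r i * v r j)"
      using insert.IH[of G] insert.prems by blast
    then have "\<forall>i j. G i j = (\<Sum>s\<in>insert r J. (v(r := \<lambda>_. 0)) s i * (v(r := \<lambda>_. 0)) s j)"
      using insert.hyps by (auto intro!: sum.cong)
    then show ?thesis by blast
  next
    case False
    have pos: "G r r > 0" using False q_nonneg[of "e r"] qee[of r] by simp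
    define G' where "G' i j = G i j - G i r * G j r / G r r" for i j
    have "0 \<le> (\<Sum>i\<in>UNIV. \<Sum>j\<in>UNIV. G' i j * x i * x j)" for x
    proof -
      have "(\<Sum>i\<in>UNIV. \<Sum>j\<in>UNIV. G' i j * x i * x j) = q x x - (q x (e r))\<^sup>2 / G r r"
        unfolding G'_def q_def[of x x] qe power2_eq_square
        by (simp add: algebra_simps sum_subtractf sum_product sum_distrib_left sum_divide_distrib)
      \<comment> \<open>Completing the square: the coefficient of \<open>e r\<close> minimizes the
        form along that direction.\<close>
      also have "\<dots> = q (\<lambda>i. x i + (- q x (e r) / G r r) * e r i) (\<lambda>i. x i + (- q x (e r) / G r r) * e r i)"
        unfolding q_add qee using pos by (simp add: field_simps power2_eq_square)
      finally show ?thesis using q_nonneg by simp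
    qed
    moreover have "G' i j = G' j i" for i j using insert.prems(1) by (simp add: G'_def mult.commute)
    moreover have "G' i j = 0" if "i \<notin> J" for i j
      using that insert.prems(1)[of j r] insert.prems(3)[of i] False by (cases "i = r") (auto simp: G'_def)
    ultimately obtain v where v: "\<forall>i j. G' i j = (\<Sum>r\<in>J. v r i * v r j)"
      using insert.IH[of G'] by blast
    define v' where "v' = v(r := \<lambda>i. G i r / sqrt (G r r))"
    have "G i j = (\<Sum>s\<in>insert r J. v' s i * v' s j)" for i j
    proof -
      have "(\<Sum>s\<in>J. v' s i * v' s j) = (\<Sum>s\<in>J. v s i * v s j)"
        using insert.hyps by (intro sum.cong) (auto simp: v'_def)
      moreover have "v' r i * v' r j = G i r * G j r / G r r"
        using pos by (simp add: v'_def)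
      moreover have "G i j = G' i j + G i r * G j r / G r r" by (simp add: G'_def)
      ultimately show ?thesis using insert.hyps v by simp
    qed
    then show ?thesis by blast
  qed
qed

text \<open>\<open>Q\<close> is the squared norm of \<open>f\<close> with both indices measured by
  \<open>G\<close>. Splitting one copy of \<open>G\<close> into squares of vectors
  \<open>v r\<close> turns \<open>Q\<close> into the sum over \<open>r\<close> of the values of the
  form \<open>G\<close> at the vectors \<open>y r = f (v r)\<close>. If all of these vanish, then
  \<open>f\<close> annihilates every \<open>v r\<close>, hence \<open>f G = 0\<close>, and
  positivity of \<open>G\<close> at each row of \<open>f\<close> finishes.\<close>

lemma hessian_norm:
  fixes G f :: "'n::finite \<Rightarrow> 'n \<Rightarrow> real"
  assumes G: "\<And>i j. G i j = G j i"
    and pos: "\<And>x. (\<exists>i. x i \<noteq> 0) \<Longrightarrow> 0 < (\<Sum>i\<in>UNIV. \<Sum>j\<in>UNIV. G i j * x i * x j)"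
    and f: "\<And>i j. f i j = f j i"
  defines "Q \<equiv> \<Sum>i\<in>UNIV. \<Sum>l\<in>UNIV. \<Sum>k\<in>UNIV. \<Sum>j\<in>UNIV. G i l * G k j * f l k * f i j"
  shows "0 \<le> Q" "Q = 0 \<Longrightarrow> f i j = 0"
proof -
  have nonneg: "0 \<le> (\<Sum>i\<in>UNIV. \<Sum>j\<in>UNIV. G i j * x i * x j)" for x
    using pos[of x] by (cases "\<exists>i. x i \<noteq> 0") (auto simp: less_eq_real_def)
  obtain v :: "'n \<Rightarrow> 'n \<Rightarrow> real" where v: "\<And>i j. G i j = (\<Sum>r\<in>UNIV. v r i * v r j)"
  proof -
    have "\<exists>v::'n \<Rightarrow> 'n \<Rightarrow> real. \<forall>i j. G i j = (\<Sum>r\<in>UNIV. v r i * v r j)"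
      by (rule psd_sum_of_squares[OF finite G nonneg]) simp
    then obtain w :: "'n \<Rightarrow> 'n \<Rightarrow> real" where "\<forall>i j. G i j = (\<Sum>r\<in>UNIV. w r i * w r j)"
      by blast
    then show thesis by (intro that[of w]) blast
  qed
  define y where "y r l = (\<Sum>k\<in>UNIV. f l k * v r k)" for r l
  have Q: "Q = (\<Sum>r\<in>UNIV. \<Sum>i\<in>UNIV. \<Sum>l\<in>UNIV. G i l * y r i * y r l)"
  proof -
    have "(\<Sum>k\<in>UNIV. \<Sum>j\<in>UNIV. G i l * G k j * f l k * f i j) = (\<Sum>r\<in>UNIV. G i l * y r i * y r l)" for i l
    proof -
      have "(\<Sum>r\<in>UNIV. G i l * y r i * y r l)
          = (\<Sum>r\<in>UNIV. \<Sum>k\<in>UNIV. \<Sum>j\<in>UNIV. G i l * (f l k * v r k) * (f i j * v r j))"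
      proof (rule sum.cong[OF refl])
        fix r
        have "G i l * y r i * y r l = G i l * (y r l * y r i)" by simp
        also have "y r l * y r i = (\<Sum>k\<in>UNIV. \<Sum>j\<in>UNIV. (f l k * v r k) * (f i j * v r j))"
          unfolding y_def by (rule sum_product)
        finally show "G i l * y r i * y r l
            = (\<Sum>k\<in>UNIV. \<Sum>j\<in>UNIV. G i l * (f l k * v r k) * (f i j * v r j))"
          by (simp add: sum_distrib_left mult.assoc)
      qed
      also have "\<dots> = (\<Sum>k\<in>UNIV. \<Sum>r\<in>UNIV. \<Sum>j\<in>UNIV. G i l * (f l k * v r k) * (f i j * v r j))"
        by (rule sum.swap)
      also have "\<dots> = (\<Sum>k\<in>UNIV. \<Sum>j\<in>UNIV. \<Sum>r\<in>UNIV. G i l * (f l k * v r k) * (f i j * v r j))"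
        by (rule sum.cong[OF refl], rule sum.swap)
      also have "\<dots> = (\<Sum>k\<in>UNIV. \<Sum>j\<in>UNIV. G i l * G k j * f l k * f i j)"
      proof (intro sum.cong refl)
        fix k j
        have "(\<Sum>r\<in>UNIV. G i l * (f l k * v r k) * (f i j * v r j))
            = G i l * f l k * f i j * (\<Sum>r\<in>UNIV. v r k * v r j)"
          by (simp add: sum_distrib_left mult_ac)
        then show "(\<Sum>r\<in>UNIV. G i l * (f l k * v r k) * (f i j * v r j)) = G i l * G k j * f l k * f i j"
          by (simp add: v[of k j] mult_ac)
      qed
      finally show ?thesis by simp
    qed
    then have "Q = (\<Sum>i\<in>UNIV. \<Sum>l\<in>UNIV. \<Sum>r\<in>UNIV. G i l * y r i * y r l)"
      unfolding Q_def by simp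
    also have "\<dots> = (\<Sum>i\<in>UNIV. \<Sum>r\<in>UNIV. \<Sum>l\<in>UNIV. G i l * y r i * y r l)"
      by (rule sum.cong[OF refl], rule sum.swap)
    also have "\<dots> = (\<Sum>r\<in>UNIV. \<Sum>i\<in>UNIV. \<Sum>l\<in>UNIV. G i l * y r i * y r l)"
      by (rule sum.swap)
    finally show ?thesis .
  qed
  show "0 \<le> Q" unfolding Q by (intro sum_nonneg nonneg)
  show "f i j = 0" if "Q = 0"
  proof -
    have z: "(\<Sum>i\<in>UNIV. \<Sum>l\<in>UNIV. G i l * y r i * y r l) = 0" for r
      using that unfolding Q by (subst (asm) sum_nonneg_eq_0_iff) (auto intro: nonneg)
    have y: "y r l = 0" for r l
      using z[of r] pos[of "y r"] by (metis less_irrefl)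
    have "(\<Sum>k\<in>UNIV. G k j * f i k) = 0" for j
    proof -
      have "(\<Sum>k\<in>UNIV. G k j * f i k) = (\<Sum>k\<in>UNIV. \<Sum>r\<in>UNIV. v r j * (f i k * v r k))"
        unfolding v[of _ j] by (simp add: sum_distrib_left sum_distrib_right mult_ac)
      also have "\<dots> = (\<Sum>r\<in>UNIV. v r j * y r i)"
        unfolding y_def sum_distrib_left by (rule sum.swap)
      finally show ?thesis using y by simp
    qed
    then have "(\<Sum>j\<in>UNIV. (\<Sum>k\<in>UNIV. G k j * f i k) * f i j) = 0" by simp
    moreover have "(\<Sum>j\<in>UNIV. (\<Sum>k\<in>UNIV. G k j * f i k) * f i j)
        = (\<Sum>k\<in>UNIV. \<Sum>j\<in>UNIV. G k j * f i k * f i j)"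
      unfolding sum_distrib_right by (rule sum.swap)
    ultimately show ?thesis using pos[of "f i"] by (metis less_irrefl)
  qed
qed

section \<open>Integration of derivatives with compact support\<close>

lemma integrable_compact_support:
  fixes u :: "'a::euclidean_space \<Rightarrow> real"
  assumes "continuous_on UNIV u" "\<And>y. norm y > R \<Longrightarrow> u y = 0"
  shows "integrable lborel u"
proof -
  have "integrable lborel (\<lambda>x. indicator (cball 0 R) x *\<^sub>R u x)"
    by (intro borel_integrable_compact compact_cball continuous_on_subset[OF assms(1)]) simp
  moreover have "(\<lambda>x. indicator (cball 0 R) x *\<^sub>R u x) = u"
    using assms(2) by (auto simp: indicator_def fun_eq_iff)
  ultimately show ?thesis by simp
qed

text \<open>The difference quotients have integral zero by translation invariance; pass to the limit
  by dominated convergence.\<close>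

lemma integral_directional_derivative_eq_0:
  fixes u u' :: "'a::euclidean_space \<Rightarrow> real"
  assumes deriv: "\<And>y. ((\<lambda>t. u (y + t *\<^sub>R e)) has_real_derivative u' y) (at 0)"
    and u: "continuous_on UNIV u" and u': "continuous_on UNIV u'"
    and supp: "\<And>y. norm y > R \<Longrightarrow> u y = 0" "\<And>y. norm y > R \<Longrightarrow> u' y = 0"
  shows "integral\<^sup>L lborel u' = 0"
proof -
  have deriv': "((\<lambda>t. u (y + t *\<^sub>R e)) has_real_derivative u' (y + s *\<^sub>R e)) (at s)" for y s
  proof -
    have "((\<lambda>t. u ((y + s *\<^sub>R e) + t *\<^sub>R e)) has_real_derivative u' (y + s *\<^sub>R e)) (at (s - s))"
      using deriv[of "y + s *\<^sub>R e"] by simp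
    then have "((\<lambda>t. u ((y + s *\<^sub>R e) + (t - s) *\<^sub>R e)) has_real_derivative u' (y + s *\<^sub>R e)) (at s)"
      using DERIV_shift[of "\<lambda>t. u ((y + s *\<^sub>R e) + t *\<^sub>R e)" "u' (y + s *\<^sub>R e)" s "- s"] by simp
    moreover have "(\<lambda>t. u ((y + s *\<^sub>R e) + (t - s) *\<^sub>R e)) = (\<lambda>t. u (y + t *\<^sub>R e))"
      by (simp add: algebra_simps)
    ultimately show ?thesis by simp
  qed
  have "bounded (u' ` cball 0 R)"
    by (intro compact_imp_bounded compact_continuous_image continuous_on_subset[OF u']) auto
  then obtain M where "\<forall>y\<in>cball 0 R. \<bar>u' y\<bar> \<le> M"
    by (auto simp: bounded_iff)
  then have M: "\<bar>u' y\<bar> \<le> M" if "norm y \<le> R" for y using that by simp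
  \<comment> \<open>For negative \<open>R\<close> the ball is empty and \<open>M\<close> may be
    negative.\<close>
  define M' where "M' = max M 0"
  have M': "\<bar>u' y\<bar> \<le> M'" for y
    using M[of y] supp(2)[of y] unfolding M'_def by (cases "norm y \<le> R") auto
  define h where "h n = 1 / real (Suc n)" for n
  have h: "h n > 0" "h n \<le> 1" for n unfolding h_def by auto
  define s where "s n y = (u (y + h n *\<^sub>R e) - u y) / h n" for n y
  \<comment> \<open>The increments are at most \<open>norm e\<close> long, so all difference
    quotients vanish outside the ball enlarged by that amount.\<close>
  define w where "w y = indicator (cball 0 (R + norm e)) y *\<^sub>R M'" for y :: 'a
  have int_u: "integrable lborel u" using integrable_compact_support[OF u supp(1)] by blast
  have [measurable]: "u \<in> borel_measurable borel" "u' \<in> borel_measurable borel"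
    using u u' by (auto intro: borel_measurable_continuous_onI)
  have trans: "integral\<^sup>L lborel (\<lambda>y. u (y + c)) = integral\<^sup>L lborel u"
     "integrable lborel (\<lambda>y. u (y + c))" for c
  proof -
    have d: "distr lborel borel ((+) c) = lborel" by (rule lborel_distr_plus)
    have "integral\<^sup>L (distr lborel borel ((+) c)) u = integral\<^sup>L lborel (\<lambda>y. u (c + y))"
      by (rule integral_distr) auto
    then show "integral\<^sup>L lborel (\<lambda>y. u (y + c)) = integral\<^sup>L lborel u"
      unfolding d by (simp add: add.commute)
    have "integrable (distr lborel borel ((+) c)) u \<longleftrightarrow> integrable lborel (\<lambda>y. u (c + y))"
      by (rule integrable_distr_eq) auto
    then show "integrable lborel (\<lambda>y. u (y + c))"
      unfolding d using int_u by (simp add: add.commute)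
  qed
  have int_s: "integral\<^sup>L lborel (s n) = 0" for n
    unfolding s_def using trans[of "h n *\<^sub>R e"] int_u by simp
  have "(\<lambda>n. integral\<^sup>L lborel (s n)) \<longlonglongrightarrow> integral\<^sup>L lborel u'"
  proof (rule integral_dominated_convergence[where w = w])
    show "u' \<in> borel_measurable lborel" "\<And>n. s n \<in> borel_measurable lborel"
      unfolding s_def by auto
    show "integrable lborel w"
      unfolding w_def by (intro borel_integrable_compact) auto
    have "(\<lambda>n. s n y) \<longlonglongrightarrow> u' y" for y
    proof -
      have "((\<lambda>t. (u (y + t *\<^sub>R e) - u y) / t) \<longlongrightarrow> u' y) (at 0)"
        using deriv[of y] unfolding has_field_derivative_iff by simp
      moreover have "filterlim h (at 0) sequentially"
      proof -
        have "h \<longlonglongrightarrow> 0" using LIMSEQ_inverse_real_of_nat by (simp add: h_def[abs_def] inverse_eq_divide)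
        moreover have "h n \<noteq> 0" for n using h(1)[of n] by simp
        ultimately show ?thesis unfolding filterlim_at by simp
      qed
      ultimately show ?thesis
        unfolding s_def using filterlim_compose by blast
    qed
    then show "AE y in lborel. (\<lambda>n. s n y) \<longlonglongrightarrow> u' y" by simp
    have "norm (s n y) \<le> w y" for n y
    proof (cases "norm y \<le> R + norm e")
      case True
      obtain \<xi> where "u (y + h n *\<^sub>R e) - u (y + 0 *\<^sub>R e) = (h n - 0) * u' (y + \<xi> *\<^sub>R e)"
        using MVT2[of 0 "h n" "\<lambda>t. u (y + t *\<^sub>R e)" "\<lambda>t. u' (y + t *\<^sub>R e)"] deriv' h by blast
      then have "s n y = u' (y + \<xi> *\<^sub>R e)" using h(1)[of n] by (simp add: s_def)
      then show ?thesis using True M' by (simp add: w_def)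
    next
      case False
      have "norm (y + h n *\<^sub>R e) \<ge> norm y - norm (h n *\<^sub>R e)"
        by (metis add.commute norm_diff_ineq)
      moreover have "norm (h n *\<^sub>R e) \<le> norm e"
        using h[of n] by (simp add: mult_left_le_one_le)
      ultimately have "norm (y + h n *\<^sub>R e) > R" "norm y > R"
        using False norm_ge_zero[of e] by linarith+
      then show ?thesis using supp by (simp add: s_def w_def M'_def)
    qed
    then show "AE y in lborel. norm (s n y) \<le> w y" for n by simp
  qed
  then show ?thesis using int_s by (simp add: LIMSEQ_const_iff)
qed

lemma continuous_nonneg_integral_eq_0:
  fixes f :: "'a::euclidean_space \<Rightarrow> real"
  assumes "continuous_on UNIV f" "\<And>x. 0 \<le> f x" "integrable lborel f" "integral\<^sup>L lborel f = 0"
  shows "f x = 0"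
proof (rule ccontr)
  assume "f x \<noteq> 0"
  have "AE x in lborel. f x = 0"
    using integral_nonneg_eq_0_iff_AE[OF assms(3)] assms(2,4) by simp
  moreover have op: "open {x. f x \<noteq> 0}"
    using open_Collect_neq[OF assms(1) continuous_on_const] by simp
  ultimately have "{x. f x \<noteq> 0} \<in> null_sets lborel"
    using AE_iff_null[of lborel "\<lambda>x. f x = 0"] by simp
  then have "negligible {x. f x \<noteq> 0}"
    unfolding negligible_iff_null_sets by (rule null_sets_completionI)
  then show False
    using op open_not_negligible \<open>f x \<noteq> 0\<close> by blast
qed

section \<open>Uniform linear approximation on compact sets\<close>

text \<open>The point is that one \<open>\<delta>\<close> serves all base points in
  \<open>K\<close>; the envelope argument needs this for all unit vectors over a point. Uniform
  continuity of the partial derivatives near \<open>K\<close> bounds the variation of the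
  differential, and the mean value inequality does the rest.\<close>

lemma uniform_linear_approximation:
  fixes f :: "'a::euclidean_space \<Rightarrow> real"
  assumes "open S" "smooth_on S f" "compact K" "K \<subseteq> S" "\<epsilon> > 0"
  obtains \<delta> where "\<delta> > 0" "\<And>z z'. z \<in> K \<Longrightarrow> norm (z' - z) < \<delta> \<Longrightarrow>
     z' \<in> S \<and> \<bar>f z' - f z - frechet_derivative f (at z) (z' - z)\<bar> \<le> \<epsilon> * norm (z' - z)"
proof -
  obtain d where d: "d > 0" "(\<Union>x\<in>K. cball x d) \<subseteq> S"
    using compact_subset_open_imp_cball_epsilon_subset[OF assms(3,1,4)] by blast
  \<comment> \<open>The closed \<open>d\<close>-neighbourhood of \<open>K\<close>: uniform
    continuity must also cover the displaced points, and this set is still compact and inside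
    \<open>S\<close>.\<close>
  define K' where "K' = {x + y |x y. x \<in> K \<and> y \<in> cball 0 d}"
  have K': "compact K'" unfolding K'_def using compact_sums[OF assms(3) compact_cball] .
  have K'I: "z' \<in> K'" if "z \<in> K" "norm (z' - z) \<le> d" for z z'
    unfolding K'_def using that by (intro CollectI exI[of _ z] exI[of _ "z' - z"]) simp
  have K'S: "K' \<subseteq> S"
    unfolding K'_def using d(2) by (force simp: dist_norm subset_iff)
  define D where "D = real DIM('a)"
  have D: "D > 0" unfolding D_def by simp
  have "\<exists>\<delta>>0. \<forall>x\<in>K'. \<forall>x'\<in>K'. dist x' x < \<delta> \<longrightarrow>
      dist (frechet_derivative f (at x') b) (frechet_derivative f (at x) b) < \<epsilon> / D" if "b \<in> Basis" for b
  proof -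
    have "uniformly_continuous_on K' (\<lambda>x. frechet_derivative f (at x) b)"
      by (intro compact_uniformly_continuous K' continuous_on_subset[OF _ K'S]
          smooth_on_continuous[OF smooth_on_frechet[OF assms(2)]])
    then show ?thesis unfolding uniformly_continuous_on_def using assms(5) D by simp
  qed
  then obtain \<Delta> where \<Delta>: "\<And>b. b \<in> Basis \<Longrightarrow> \<Delta> b > 0 \<and> (\<forall>x\<in>K'. \<forall>x'\<in>K'. dist x' x < \<Delta> b \<longrightarrow>
      dist (frechet_derivative f (at x') b) (frechet_derivative f (at x) b) < \<epsilon> / D)"
    by metis
  define \<delta> where "\<delta> = min d (Min (\<Delta> ` Basis))"
  have \<delta>: "\<delta> > 0" "\<delta> \<le> d" "\<And>b. b \<in> Basis \<Longrightarrow> \<delta> \<le> \<Delta> b"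
    unfolding \<delta>_def using d(1) \<Delta> by (auto simp: min_le_iff_disj)
  show thesis
  proof (rule that[OF \<delta>(1)])
    fix z z' assume z: "z \<in> K" "norm (z' - z) < \<delta>"
    let ?C = "ball z \<delta>"
    have C: "?C \<subseteq> K'" using K'I[OF z(1)] \<delta>(2) by (auto simp: dist_norm norm_minus_commute)
    have der: "(f has_derivative frechet_derivative f (at x)) (at x)" if "x \<in> K'" for x
      using that K'S smooth_on_differentiable[OF assms(2)] frechet_derivative_works by blast
    have zz: "z \<in> ?C" using \<delta>(1) by simp
    have "norm (f z' - f z - frechet_derivative f (at z) (z' - z)) \<le> norm (z' - z) * \<epsilon>"
    proof (rule differentiable_bound_linearization[of z z' ?C f "\<lambda>x. frechet_derivative f (at x)" z \<epsilon>])
      show "z + t *\<^sub>R (z' - z) \<in> ?C" if "t \<in> {0..1}" for t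
      proof -
        have "norm (t *\<^sub>R (z' - z)) \<le> norm (z' - z)"
          using that by (simp add: mult_left_le_one_le)
        then show ?thesis using z(2) by (simp add: dist_norm)
      qed
      show "(f has_derivative frechet_derivative f (at x)) (at x within ?C)" if "x \<in> ?C" for x
        using der that C has_derivative_at_withinI by blast
      show "onorm (frechet_derivative f (at x) - frechet_derivative f (at z)) \<le> \<epsilon>"
        if x: "x \<in> ?C" for x
      proof (rule onorm_le)
        fix v
        have df: "f differentiable (at x)" "f differentiable (at z)"
          using der[of x] der[of z] x C zz unfolding differentiable_def by blast+
        have "frechet_derivative f (at x) v - frechet_derivative f (at z) v
          = (\<Sum>b\<in>Basis. (v \<bullet> b) * (frechet_derivative f (at x) b - frechet_derivative f (at z) b))"
          by (subst (1 2) frechet_derivative_Basis) (use df in \<open>simp_all add: sum_subtractf algebra_simps\<close>)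
        also have "norm \<dots> \<le> (\<Sum>b\<in>(Basis::'a set). norm v * (\<epsilon> / D))"
        proof (rule sum_norm_le)
          fix b :: 'a assume b: "b \<in> Basis"
          have "dist (frechet_derivative f (at x) b) (frechet_derivative f (at z) b) < \<epsilon> / D"
          proof -
            have "x \<in> K'" "z \<in> K'" "dist x z < \<Delta> b"
              using x zz C \<delta>(3)[OF b] by (auto simp: dist_commute)
            then show ?thesis using \<Delta>[OF b] by blast
          qed
          then show "norm ((v \<bullet> b) * (frechet_derivative f (at x) b - frechet_derivative f (at z) b))
              \<le> norm v * (\<epsilon> / D)"
            unfolding norm_mult using Basis_le_norm[OF b, of v]
            by (intro mult_mono) (auto simp: dist_norm)
        qed
        also have "\<dots> = \<epsilon> * norm v" using D by (simp add: D_def)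
        finally show "norm ((frechet_derivative f (at x) - frechet_derivative f (at z)) v) \<le> \<epsilon> * norm v"
          by simp
      qed
    qed (rule zz)
    moreover have "z' \<in> S"
      using C K'S z(2) by (auto simp: subset_iff dist_norm norm_minus_commute)
    ultimately show "z' \<in> S \<and> \<bar>f z' - f z - frechet_derivative f (at z) (z' - z)\<bar> \<le> \<epsilon> * norm (z' - z)"
      by (simp add: mult.commute)
  qed
qed

section \<open>Partial derivatives\<close>

lemma fd_add:
  assumes "f differentiable (at z)" "g differentiable (at z)"
  shows "frechet_derivative (\<lambda>w. f w + g w) (at z) v
       = frechet_derivative f (at z) v + frechet_derivative g (at z) v"
  using frechet_derivative_at[OF has_derivative_add[OF
      assms[unfolded frechet_derivative_works]]] by metis

lemma fd_diff:
  assumes "f differentiable (at z)" "g differentiable (at z)"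
  shows "frechet_derivative (\<lambda>w. f w - g w) (at z) v
       = frechet_derivative f (at z) v - frechet_derivative g (at z) v"
  using frechet_derivative_at[OF has_derivative_diff[OF
      assms[unfolded frechet_derivative_works]]] by metis

lemma fd_mult:
  fixes f g :: "'a::real_normed_vector \<Rightarrow> real"
  assumes "f differentiable (at z)" "g differentiable (at z)"
  shows "frechet_derivative (\<lambda>w. f w * g w) (at z) v
       = f z * frechet_derivative g (at z) v + frechet_derivative f (at z) v * g z"
  using frechet_derivative_at[OF has_derivative_mult[OF
      assms[unfolded frechet_derivative_works]]] by metis

lemma fd_sum:
  assumes "\<And>i. i \<in> I \<Longrightarrow> f i differentiable (at z)"
  shows "frechet_derivative (\<lambda>w. \<Sum>i\<in>I. f i w) (at z) v
       = (\<Sum>i\<in>I. frechet_derivative (f i) (at z) v)"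
proof -
  have "((\<lambda>w. \<Sum>i\<in>I. f i w) has_derivative (\<lambda>v. \<Sum>i\<in>I. frechet_derivative (f i) (at z) v)) (at z)"
    using assms by (intro has_derivative_sum) (simp add: frechet_derivative_works)
  from frechet_derivative_at[OF this] show ?thesis by metis
qed

lemma fd_const: "frechet_derivative (\<lambda>w. c) (at z) v = 0"
  using frechet_derivative_at[OF has_derivative_const[of c "at z"]] by metis

lemma fd_bounded_linear: "bounded_linear L \<Longrightarrow> frechet_derivative L (at z) v = L v"
  using frechet_derivative_at[OF bounded_linear_imp_has_derivative] by metis

lemma pt_decomp:
  fixes u :: "'n::finite pt"
  shows "u = (\<Sum>k\<in>UNIV. fst u $ k *\<^sub>R (axis k 1, 0)) + (\<Sum>k\<in>UNIV. snd u $ k *\<^sub>R (0, axis k 1))"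
proof -
  have *: "(\<Sum>k\<in>UNIV. (x $ k) *\<^sub>R axis k 1) = x" for x :: "real^'n"
    by (simp add: vec_eq_iff axis_def if_distrib sum.delta cong: if_cong)
  show ?thesis
    by (rule prod_eqI) (simp_all add: fst_sum snd_sum *)
qed

lemma fd_pd:
  assumes "f differentiable (at z)"
  shows "frechet_derivative f (at z) u
    = (\<Sum>k\<in>UNIV. fst u $ k * pdx k f z) + (\<Sum>k\<in>UNIV. snd u $ k * pdy k f z)"
proof -
  have l: "linear (frechet_derivative f (at z))" using assms linear_frechet_derivative by blast
  have 1: "frechet_derivative f (at z) (a *\<^sub>R x, 0) = a * frechet_derivative f (at z) (x, 0)"
    and 2: "frechet_derivative f (at z) (0, a *\<^sub>R x) = a * frechet_derivative f (at z) (0, x)" for a x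
    using linear_cmul[OF l, of a "(x, 0)"] linear_cmul[OF l, of a "(0, x)"] by simp_all
  show ?thesis
    by (subst pt_decomp[of u])
      (simp add: linear_add[OF l] linear_sum[OF l] 1 2 pdx_def pdy_def)
qed

lemma bounded_linear_snd_nth: "bounded_linear (\<lambda>w::'n::finite pt. snd w $ k)"
  by (intro bounded_linear_compose[OF bounded_linear_vec_nth bounded_linear_snd])

section \<open>Local Finsler geometry\<close>

text \<open>In the following locale \<open>E = F\<^sup>2\<close>, \<open>g\<close> and \<open>gi\<close> are the fundamental tensor and its inverse, \<open>del k\<close> is
  \<open>\<delta>/\<delta>x\<^sup>k\<close>, \<open>Gam i j k\<close> is \<open>\<Gamma>\<^sup>i\<^sub>j\<^sub>k\<close>, \<open>ver\<close> is \<open>F \<delta>y\<close>, and \<open>tau0\<close> is the distortion for \<open>\<sigma> = 1\<close>; a trailing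
  \<open>l\<close>, as in \<open>Gl\<close> and \<open>Gaml\<close>, marks a lowered upper index.\<close>

locale local_finsler =
  fixes F :: "'n::finite pt \<Rightarrow> real" and U :: "(real ^ 'n) set"
  assumes open_U: "open U"
    and smooth_F: "smooth_on (U \<times> (UNIV - {0})) F"
    and F_scale: "\<And>x y a. x \<in> U \<Longrightarrow> y \<noteq> 0 \<Longrightarrow> a > 0 \<Longrightarrow> F (x, a *\<^sub>R y) = a * F (x, y)"
    and F_nonneg: "\<And>z. z \<in> U \<times> (UNIV - {0}) \<Longrightarrow> 0 \<le> F z"
    and fund_posdef: "\<And>z w. z \<in> U \<times> (UNIV - {0}) \<Longrightarrow> w \<noteq> 0 \<Longrightarrow> 0 < w \<bullet> (fund F z *v w)"
begin

definition S :: "'n pt set" where "S = U \<times> (UNIV - {0})"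

abbreviation sm :: "('n pt \<Rightarrow> real) \<Rightarrow> bool" where "sm \<equiv> smooth_on S"

lemma open_S: "open S"
  unfolding S_def using open_U by (simp add: open_Times open_delete)

lemmas sm_const [simp] = smooth_on_const[OF open_S]
lemmas sm_add [simp] = smooth_on_add[OF open_S]
lemmas sm_diff [simp] = smooth_on_diff[OF open_S]
lemmas sm_mult [simp] = smooth_on_mult[OF open_S]

lemma sm_divide [simp]: "sm f \<Longrightarrow> sm (\<lambda>w. f w / c)"
  unfolding divide_inverse by simp

lemmas sm_cong = smooth_on_cong[OF open_S]

lemma sm_sum [simp]: "(\<And>i. i \<in> I \<Longrightarrow> sm (f i)) \<Longrightarrow> sm (\<lambda>w. \<Sum>i\<in>I. f i w)"
  by (rule smooth_on_sum[OF open_S])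

lemma sm_pdx [simp]: "sm f \<Longrightarrow> sm (pdx i f)"
  unfolding pdx_def[abs_def] by (rule smooth_on_frechet)

lemma sm_pdy [simp]: "sm f \<Longrightarrow> sm (pdy i f)"
  unfolding pdy_def[abs_def] by (rule smooth_on_frechet)

lemma sm_snd [simp]: "sm (\<lambda>w. snd w $ k)"
  by (rule smooth_on_bounded_linear[OF open_S bounded_linear_snd_nth])

lemma sm_differentiable [simp]: "sm f \<Longrightarrow> z \<in> S \<Longrightarrow> f differentiable (at z)"
  by (rule smooth_on_differentiable)

lemma pdx_const [simp]: "pdx i (\<lambda>w. c) z = 0"
  by (simp add: pdx_def fd_const)
lemma pdy_const [simp]: "pdy i (\<lambda>w. c) z = 0"
  by (simp add: pdy_def fd_const)

lemma pdx_snd [simp]: "pdx i (\<lambda>w. snd w $ k) z = 0"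
  unfolding pdx_def by (subst fd_bounded_linear[OF bounded_linear_snd_nth]) simp
lemma pdy_snd [simp]: "pdy i (\<lambda>w. snd w $ k) z = (if i = k then 1 else 0)"
  unfolding pdy_def by (subst fd_bounded_linear[OF bounded_linear_snd_nth]) (simp add: axis_def eq_commute)

lemma pdx_add [simp]: "z \<in> S \<Longrightarrow> sm f \<Longrightarrow> sm g \<Longrightarrow> pdx i (\<lambda>w. f w + g w) z = pdx i f z + pdx i g z"
  by (simp add: pdx_def fd_add)
lemma pdy_add [simp]: "z \<in> S \<Longrightarrow> sm f \<Longrightarrow> sm g \<Longrightarrow> pdy i (\<lambda>w. f w + g w) z = pdy i f z + pdy i g z"
  by (simp add: pdy_def fd_add)
lemma pdx_diff [simp]: "z \<in> S \<Longrightarrow> sm f \<Longrightarrow> sm g \<Longrightarrow> pdx i (\<lambda>w. f w - g w) z = pdx i f z - pdx i g z"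
  by (simp add: pdx_def fd_diff)
lemma pdy_diff [simp]: "z \<in> S \<Longrightarrow> sm f \<Longrightarrow> sm g \<Longrightarrow> pdy i (\<lambda>w. f w - g w) z = pdy i f z - pdy i g z"
  by (simp add: pdy_def fd_diff)
lemma pdx_mult [simp]: "z \<in> S \<Longrightarrow> sm f \<Longrightarrow> sm g \<Longrightarrow>
    pdx i (\<lambda>w. f w * g w) z = f z * pdx i g z + pdx i f z * g z"
  by (simp add: pdx_def fd_mult)
lemma pdy_mult [simp]: "z \<in> S \<Longrightarrow> sm f \<Longrightarrow> sm g \<Longrightarrow>
    pdy i (\<lambda>w. f w * g w) z = f z * pdy i g z + pdy i f z * g z"
  by (simp add: pdy_def fd_mult)
lemma pdx_sum [simp]: "z \<in> S \<Longrightarrow> (\<And>k. k \<in> I \<Longrightarrow> sm (f k)) \<Longrightarrow>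
    pdx i (\<lambda>w. \<Sum>k\<in>I. f k w) z = (\<Sum>k\<in>I. pdx i (f k) z)"
  by (simp add: pdx_def fd_sum)
lemma pdy_sum [simp]: "z \<in> S \<Longrightarrow> (\<And>k. k \<in> I \<Longrightarrow> sm (f k)) \<Longrightarrow>
    pdy i (\<lambda>w. \<Sum>k\<in>I. f k w) z = (\<Sum>k\<in>I. pdy i (f k) z)"
  by (simp add: pdy_def fd_sum)

lemma pdx_divide [simp]: "z \<in> S \<Longrightarrow> sm f \<Longrightarrow> pdx i (\<lambda>w. f w / c) z = pdx i f z / c"
  by (simp add: divide_inverse)
lemma pdy_divide [simp]: "z \<in> S \<Longrightarrow> sm f \<Longrightarrow> pdy i (\<lambda>w. f w / c) z = pdy i f z / c"
  by (simp add: divide_inverse)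

lemma fd_cong: "sm f \<Longrightarrow> z \<in> S \<Longrightarrow> (\<And>w. w \<in> S \<Longrightarrow> f w = g w) \<Longrightarrow>
    frechet_derivative g (at z) = frechet_derivative f (at z)"
  using frechet_derivative_transform_within_open[of f z S g] open_S by simp

lemma pdx_cong: "sm f \<Longrightarrow> z \<in> S \<Longrightarrow> (\<And>w. w \<in> S \<Longrightarrow> f w = g w) \<Longrightarrow> pdx i g z = pdx i f z"
  using fd_cong[of f z g] by (simp add: pdx_def)
lemma pdy_cong: "sm f \<Longrightarrow> z \<in> S \<Longrightarrow> (\<And>w. w \<in> S \<Longrightarrow> f w = g w) \<Longrightarrow> pdy i g z = pdy i f z"
  using fd_cong[of f z g] by (simp add: pdy_def)

lemma fd_commute: "sm f \<Longrightarrow> z \<in> S \<Longrightarrow>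
    frechet_derivative (\<lambda>x. frechet_derivative f (at x) u) (at z) v
  = frechet_derivative (\<lambda>x. frechet_derivative f (at x) v) (at z) u"
  by (rule frechet_derivative_commute[OF open_S])

lemma pdy_pdy: "sm f \<Longrightarrow> z \<in> S \<Longrightarrow> pdy i (pdy j f) z = pdy j (pdy i f) z"
  using fd_commute by (simp add: pdy_def[abs_def])
lemma pdy_pdx: "sm f \<Longrightarrow> z \<in> S \<Longrightarrow> pdy i (pdx j f) z = pdx j (pdy i f) z"
  using fd_commute by (simp add: pdy_def[abs_def] pdx_def[abs_def])

text \<open>Homogeneity is encoded by Euler's identity, which can be differentiated and contracted.
  Invariance under scaling is recovered for degree 0 in \<open>homog_0_scale\<close>.\<close>

definition homog :: "real \<Rightarrow> ('n pt \<Rightarrow> real) \<Rightarrow> bool" where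
  "homog c f \<longleftrightarrow> (\<forall>z\<in>S. (\<Sum>k\<in>UNIV. snd z $ k * pdy k f z) = c * f z)"

lemma homogD: "homog c f \<Longrightarrow> z \<in> S \<Longrightarrow> (\<Sum>k\<in>UNIV. snd z $ k * pdy k f z) = c * f z"
  by (simp add: homog_def)

lemma homog_pdy:
  assumes "sm f" "homog c f"
  shows "homog (c - 1) (pdy j f)"
  unfolding homog_def
proof
  fix z assume z: "z \<in> S"
  have "pdy j (\<lambda>z. \<Sum>k\<in>UNIV. snd z $ k * pdy k f z) z = pdy j (\<lambda>z. c * f z) z"
    by (rule pdy_cong) (use assms z in \<open>auto simp: homogD\<close>)
  then have "(\<Sum>k\<in>UNIV. snd z $ k * pdy j (pdy k f) z + (if j = k then 1 else 0) * pdy k f z) = c * pdy j f z"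
    using z assms(1) by simp
  then have "(\<Sum>k\<in>UNIV. snd z $ k * pdy j (pdy k f) z) + pdy j f z = c * pdy j f z"
    by (simp add: sum.distrib if_distrib[of "\<lambda>x. x * _"] cong: if_cong)
  then show "(\<Sum>k\<in>UNIV. snd z $ k * pdy k (pdy j f) z) = (c - 1) * pdy j f z"
    using pdy_pdy[OF assms(1) z, of _ j] by (simp add: algebra_simps)
qed

lemma homog_pdx:
  assumes "sm f" "homog c f"
  shows "homog c (pdx j f)"
  unfolding homog_def
proof
  fix z assume z: "z \<in> S"
  have "pdx j (\<lambda>z. \<Sum>k\<in>UNIV. snd z $ k * pdy k f z) z = pdx j (\<lambda>z. c * f z) z"
    by (rule pdx_cong) (use assms z in \<open>auto simp: homogD\<close>)
  then have "(\<Sum>k\<in>UNIV. snd z $ k * pdx j (pdy k f) z) = c * pdx j f z"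
    using z assms(1) by simp
  then show "(\<Sum>k\<in>UNIV. snd z $ k * pdy k (pdx j f) z) = c * pdx j f z"
    using pdy_pdx[OF assms(1) z, of _ j] by simp
qed

definition E :: "'n pt \<Rightarrow> real" where "E = (\<lambda>w. (F w)\<^sup>2)"

lemma sm_F [simp]: "sm F" unfolding S_def by (rule smooth_F)

lemma sm_E [simp]: "sm E" unfolding E_def power2_eq_square by simp

definition g :: "'n \<Rightarrow> 'n \<Rightarrow> 'n pt \<Rightarrow> real" where "g i j z = 1/2 * pdy j (pdy i E) z"

lemma fund_g: "fund F z $ i $ j = g i j z"
  by (simp add: fund_def g_def E_def)

lemma sm_g [simp]: "sm (g i j)" unfolding g_def[abs_def] by simp

lemma g_sym: "z \<in> S \<Longrightarrow> g i j z = g j i z"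
  by (simp add: g_def pdy_pdy)

lemma pdy_E2: "pdy j (pdy i E) z = 2 * g i j z" by (simp add: g_def)

lemma E_scale: "x \<in> U \<Longrightarrow> y \<noteq> 0 \<Longrightarrow> a > 0 \<Longrightarrow> E (x, a *\<^sub>R y) = a\<^sup>2 * E (x, y)"
  using F_scale by (simp add: E_def power_mult_distrib)

lemma homog_E: "homog 2 E"
  unfolding homog_def
proof
  fix z assume z: "z \<in> S"
  obtain x y where xy: "z = (x, y)" "x \<in> U" "y \<noteq> 0" using z by (auto simp: S_def)
  have 1: "((\<lambda>a. (x, a *\<^sub>R y)) has_derivative (\<lambda>a. (0, a *\<^sub>R y))) (at 1)"
    by (auto intro!: derivative_eq_intros)
  have "(E has_derivative frechet_derivative E (at (x, 1 *\<^sub>R y))) (at (x, 1 *\<^sub>R y))"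
    using xy(1) sm_differentiable[OF sm_E z] frechet_derivative_works[of E "at z"] by simp
  from has_derivative_compose[OF 1 this]
  have "((\<lambda>a. E (x, a *\<^sub>R y)) has_derivative (\<lambda>a. frechet_derivative E (at z) (0, a *\<^sub>R y))) (at 1)"
    using xy by simp
  moreover have "((\<lambda>a. E (x, a *\<^sub>R y)) has_derivative (\<lambda>a. a * (2 * E (x, y)))) (at 1)"
  proof (rule has_derivative_transform_within_open[where s = "{0<..}"])
    show "((\<lambda>a. a\<^sup>2 * E (x, y)) has_derivative (\<lambda>a. a * (2 * E (x, y)))) (at 1)"
      by (auto intro!: derivative_eq_intros)
  qed (auto simp: E_scale[OF xy(2,3)])
  ultimately have "frechet_derivative E (at z) (0, 1 *\<^sub>R y) = 1 * (2 * E (x, y))"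
    using has_derivative_unique by metis
  then show "(\<Sum>k\<in>UNIV. snd z $ k * pdy k E z) = 2 * E z"
    using fd_pd[OF sm_differentiable[OF sm_E z], of "(0, y)"] xy by simp
qed

lemma homog_E1: "homog 1 (pdy i E)" using homog_pdy[OF sm_E homog_E, of i] by simp
lemma homog_E2: "homog 0 (pdy j (pdy i E))" using homog_pdy[OF _ homog_E1, of i j] by simp

lemma y_g: "z \<in> S \<Longrightarrow> (\<Sum>j\<in>UNIV. snd z $ j * g i j z) = 1/2 * pdy i E z"
  using homogD[OF homog_E1[of i]]
  by (simp add: g_def sum_distrib_left[symmetric] sum_divide_distrib[symmetric])

lemma homog_g: "homog 0 (g i j)"
  using homog_E2[of j i] unfolding homog_def
  by (simp add: g_def[abs_def] sum_distrib_left[symmetric] sum_divide_distrib[symmetric])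

lemma posdef: "z \<in> S \<Longrightarrow> w \<noteq> 0 \<Longrightarrow> 0 < w \<bullet> (fund F z *v w)"
  unfolding S_def by (rule fund_posdef)

lemma snd_nz: "z \<in> S \<Longrightarrow> snd z \<noteq> 0"
  by (auto simp: S_def)

text \<open>Two applications of Euler's identity give \<open>g(y, y) = E\<close>, so this is
  positive definiteness evaluated at \<open>y\<close> itself.\<close>

lemma E_pos: "z \<in> S \<Longrightarrow> E z > 0"
proof -
  assume z: "z \<in> S"
  have "snd z \<bullet> (fund F z *v snd z) = (\<Sum>i\<in>UNIV. snd z $ i * (1/2 * pdy i E z))"
    unfolding y_g[OF z, symmetric]
    by (simp add: inner_vec_def matrix_vector_mult_def fund_g mult.commute)
  also have "\<dots> = E z" using homogD[OF homog_E z]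
    by (simp add: sum_divide_distrib[symmetric])
  finally show ?thesis using posdef[OF z snd_nz[OF z]] by simp
qed

lemma F_pos: "z \<in> S \<Longrightarrow> F z > 0"
  using E_pos[of z] F_nonneg[of z] unfolding E_def S_def by (cases "F z = 0") auto

section \<open>Inverse and determinant of the fundamental tensor\<close>

definition gi :: "'n \<Rightarrow> 'n \<Rightarrow> 'n pt \<Rightarrow> real" where "gi i j z = fund_inv F z $ i $ j"

lemma fund_invertible: "z \<in> S \<Longrightarrow> invertible (fund F z)"
  unfolding S_def using posdef_invertible fund_posdef by blast

lemma g_gi: "z \<in> S \<Longrightarrow> (\<Sum>j\<in>UNIV. g i j z * gi j k z) = (if i = k then 1 else 0)"
  using invertible_matrix_inv(1)[OF fund_invertible, of z]
  by (simp add: matrix_matrix_mult_def vec_eq_iff mat_def fund_g gi_def fund_inv_def)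

lemma gi_g: "z \<in> S \<Longrightarrow> (\<Sum>j\<in>UNIV. gi i j z * g j k z) = (if i = k then 1 else 0)"
  using invertible_matrix_inv(2)[OF fund_invertible, of z]
  by (simp add: matrix_matrix_mult_def vec_eq_iff mat_def fund_g gi_def fund_inv_def)

lemma raise_lower:
  assumes "z \<in> S"
  shows "(\<Sum>s\<in>UNIV. gi i s z * (\<Sum>j\<in>UNIV. g s j z * a j)) = a i"
proof -
  have "(\<Sum>s\<in>UNIV. gi i s z * (\<Sum>j\<in>UNIV. g s j z * a j))
      = (\<Sum>j\<in>UNIV. (\<Sum>s\<in>UNIV. gi i s z * g s j z) * a j)"
    unfolding sum_distrib_left sum_distrib_right by (subst sum.swap) (simp add: mult_ac)
  then show ?thesis using gi_g[OF assms] by (simp add: if_distrib[of "\<lambda>x. x * _"] cong: if_cong)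
qed

lemma lower_raise:
  assumes "z \<in> S"
  shows "(\<Sum>s\<in>UNIV. g i s z * (\<Sum>j\<in>UNIV. gi s j z * a j)) = a i"
proof -
  have "(\<Sum>s\<in>UNIV. g i s z * (\<Sum>j\<in>UNIV. gi s j z * a j))
      = (\<Sum>j\<in>UNIV. (\<Sum>s\<in>UNIV. g i s z * gi s j z) * a j)"
    unfolding sum_distrib_left sum_distrib_right by (subst sum.swap) (simp add: mult_ac)
  then show ?thesis using g_gi[OF assms] by (simp add: if_distrib[of "\<lambda>x. x * _"] cong: if_cong)
qed

text \<open>Identities with an upper index are checked after lowering it: the lowered spray and the
  lowered Christoffel symbols have formulas without the inverse metric.\<close>

lemma lower_inj:
  assumes "z \<in> S" "\<And>s. (\<Sum>j\<in>UNIV. g s j z * a j) = (\<Sum>j\<in>UNIV. g s j z * b j)"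
  shows "a i = b i"
  using raise_lower[OF assms(1), of i a] raise_lower[OF assms(1), of i b] assms(2) by simp

lemma gi_sym:
  assumes "z \<in> S"
  shows "gi i j z = gi j i z"
proof (rule lower_inj[OF assms])
  fix s
  show "(\<Sum>j\<in>UNIV. g s j z * gi j k z) = (\<Sum>j\<in>UNIV. g s j z * gi k j z)" for k
    using g_gi[OF assms, of s k] gi_g[OF assms, of k s] g_sym[OF assms, of s]
    by (simp add: mult.commute eq_commute)
qed

lemma sm_det:
  fixes A :: "'n pt \<Rightarrow> real^'n^'n"
  assumes "\<And>i j. sm (\<lambda>z. A z $ i $ j)"
  shows "sm (\<lambda>z. det (A z))"
  unfolding det_def
  by (intro sm_sum sm_mult sm_const smooth_on_prod[OF open_S] assms)

definition dt :: "'n pt \<Rightarrow> real" where "dt z = det (fund F z)"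

lemma dt_pos: "z \<in> S \<Longrightarrow> dt z > 0"
  unfolding dt_def S_def using posdef_det_pos fund_posdef by blast

lemma sm_dt [simp]: "sm dt"
  unfolding dt_def[abs_def] by (rule sm_det) (simp add: fund_g)

lemma sm_gi [simp]: "sm (gi i j)"
proof (rule sm_cong)
  have "sm (\<lambda>z. (\<chi> i' j'. if j' = i then axis j 1 $ i' else fund F z $ i' $ j') $ i' $ j')" for i' j'
    by (cases "j' = i") (simp_all add: fund_g)
  then show "sm (\<lambda>z. det (\<chi> i' j'. if j' = i then axis j 1 $ i' else fund F z $ i' $ j') * inverse (dt z))"
    by (intro sm_mult sm_det smooth_on_inverse[OF open_S]) (use dt_pos in force)+
  show "det (\<chi> i' j'. if j' = i then axis j 1 $ i' else fund F z $ i' $ j') * inverse (dt z) = gi i j z"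
    if "z \<in> S" for z
    using matrix_inv_cramer[of "fund F z" i j] dt_pos[OF that]
    by (simp add: gi_def fund_inv_def dt_def divide_inverse)
qed

lemma pdy_gi:
  assumes z: "z \<in> S"
  shows "pdy k (gi i j) z = - (\<Sum>a\<in>UNIV. gi i a z * (\<Sum>b\<in>UNIV. pdy k (g a b) z * gi b j z))"
proof -
  have "(\<Sum>b\<in>UNIV. g a b z * pdy k (gi b j) z) = - (\<Sum>b\<in>UNIV. pdy k (g a b) z * gi b j z)" for a
  proof -
    have "pdy k (\<lambda>z. \<Sum>b\<in>UNIV. g a b z * gi b j z) z = pdy k (\<lambda>z. if a = j then 1 else 0) z"
      by (rule pdy_cong) (use z in \<open>auto simp: g_gi\<close>)
    then show ?thesis using z by (simp add: sum.distrib)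
  qed
  then have "(\<Sum>a\<in>UNIV. gi i a z * (\<Sum>b\<in>UNIV. g a b z * pdy k (gi b j) z))
     = - (\<Sum>a\<in>UNIV. gi i a z * (\<Sum>b\<in>UNIV. pdy k (g a b) z * gi b j z))"
    by (simp add: sum_negf)
  then show ?thesis using raise_lower[OF z, of i "\<lambda>b. pdy k (gi b j) z"] by simp
qed

lemma fd_dt:
  assumes z: "z \<in> S"
  shows "frechet_derivative dt (at z) v
    = dt z * (\<Sum>i\<in>UNIV. \<Sum>j\<in>UNIV. gi i j z * frechet_derivative (g i j) (at z) v)"
proof -
  have d: "((\<lambda>w. fund F w $ i $ j) has_derivative
      (\<lambda>v. (\<chi> i j. frechet_derivative (g i j) (at z) v) $ i $ j)) (at z)" for i j
    using sm_differentiable[OF sm_g z, of i j] by (simp add: fund_g frechet_derivative_works)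
  have "frechet_derivative dt (at z) v
     = dt z * (\<Sum>i\<in>UNIV. \<Sum>j\<in>UNIV. gi i j z * frechet_derivative (g j i) (at z) v)"
    using fun_cong[OF frechet_derivative_at[OF has_derivative_det[OF d fund_invertible[OF z]]], of v]
    by (simp add: dt_def[abs_def] gi_def fund_inv_def)
  moreover have "frechet_derivative (g j i) (at z) = frechet_derivative (g i j) (at z)" for i j
    by (rule fd_cong) (use z g_sym in auto)
  ultimately show ?thesis by simp
qed

lemma pdy_dt: "z \<in> S \<Longrightarrow> pdy k dt z = dt z * (\<Sum>i\<in>UNIV. \<Sum>j\<in>UNIV. gi i j z * pdy k (g i j) z)"
  unfolding pdy_def by (rule fd_dt)

lemma pdy_g_sym12: "z \<in> S \<Longrightarrow> pdy k (g i j) z = pdy k (g j i) z"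
  by (rule pdy_cong) (auto simp: g_sym)

lemma pdx_g_sym: "z \<in> S \<Longrightarrow> pdx k (g i j) z = pdx k (g j i) z"
  by (rule pdx_cong) (auto simp: g_sym)

text \<open>Since \<open>g\<close> is half the fibre Hessian of \<open>E\<close>, its fibre
  derivative is a third derivative, up to the factor \<open>F / 2\<close> the Cartan tensor. Every
  later cancellation of derivatives of \<open>g\<close> rests on this total symmetry.\<close>

lemma pdy_g_sym23:
  assumes "z \<in> S" shows "pdy k (g i j) z = pdy j (g i k) z"
proof -
  have 1: "pdy k (g i j) z = 1/2 * pdy k (pdy j (pdy i E)) z" for k j
    using assms by (simp add: g_def[abs_def])
  show ?thesis unfolding 1 using pdy_pdy[of "pdy i E" z k j] assms by simp
qed

lemma y_dg:
  assumes "z \<in> S"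
  shows "(\<Sum>j\<in>UNIV. snd z $ j * pdy j (g s k) z) = 0"
    "(\<Sum>j\<in>UNIV. snd z $ j * pdy k (g s j) z) = 0"
    "(\<Sum>j\<in>UNIV. snd z $ j * pdy k (g j s) z) = 0"
  using homogD[OF homog_g assms, of s k] pdy_g_sym23[OF assms, of k s] pdy_g_sym12[OF assms, of k _ s]
  by simp_all

lemma y_pdx_g:
  assumes "z \<in> S"
  shows "(\<Sum>j\<in>UNIV. snd z $ j * pdx k (g s j) z) = 1/2 * pdx k (pdy s E) z"
proof -
  have 1: "pdx k (g s j) z = 1/2 * pdy j (pdx k (pdy s E)) z" for j
    using assms by (simp add: g_def[abs_def] pdy_pdx)
  show ?thesis unfolding 1
    using homogD[OF homog_pdx[OF _ homog_E1] assms, of s k]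
    by (simp add: sum_distrib_left[symmetric] sum_divide_distrib[symmetric])
qed

subsection \<open>Spray and nonlinear connection\<close>

abbreviation G :: "'n \<Rightarrow> 'n pt \<Rightarrow> real" where "G \<equiv> spray F"
abbreviation N :: "'n \<Rightarrow> 'n \<Rightarrow> 'n pt \<Rightarrow> real" where "N \<equiv> nonlin F"

definition Gl :: "'n \<Rightarrow> 'n pt \<Rightarrow> real" where
  "Gl j z = 1/4 * ((\<Sum>k\<in>UNIV. pdx k (pdy j E) z * snd z $ k) - pdx j E z)"

lemma sm_Gl [simp]: "sm (Gl j)" unfolding Gl_def[abs_def] by simp

lemma G_eq: "G i z = (\<Sum>j\<in>UNIV. gi i j z * Gl j z)"
  by (simp add: spray_def Gl_def gi_def E_def sum_distrib_left sum_divide_distrib)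

lemma sm_G [simp]: "sm (G i)" unfolding G_eq[abs_def] by simp

lemma sm_N [simp]: "sm (N i j)" unfolding nonlin_def by simp

lemma g_G: "z \<in> S \<Longrightarrow> (\<Sum>i\<in>UNIV. g s i z * G i z) = Gl s z"
  unfolding G_eq by (rule lower_raise)

lemma pdy_Gl:
  assumes "z \<in> S"
  shows "pdy k (Gl s) z = 1/4 * ((\<Sum>j\<in>UNIV. 2 * pdx j (g s k) z * snd z $ j)
     + pdx k (pdy s E) z - pdx s (pdy k E) z)"
proof -
  have "pdy k (Gl s) z = 1/4 * ((\<Sum>j\<in>UNIV. pdx j (pdy s E) z * (if k = j then 1 else 0)
      + pdy k (pdx j (pdy s E)) z * snd z $ j) - pdy k (pdx s E) z)"
    unfolding Gl_def[abs_def] using assms by simp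
  moreover have "pdy k (pdx j (pdy s E)) z = 2 * pdx j (g s k) z" for j
    using assms by (simp add: pdy_pdx g_def[abs_def])
  ultimately show ?thesis
    using assms by (simp add: sum.distrib pdy_pdx if_distrib[of "\<lambda>x. _ * x"] cong: if_cong)
qed

lemma homog_Gl: "homog 2 (Gl s)"
  unfolding homog_def
proof
  fix z assume z: "z \<in> S"
  have "(\<Sum>k\<in>UNIV. snd z $ k * pdy k (Gl s) z) = 1/4 *
    ((\<Sum>k\<in>UNIV. snd z $ k * (\<Sum>j\<in>UNIV. 2 * pdx j (g s k) z * snd z $ j))
     + (\<Sum>k\<in>UNIV. snd z $ k * pdx k (pdy s E) z) - (\<Sum>k\<in>UNIV. snd z $ k * pdx s (pdy k E) z))"
    unfolding pdy_Gl[OF z] by (simp add: sum.distrib sum_subtractf algebra_simps sum_distrib_left sum_divide_distrib)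
  also have "(\<Sum>k\<in>UNIV. snd z $ k * (\<Sum>j\<in>UNIV. 2 * pdx j (g s k) z * snd z $ j))
     = (\<Sum>j\<in>UNIV. 2 * snd z $ j * (\<Sum>k\<in>UNIV. snd z $ k * pdx j (g s k) z))"
    unfolding sum_distrib_left by (subst sum.swap) (simp add: mult_ac)
  also have "\<dots> = (\<Sum>k\<in>UNIV. snd z $ k * pdx k (pdy s E) z)"
    unfolding y_pdx_g[OF z] by simp
  also have "(\<Sum>k\<in>UNIV. snd z $ k * pdx s (pdy k E) z) = 2 * pdx s E z"
    using homogD[OF homog_pdx[OF sm_E homog_E] z, of s] z by (simp add: pdy_pdx)
  finally show "(\<Sum>k\<in>UNIV. snd z $ k * pdy k (Gl s) z) = 2 * Gl s z"
    by (simp add: Gl_def[of s z] mult.commute)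
qed

lemma g_N:
  assumes "z \<in> S"
  shows "(\<Sum>i\<in>UNIV. g s i z * N i k z) = pdy k (Gl s) z - (\<Sum>i\<in>UNIV. pdy k (g s i) z * G i z)"
proof -
  have "pdy k (\<lambda>z. \<Sum>i\<in>UNIV. g s i z * G i z) z = pdy k (Gl s) z"
    by (rule pdy_cong) (use assms g_G in auto)
  then show ?thesis using assms by (simp add: sum.distrib nonlin_def)
qed

text \<open>After lowering, this is the homogeneity of \<open>Gl\<close>: the extra term from
  differentiating \<open>g\<close> dies on contraction with \<open>y\<close>.\<close>

lemma y_N:
  assumes "z \<in> S"
  shows "(\<Sum>j\<in>UNIV. snd z $ j * N i j z) = 2 * G i z"
proof (rule lower_inj[OF assms])
  fix s
  have "(\<Sum>i\<in>UNIV. g s i z * (\<Sum>j\<in>UNIV. snd z $ j * N i j z))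
     = (\<Sum>j\<in>UNIV. snd z $ j * (\<Sum>i\<in>UNIV. g s i z * N i j z))"
    unfolding sum_distrib_left by (subst sum.swap) (simp add: mult_ac)
  also have "\<dots> = (\<Sum>j\<in>UNIV. snd z $ j * pdy j (Gl s) z)
     - (\<Sum>j\<in>UNIV. snd z $ j * (\<Sum>i\<in>UNIV. pdy j (g s i) z * G i z))"
    unfolding g_N[OF assms] by (simp add: right_diff_distrib sum_subtractf)
  also have "(\<Sum>j\<in>UNIV. snd z $ j * (\<Sum>i\<in>UNIV. pdy j (g s i) z * G i z))
     = (\<Sum>i\<in>UNIV. G i z * (\<Sum>j\<in>UNIV. snd z $ j * pdy j (g s i) z))"
    unfolding sum_distrib_left by (subst sum.swap) (simp add: mult_ac)
  also have "\<dots> = 0" using y_dg(1)[OF assms] by simp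
  finally show "(\<Sum>i\<in>UNIV. g s i z * (\<Sum>j\<in>UNIV. snd z $ j * N i j z)) = (\<Sum>i\<in>UNIV. g s i z * (2 * G i z))"
    using homogD[OF homog_Gl assms, of s] g_G[OF assms, of s]
    by (simp add: sum_distrib_left[symmetric] mult.left_commute)
qed

lemma homog_G: "homog 2 (G i)"
  unfolding homog_def using y_N by (simp add: nonlin_def)

lemma homog_N: "homog 1 (N i j)"
proof -
  have "homog (2 - 1) (pdy j (G i))" by (rule homog_pdy[OF sm_G homog_G])
  then show ?thesis by (simp add: nonlin_def)
qed

subsection \<open>Christoffel symbols\<close>

definition del :: "'n \<Rightarrow> ('n pt \<Rightarrow> real) \<Rightarrow> 'n pt \<Rightarrow> real" where
  "del k f z = pdx k f z - (\<Sum>m\<in>UNIV. N m k z * pdy m f z)"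

lemma sm_del [simp]: "sm f \<Longrightarrow> sm (del k f)" unfolding del_def[abs_def] by simp

lemma del_g_sym: "z \<in> S \<Longrightarrow> del k (g i j) z = del k (g j i) z"
  by (simp add: del_def pdx_g_sym pdy_g_sym12)

lemma fd_del:
  assumes "sm f" "z \<in> S"
  shows "frechet_derivative f (at z) u = (\<Sum>k\<in>UNIV. fst u $ k * del k f z)
    + (\<Sum>m\<in>UNIV. (snd u $ m + (\<Sum>k\<in>UNIV. N m k z * fst u $ k)) * pdy m f z)"
proof -
  have "(\<Sum>m\<in>UNIV. (\<Sum>k\<in>UNIV. N m k z * fst u $ k) * pdy m f z)
     = (\<Sum>k\<in>UNIV. fst u $ k * (\<Sum>m\<in>UNIV. N m k z * pdy m f z))"
    unfolding sum_distrib_left sum_distrib_right by (subst sum.swap) (simp add: mult_ac)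
  then show ?thesis
    unfolding fd_pd[OF sm_differentiable[OF assms]] del_def
    by (simp add: algebra_simps sum.distrib sum_subtractf)
qed

definition Gaml :: "'n \<Rightarrow> 'n \<Rightarrow> 'n \<Rightarrow> 'n pt \<Rightarrow> real" where
  "Gaml s j k z = 1/2 * (del k (g s j) z + del j (g s k) z - del s (g j k) z)"

definition Gam :: "'n \<Rightarrow> 'n \<Rightarrow> 'n \<Rightarrow> 'n pt \<Rightarrow> real" where
  "Gam i j k z = (\<Sum>s\<in>UNIV. gi i s z * Gaml s j k z)"

lemma sm_Gam [simp]: "sm (Gam i j k)"
  unfolding Gam_def[abs_def] Gaml_def[abs_def] by simp

lemma g_Gam: "z \<in> S \<Longrightarrow> (\<Sum>i\<in>UNIV. g s i z * Gam i j k z) = Gaml s j k z"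
  unfolding Gam_def by (rule lower_raise)

lemma Gam_sym: "z \<in> S \<Longrightarrow> Gam i j k z = Gam i k j z"
  unfolding Gam_def Gaml_def using del_g_sym by (simp add: add.commute)

text \<open>In the sum of the two lowered symbols the cyclic terms cancel, exactly as for the
  Levi-Civita connection, with \<open>del\<close> in the role of the coordinate derivatives.\<close>

lemma compat:
  assumes "z \<in> S"
  shows "del k (g i j) z = (\<Sum>m\<in>UNIV. g m j z * Gam m i k z) + (\<Sum>m\<in>UNIV. g i m z * Gam m j k z)"
proof -
  have "(\<Sum>m\<in>UNIV. g m j z * Gam m i k z) = Gaml j i k z"
    using g_Gam[OF assms, of j i k] g_sym[OF assms, of j] by simp
  then show ?thesis
    using g_Gam[OF assms, of i j k] del_g_sym[OF assms] by (simp add: Gaml_def)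
qed

text \<open>Ties the Christoffel symbols back to the spray. Contraction with \<open>y\<close>
  removes the fibre derivatives of \<open>g\<close>, except for the one multiplied by
  \<open>G\<close>, and what remains is the formula \<open>g_N\<close> for the lowered
  \<open>N\<close>.\<close>

lemma y_Gam:
  assumes z: "z \<in> S"
  shows "(\<Sum>j\<in>UNIV. snd z $ j * Gam i j k z) = N i k z"
proof (rule lower_inj[OF z, where a = "\<lambda>i. \<Sum>j\<in>UNIV. snd z $ j * Gam i j k z" and b = "\<lambda>i. N i k z"])
  fix s
  have 1: "(\<Sum>j\<in>UNIV. snd z $ j * del k (g s j) z) = 1/2 * pdx k (pdy s E) z" for k s
  proof -
    have "(\<Sum>j\<in>UNIV. snd z $ j * (\<Sum>m\<in>UNIV. N m k z * pdy m (g s j) z))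
       = (\<Sum>m\<in>UNIV. N m k z * (\<Sum>j\<in>UNIV. snd z $ j * pdy m (g s j) z))"
      unfolding sum_distrib_left by (subst sum.swap) (simp add: mult_ac)
    then show ?thesis
      using y_pdx_g[OF z] y_dg(2)[OF z]
      by (simp add: del_def right_diff_distrib sum_subtractf)
  qed
  have 2: "(\<Sum>j\<in>UNIV. snd z $ j * del j (g s k) z)
      = (\<Sum>j\<in>UNIV. snd z $ j * pdx j (g s k) z) - 2 * (\<Sum>m\<in>UNIV. G m z * pdy m (g s k) z)"
  proof -
    have "(\<Sum>j\<in>UNIV. snd z $ j * (\<Sum>m\<in>UNIV. N m j z * pdy m (g s k) z))
       = (\<Sum>m\<in>UNIV. (\<Sum>j\<in>UNIV. snd z $ j * N m j z) * pdy m (g s k) z)"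
      unfolding sum_distrib_left sum_distrib_right by (subst sum.swap) (simp add: mult_ac)
    also have "\<dots> = 2 * (\<Sum>m\<in>UNIV. G m z * pdy m (g s k) z)"
      unfolding y_N[OF z] by (simp add: sum_distrib_left mult.assoc)
    finally show ?thesis by (simp add: del_def right_diff_distrib sum_subtractf)
  qed
  have "(\<Sum>i\<in>UNIV. g s i z * (\<Sum>j\<in>UNIV. snd z $ j * Gam i j k z))
     = (\<Sum>j\<in>UNIV. snd z $ j * (\<Sum>i\<in>UNIV. g s i z * Gam i j k z))"
    unfolding sum_distrib_left by (subst sum.swap) (simp add: mult_ac)
  also have "\<dots> = 1/2 * ((\<Sum>j\<in>UNIV. snd z $ j * del k (g s j) z) + (\<Sum>j\<in>UNIV. snd z $ j * del j (g s k) z)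
      - (\<Sum>j\<in>UNIV. snd z $ j * del s (g k j) z))"
    unfolding g_Gam[OF z] Gaml_def del_g_sym[OF z, of s k]
    by (simp add: algebra_simps sum.distrib sum_subtractf sum_divide_distrib add_divide_distrib diff_divide_distrib)
  also have "\<dots> = pdy k (Gl s) z - (\<Sum>i\<in>UNIV. pdy k (g s i) z * G i z)"
    unfolding 1 2 pdy_Gl[OF z] pdy_g_sym23[OF z, of k s]
    by (simp add: sum_distrib_left mult_ac algebra_simps)
  finally show "(\<Sum>i\<in>UNIV. g s i z * (\<Sum>j\<in>UNIV. snd z $ j * Gam i j k z)) = (\<Sum>i\<in>UNIV. g s i z * N i k z)"
    unfolding g_N[OF z] .
qed

end

section \<open>A rigidity theorem for elliptic equations of Hessian type\<close>

lemma sum_swap13: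
  "(\<Sum>i\<in>UNIV. \<Sum>a\<in>UNIV. \<Sum>b\<in>UNIV. t i a b) = (\<Sum>b\<in>UNIV. \<Sum>a\<in>UNIV. \<Sum>i\<in>UNIV. t i a b)"
  for t :: "'n::finite \<Rightarrow> 'n \<Rightarrow> 'n \<Rightarrow> real"
proof -
  have "(\<Sum>i\<in>UNIV. \<Sum>a\<in>UNIV. \<Sum>b\<in>UNIV. t i a b) = (\<Sum>i\<in>UNIV. \<Sum>b\<in>UNIV. \<Sum>a\<in>UNIV. t i a b)"
    by (rule sum.cong[OF refl], rule sum.swap)
  also have "\<dots> = (\<Sum>b\<in>UNIV. \<Sum>i\<in>UNIV. \<Sum>a\<in>UNIV. t i a b)" by (rule sum.swap)
  also have "\<dots> = (\<Sum>b\<in>UNIV. \<Sum>a\<in>UNIV. \<Sum>i\<in>UNIV. t i a b)"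
    by (rule sum.cong[OF refl], rule sum.swap)
  finally show ?thesis .
qed

lemma sum_rot3:
  "(\<Sum>i\<in>UNIV. \<Sum>a\<in>UNIV. \<Sum>b\<in>UNIV. t i a b) = (\<Sum>a\<in>UNIV. \<Sum>b\<in>UNIV. \<Sum>i\<in>UNIV. t i a b)"
  for t :: "'n::finite \<Rightarrow> 'n \<Rightarrow> 'n \<Rightarrow> real"
  by (subst sum.swap, rule sum.cong[OF refl], rule sum.swap)

text \<open>Extended by zero over the origin, the components are continuous with continuous
  derivatives and compact support, so the divergence has integral zero. Being continuous and
  nonnegative, it vanishes.\<close>

lemma annulus_divergence:
  fixes v v' :: "'n::finite \<Rightarrow> real^'n \<Rightarrow> real"
  assumes deriv: "\<And>i y. y \<noteq> 0 \<Longrightarrow> ((\<lambda>t. v i (y + t *\<^sub>R axis i 1)) has_real_derivative v' i y) (at 0)"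
    and cont: "\<And>i. continuous_on (UNIV - {0}) (v i)" "\<And>i. continuous_on (UNIV - {0}) (v' i)"
    and r1: "r1 > 0"
    and supp: "\<And>i y. y \<noteq> 0 \<Longrightarrow> norm y < r1 \<or> norm y > r2 \<Longrightarrow> v i y = 0"
      "\<And>i y. y \<noteq> 0 \<Longrightarrow> norm y < r1 \<or> norm y > r2 \<Longrightarrow> v' i y = 0"
    and nonneg: "\<And>y. y \<noteq> 0 \<Longrightarrow> 0 \<le> (\<Sum>i\<in>UNIV. v' i y)"
    and y: "y \<noteq> 0"
  shows "(\<Sum>i\<in>UNIV. v' i y) = 0"
proof -
  define ext where "ext f y = (if y = 0 then 0 else f y)" for f :: "real^'n \<Rightarrow> real" and y
  have ext_cont: "continuous_on UNIV (ext f)"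
    if "continuous_on (UNIV - {0}) f" "\<And>y. y \<noteq> 0 \<Longrightarrow> norm y < r1 \<Longrightarrow> f y = 0" for f
  proof -
    have "continuous_on (UNIV - {0}) (ext f)"
      using that(1) by (rule continuous_on_eq) (auto simp: ext_def)
    moreover have "continuous_on (ball 0 r1) (ext f)"
      by (rule continuous_on_eq[of _ "\<lambda>_. 0"]) (use that(2) in \<open>auto simp: ext_def\<close>)
    ultimately have "continuous_on ((UNIV - {0}) \<union> ball 0 r1) (ext f)"
      by (intro continuous_on_open_Un) auto
    moreover have "(UNIV - {0}) \<union> ball (0::real^'n) r1 = UNIV" using r1 by auto
    ultimately show ?thesis by simp
  qed
  have der: "((\<lambda>t. ext (v i) (y + t *\<^sub>R axis i 1)) has_real_derivative ext (v' i) y) (at 0)" for i y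
  proof (cases "y = 0")
    case True
    have "((\<lambda>t. ext (v i) (y + t *\<^sub>R axis i 1)) has_real_derivative 0) (at 0)"
    proof (rule has_field_derivative_transform_within_open[where S = "{-r1<..<r1}" and f = "\<lambda>_. 0"])
      show "0 = ext (v i) (y + t *\<^sub>R axis i 1)" if "t \<in> {-r1<..<r1}" for t
      proof -
        have "norm (t *\<^sub>R axis i (1::real)) < r1" using that by auto
        then show ?thesis using supp(1)[of "t *\<^sub>R axis i 1" i] True by (auto simp: ext_def)
      qed
    qed (use r1 in auto)
    then show ?thesis using True by (simp add: ext_def)
  next
    case False
    have "open ((\<lambda>t. y + t *\<^sub>R axis i 1) -` (- {0}))"
      by (intro open_vimage continuous_intros)
    moreover have "0 \<in> (\<lambda>t. y + t *\<^sub>R axis i 1) -` (- {0})" using False by simp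
    ultimately have "((\<lambda>t. ext (v i) (y + t *\<^sub>R axis i 1)) has_real_derivative v' i y) (at 0)"
      by (rule has_field_derivative_transform_within_open[OF deriv[OF False]]) (auto simp: ext_def)
    then show ?thesis using False by (simp add: ext_def)
  qed
  have c: "continuous_on UNIV (ext (v i))" "continuous_on UNIV (ext (v' i))" for i
    by (intro ext_cont cont supp; blast)+
  have s: "norm y > r2 \<Longrightarrow> ext (v i) y = 0" "norm y > r2 \<Longrightarrow> ext (v' i) y = 0" for i y
    using supp by (auto simp: ext_def)
  have i: "integral\<^sup>L lborel (ext (v' i)) = 0" "integrable lborel (ext (v' i))" for i
    using integral_directional_derivative_eq_0[OF der c s] integrable_compact_support[OF c(2) s(2)] by auto
  have "(\<Sum>i\<in>UNIV. ext (v' i) y) = 0"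
  proof (rule continuous_nonneg_integral_eq_0[where f = "\<lambda>y. \<Sum>i\<in>UNIV. ext (v' i) y"])
    show "continuous_on UNIV (\<lambda>y. \<Sum>i\<in>UNIV. ext (v' i) y)"
      by (intro continuous_on_sum c)
    show "0 \<le> (\<Sum>i\<in>UNIV. ext (v' i) y)" for y
      using nonneg[of y] by (cases "y = 0") (simp_all add: ext_def)
  qed (simp_all add: i)
  then show ?thesis using y by (simp add: ext_def)
qed

context local_finsler
begin

text \<open>Piola's identity: \<open>dt * gi\<close> is the cofactor matrix of the fibre Hessian of
  \<open>E / 2\<close>. The derivatives of the determinant and of the inverse contract the same
  tensor in different index positions, and its total symmetry makes them cancel.\<close>

lemma div_cofactor:
  assumes z: "z \<in> S"
  shows "(\<Sum>i\<in>UNIV. pdy i (\<lambda>w. dt w * gi i l w) z) = 0"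
proof -
  define C where "C i a b = pdy i (g a b) z" for i a b
  have C: "C i a b = C b a i" for i a b unfolding C_def by (rule pdy_g_sym23[OF z])
  have "(\<Sum>i\<in>UNIV. pdy i dt z * gi i l z) = dt z * (\<Sum>i\<in>UNIV. \<Sum>a\<in>UNIV. \<Sum>b\<in>UNIV. gi a b z * C i a b * gi i l z)"
    unfolding pdy_dt[OF z] C_def by (simp add: sum_distrib_left sum_distrib_right mult_ac)
  also have "(\<Sum>i\<in>UNIV. \<Sum>a\<in>UNIV. \<Sum>b\<in>UNIV. gi a b z * C i a b * gi i l z)
      = (\<Sum>b\<in>UNIV. \<Sum>a\<in>UNIV. \<Sum>i\<in>UNIV. gi a b z * C i a b * gi i l z)"
    by (rule sum_swap13)
  also have "\<dots> = (\<Sum>b\<in>UNIV. \<Sum>a\<in>UNIV. \<Sum>i\<in>UNIV. gi b a z * (C b a i * gi i l z))"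
    by (intro sum.cong refl) (use C gi_sym[OF z] in \<open>simp add: mult_ac\<close>)
  also have "dt z * \<dots> = - (\<Sum>i\<in>UNIV. dt z * pdy i (gi i l) z)"
    unfolding pdy_gi[OF z] C_def by (simp add: sum_distrib_left sum_negf)
  finally show ?thesis using z by (simp add: sum.distrib)
qed

lemma gi_posdef:
  assumes z: "z \<in> S" and x: "\<exists>i. x i \<noteq> 0"
  shows "0 < (\<Sum>i\<in>UNIV. \<Sum>j\<in>UNIV. gi i j z * x i * x j)"
proof -
  define w :: "real^'n" where "w = (\<chi> i. \<Sum>j\<in>UNIV. gi i j z * x j)"
  have gw: "(\<Sum>j\<in>UNIV. g i j z * w $ j) = x i" for i
    unfolding w_def using lower_raise[OF z, of i x] by simp
  have "w \<noteq> 0"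
  proof
    assume "w = 0"
    then have "x i = 0" for i using gw[of i] by simp
    then show False using x by blast
  qed
  then have "0 < w \<bullet> (fund F z *v w)" by (rule posdef[OF z])
  also have "\<dots> = (\<Sum>i\<in>UNIV. w $ i * x i)"
    by (simp add: inner_vec_def matrix_vector_mult_def fund_g gw)
  also have "\<dots> = (\<Sum>i\<in>UNIV. \<Sum>j\<in>UNIV. gi i j z * x i * x j)"
    by (simp add: w_def sum_distrib_left sum_distrib_right mult_ac)
  finally show ?thesis .
qed

lemma fibre_derivative:
  assumes "sm q" "(x, y) \<in> S"
  shows "((\<lambda>y. q (x, y)) has_derivative (\<lambda>v. frechet_derivative q (at (x, y)) (0, v))) (at y)"
proof -
  have 1: "((\<lambda>y. (x, y)) has_derivative (\<lambda>v. (0, v))) (at y)"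
    by (auto intro!: derivative_eq_intros)
  have "(q has_derivative frechet_derivative q (at (x, y))) (at (x, y))"
    using sm_differentiable[OF assms] frechet_derivative_works by blast
  from has_derivative_compose[OF 1 this] show ?thesis .
qed

text \<open>Compactness of the sphere and scaling. It places the shell between two level sets of
  \<open>E\<close> inside a Euclidean annulus.\<close>

lemma E_bounds:
  assumes x: "x \<in> U"
  obtains m M where "m > 0" "M > 0" "\<And>y. y \<noteq> 0 \<Longrightarrow> m * (norm y)\<^sup>2 \<le> E (x, y) \<and> E (x, y) \<le> M * (norm y)\<^sup>2"
proof -
  let ?S = "sphere (0::real^'n) 1"
  have sub: "(\<lambda>y. (x, y)) ` ?S \<subseteq> S" using x by (auto simp: S_def)
  have cont: "continuous_on ?S (\<lambda>y. E (x, y))"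
    using continuous_on_compose2[OF smooth_on_continuous[OF sm_E] _ sub] by (simp add: continuous_on_Pair)
  obtain e :: "real^'n" where "e \<in> Basis" using nonempty_Basis by blast
  then have ne: "?S \<noteq> {}" by (auto intro!: exI[of _ e])
  obtain a where a: "a \<in> ?S" "\<And>y. y \<in> ?S \<Longrightarrow> E (x, a) \<le> E (x, y)"
    using continuous_attains_inf[OF compact_sphere ne cont] by blast
  obtain b where b: "b \<in> ?S" "\<And>y. y \<in> ?S \<Longrightarrow> E (x, y) \<le> E (x, b)"
    using continuous_attains_sup[OF compact_sphere ne cont] by blast
  have pos: "E (x, a) > 0" "E (x, b) > 0" using E_pos sub a b by blast+
  have "E (x, a) * (norm y)\<^sup>2 \<le> E (x, y) \<and> E (x, y) \<le> E (x, b) * (norm y)\<^sup>2" if "y \<noteq> 0" for y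
  proof -
    define u where "u = inverse (norm y) *\<^sub>R y"
    have u: "u \<in> ?S" "u \<noteq> 0" "y = norm y *\<^sub>R u" using that by (auto simp: u_def)
    have "E (x, y) = (norm y)\<^sup>2 * E (x, u)"
      by (subst u(3)) (use E_scale[OF x u(2), of "norm y"] that in simp)
    then show ?thesis using a(2)[OF u(1)] b(2)[OF u(1)] by (simp add: mult.commute mult_right_mono)
  qed
  then show thesis using that pos by blast
qed

text \<open>The equation says that the vector field \<open>X\<^sup>i = det g g\<^sup>i\<^sup>l f\<^sub>l\<^sub>k g\<^sup>k\<^sup>j f\<^sub>j\<close> is tangent to the level sets of
  \<open>E\<close> and has divergence \<open>det g \<bar>Hess f\<bar>\<^sup>2\<close>; integrating over a shell between two level sets kills the
  Hessian.\<close>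

context
  fixes f :: "'n pt \<Rightarrow> real"
  assumes sm_f [simp]: "sm f" and hom_f: "homog 1 f"
    and tr_f: "\<And>z. z \<in> S \<Longrightarrow> (\<Sum>a\<in>UNIV. \<Sum>b\<in>UNIV. gi a b z * pdy a (pdy b f) z) = 0"
begin

definition f_up :: "'n \<Rightarrow> 'n pt \<Rightarrow> real" where "f_up k z = (\<Sum>j\<in>UNIV. gi k j z * pdy j f z)"
definition f_Y :: "'n \<Rightarrow> 'n pt \<Rightarrow> real" where "f_Y l z = (\<Sum>k\<in>UNIV. pdy k (pdy l f) z * f_up k z)"
definition f_X :: "'n \<Rightarrow> 'n pt \<Rightarrow> real" where "f_X i z = (\<Sum>l\<in>UNIV. (dt z * gi i l z) * f_Y l z)"

lemma sm_f_up [simp]: "sm (f_up k)" unfolding f_up_def[abs_def] by simp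
lemma sm_f_Y [simp]: "sm (f_Y k)" unfolding f_Y_def[abs_def] by simp
lemma sm_f_X [simp]: "sm (f_X k)" unfolding f_X_def[abs_def] by simp

lemma pdy_f_up:
  assumes z: "z \<in> S"
  shows "pdy i (f_up k) z = (\<Sum>j\<in>UNIV. gi k j z * pdy i (pdy j f) z)
     - (\<Sum>a\<in>UNIV. \<Sum>b\<in>UNIV. gi k a z * pdy i (g a b) z * f_up b z)"
proof -
  have "(\<Sum>j\<in>UNIV. pdy i (gi k j) z * pdy j f z)
     = - (\<Sum>j\<in>UNIV. \<Sum>a\<in>UNIV. \<Sum>b\<in>UNIV. gi k a z * pdy i (g a b) z * (gi b j z * pdy j f z))"
    unfolding pdy_gi[OF z] by (simp add: sum_distrib_left sum_distrib_right sum_negf mult_ac)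
  also have "(\<Sum>j\<in>UNIV. \<Sum>a\<in>UNIV. \<Sum>b\<in>UNIV. gi k a z * pdy i (g a b) z * (gi b j z * pdy j f z))
     = (\<Sum>a\<in>UNIV. \<Sum>b\<in>UNIV. \<Sum>j\<in>UNIV. gi k a z * pdy i (g a b) z * (gi b j z * pdy j f z))"
    by (rule sum_rot3)
  also have "\<dots> = (\<Sum>a\<in>UNIV. \<Sum>b\<in>UNIV. gi k a z * pdy i (g a b) z * f_up b z)"
    unfolding f_up_def by (simp add: sum_distrib_left)
  finally show ?thesis unfolding f_up_def[abs_def] using z by (simp add: sum.distrib)
qed

text \<open>Differentiating the equation trades the traced third derivatives of \<open>f\<close> for
  second derivatives times derivatives of \<open>g\<close>.\<close>

lemma tr_f_deriv:
  assumes z: "z \<in> S"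
  shows "(\<Sum>i\<in>UNIV. \<Sum>l\<in>UNIV. gi i l z * pdy k (pdy i (pdy l f)) z)
     = (\<Sum>i\<in>UNIV. \<Sum>l\<in>UNIV. \<Sum>a\<in>UNIV. \<Sum>b\<in>UNIV. pdy i (pdy l f) z * gi i a z * gi b l z * pdy k (g a b) z)"
proof -
  have "pdy k (\<lambda>z. \<Sum>a\<in>UNIV. \<Sum>b\<in>UNIV. gi a b z * pdy a (pdy b f) z) z = pdy k (\<lambda>z. 0) z"
    by (rule pdy_cong) (use z tr_f in auto)
  then have "(\<Sum>i\<in>UNIV. \<Sum>l\<in>UNIV. gi i l z * pdy k (pdy i (pdy l f)) z)
     = - (\<Sum>i\<in>UNIV. \<Sum>l\<in>UNIV. pdy k (gi i l) z * pdy i (pdy l f) z)"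
    using z by (simp add: sum.distrib)
  then show ?thesis
    unfolding pdy_gi[OF z] by (simp add: sum_distrib_left sum_distrib_right sum_negf mult_ac)
qed

text \<open>By \<open>div_cofactor\<close> only \<open>f_Y\<close> gets differentiated. This gives
  the squared norm of the Hessian, a term from the derivative of the inverse metric inside
  \<open>f_up\<close>, and a term with third derivatives of \<open>f\<close>. With
  \<open>tr_f_deriv\<close> and the symmetry of the derivative of \<open>g\<close>, the last two are
  the same contraction \<open>M\<close> with opposite signs.\<close>

lemma div_f_X:
  assumes z: "z \<in> S"
  shows "(\<Sum>i\<in>UNIV. pdy i (f_X i) z) = dt z * (\<Sum>i\<in>UNIV. \<Sum>l\<in>UNIV. \<Sum>k\<in>UNIV. \<Sum>j\<in>UNIV.
      gi i l z * gi k j z * pdy l (pdy k f) z * pdy i (pdy j f) z)"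
proof -
  define C where "C i a b = pdy i (g a b) z" for i a b
  have C: "C i a b = C b a i" for i a b unfolding C_def by (rule pdy_g_sym23[OF z])
  define h where "h i j = pdy i (pdy j f) z" for i j
  have h: "h i j = h j i" for i j unfolding h_def by (rule pdy_pdy) (use z in auto)
  define Q where "Q = (\<Sum>i\<in>UNIV. \<Sum>l\<in>UNIV. \<Sum>k\<in>UNIV. \<Sum>j\<in>UNIV. gi i l z * gi k j z * h l k * h i j)"
  define M where "M b = (\<Sum>i\<in>UNIV. \<Sum>l\<in>UNIV. \<Sum>k\<in>UNIV. \<Sum>a\<in>UNIV. gi i l z * h k l * gi k a z * C i a b)" for b
  have 1: "(\<Sum>i\<in>UNIV. pdy i (f_X i) z) = dt z * (\<Sum>i\<in>UNIV. \<Sum>l\<in>UNIV. gi i l z * pdy i (f_Y l) z)"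
  proof -
    have "(\<Sum>i\<in>UNIV. pdy i (f_X i) z) = (\<Sum>i\<in>UNIV. \<Sum>l\<in>UNIV. dt z * gi i l z * pdy i (f_Y l) z)
        + (\<Sum>i\<in>UNIV. \<Sum>l\<in>UNIV. pdy i (\<lambda>w. dt w * gi i l w) z * f_Y l z)"
      unfolding f_X_def[abs_def] using z by (simp add: sum.distrib)
    also have "(\<Sum>i\<in>UNIV. \<Sum>l\<in>UNIV. pdy i (\<lambda>w. dt w * gi i l w) z * f_Y l z)
        = (\<Sum>l\<in>UNIV. (\<Sum>i\<in>UNIV. pdy i (\<lambda>w. dt w * gi i l w) z) * f_Y l z)"
      unfolding sum_distrib_right by (rule sum.swap)
    also have "\<dots> = 0" unfolding div_cofactor[OF z] by simp
    finally show ?thesis by (simp add: sum_distrib_left mult.assoc)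
  qed
  have Y: "pdy i (f_Y l) z = (\<Sum>k\<in>UNIV. \<Sum>j\<in>UNIV. gi k j z * h k l * h i j)
      - (\<Sum>k\<in>UNIV. \<Sum>a\<in>UNIV. \<Sum>b\<in>UNIV. h k l * gi k a z * C i a b * f_up b z)
      + (\<Sum>k\<in>UNIV. pdy k (pdy i (pdy l f)) z * f_up k z)" for i l
  proof -
    have "pdy i (pdy k (pdy l f)) z = pdy k (pdy i (pdy l f)) z" for k
      by (rule pdy_pdy) (use z in auto)
    then have "pdy i (f_Y l) z = (\<Sum>k\<in>UNIV. h k l * pdy i (f_up k) z)
       + (\<Sum>k\<in>UNIV. pdy k (pdy i (pdy l f)) z * f_up k z)"
      unfolding f_Y_def[abs_def] h_def using z by (simp add: sum.distrib)
    then show ?thesis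
      unfolding pdy_f_up[OF z] C_def h_def
      by (simp add: right_diff_distrib sum_subtractf sum_distrib_left mult_ac)
  qed
  have "(\<Sum>i\<in>UNIV. \<Sum>l\<in>UNIV. gi i l z * pdy i (f_Y l) z)
     = (\<Sum>i\<in>UNIV. \<Sum>l\<in>UNIV. \<Sum>k\<in>UNIV. \<Sum>j\<in>UNIV. gi i l z * gi k j z * h k l * h i j)
      - (\<Sum>i\<in>UNIV. \<Sum>l\<in>UNIV. \<Sum>k\<in>UNIV. \<Sum>a\<in>UNIV. \<Sum>b\<in>UNIV. gi i l z * h k l * gi k a z * C i a b * f_up b z)
      + (\<Sum>i\<in>UNIV. \<Sum>l\<in>UNIV. \<Sum>k\<in>UNIV. gi i l z * pdy k (pdy i (pdy l f)) z * f_up k z)"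
    unfolding Y
    by (simp add: right_diff_distrib distrib_left sum.distrib sum_subtractf sum_distrib_left mult.assoc)
  also have "(\<Sum>i\<in>UNIV. \<Sum>l\<in>UNIV. \<Sum>k\<in>UNIV. \<Sum>j\<in>UNIV. gi i l z * gi k j z * h k l * h i j) = Q"
    unfolding Q_def using h by simp
  also have "(\<Sum>i\<in>UNIV. \<Sum>l\<in>UNIV. \<Sum>k\<in>UNIV. \<Sum>a\<in>UNIV. \<Sum>b\<in>UNIV. gi i l z * h k l * gi k a z * C i a b * f_up b z)
     = (\<Sum>b\<in>UNIV. M b * f_up b z)"
  proof -
    have "(\<Sum>i\<in>UNIV. \<Sum>l\<in>UNIV. \<Sum>k\<in>UNIV. \<Sum>a\<in>UNIV. \<Sum>b\<in>UNIV. t i l k a b)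
        = (\<Sum>b\<in>UNIV. \<Sum>i\<in>UNIV. \<Sum>l\<in>UNIV. \<Sum>k\<in>UNIV. \<Sum>a\<in>UNIV. t i l k a b)"
      for t :: "'n \<Rightarrow> 'n \<Rightarrow> 'n \<Rightarrow> 'n \<Rightarrow> 'n \<Rightarrow> real"
    proof -
      have "(\<Sum>i\<in>UNIV. \<Sum>l\<in>UNIV. \<Sum>k\<in>UNIV. \<Sum>a\<in>UNIV. \<Sum>b\<in>UNIV. t i l k a b)
          = (\<Sum>i\<in>UNIV. \<Sum>l\<in>UNIV. \<Sum>b\<in>UNIV. \<Sum>k\<in>UNIV. \<Sum>a\<in>UNIV. t i l k a b)"
        by (rule sum.cong[OF refl], rule sum.cong[OF refl], rule sum_rot3[symmetric])
      also have "\<dots> = (\<Sum>b\<in>UNIV. \<Sum>i\<in>UNIV. \<Sum>l\<in>UNIV. \<Sum>k\<in>UNIV. \<Sum>a\<in>UNIV. t i l k a b)"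
        by (rule sum_rot3[symmetric])
      finally show ?thesis .
    qed
    then show ?thesis unfolding M_def by (simp add: sum_distrib_right)
  qed
  also have "(\<Sum>i\<in>UNIV. \<Sum>l\<in>UNIV. \<Sum>k\<in>UNIV. gi i l z * pdy k (pdy i (pdy l f)) z * f_up k z)
     = (\<Sum>b\<in>UNIV. M b * f_up b z)"
  proof -
    have "(\<Sum>i\<in>UNIV. \<Sum>l\<in>UNIV. \<Sum>k\<in>UNIV. gi i l z * pdy k (pdy i (pdy l f)) z * f_up k z)
       = (\<Sum>k\<in>UNIV. (\<Sum>i\<in>UNIV. \<Sum>l\<in>UNIV. gi i l z * pdy k (pdy i (pdy l f)) z) * f_up k z)"
      unfolding sum_distrib_right by (rule sum_rot3[symmetric])
    also have "\<dots> = (\<Sum>b\<in>UNIV. M b * f_up b z)"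
    proof (rule sum.cong[OF refl])
      fix b
      have "(\<Sum>i\<in>UNIV. \<Sum>l\<in>UNIV. gi i l z * pdy b (pdy i (pdy l f)) z)
         = (\<Sum>k\<in>UNIV. \<Sum>l\<in>UNIV. \<Sum>a\<in>UNIV. \<Sum>i\<in>UNIV. h k l * gi k a z * gi i l z * C b a i)"
        unfolding tr_f_deriv[OF z] C_def h_def by simp
      also have "\<dots> = (\<Sum>k\<in>UNIV. \<Sum>i\<in>UNIV. \<Sum>l\<in>UNIV. \<Sum>a\<in>UNIV. h k l * gi k a z * gi i l z * C b a i)"
        by (rule sum.cong[OF refl], rule sum_rot3[symmetric])
      also have "\<dots> = (\<Sum>i\<in>UNIV. \<Sum>k\<in>UNIV. \<Sum>l\<in>UNIV. \<Sum>a\<in>UNIV. h k l * gi k a z * gi i l z * C b a i)"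
        by (rule sum.swap)
      also have "\<dots> = (\<Sum>i\<in>UNIV. \<Sum>l\<in>UNIV. \<Sum>k\<in>UNIV. \<Sum>a\<in>UNIV. h k l * gi k a z * gi i l z * C b a i)"
        by (rule sum.cong[OF refl], rule sum.swap)
      also have "\<dots> = M b" unfolding M_def
        by (intro sum.cong refl) (use C in \<open>simp add: mult_ac\<close>)
      finally show "(\<Sum>i\<in>UNIV. \<Sum>l\<in>UNIV. gi i l z * pdy b (pdy i (pdy l f)) z) * f_up b z = M b * f_up b z"
        by simp
    qed
    finally show ?thesis .
  qed
  finally show ?thesis unfolding 1 Q_def h_def by simp
qed

text \<open>Raising the index of the differential of \<open>E\<close> gives \<open>2 y\<close>, and
  \<open>y\<close> annihilates the Hessian of \<open>f\<close> because the first derivatives of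
  \<open>f\<close> are homogeneous of degree 0.\<close>

lemma f_X_tangent:
  assumes z: "z \<in> S"
  shows "(\<Sum>i\<in>UNIV. pdy i E z * f_X i z) = 0"
proof -
  have yE: "(\<Sum>i\<in>UNIV. pdy i E z * gi i l z) = 2 * snd z $ l" for l
  proof -
    have pE: "pdy i E z = 2 * (\<Sum>j\<in>UNIV. g i j z * snd z $ j)" for i
      using y_g[OF z, of i] by (simp add: mult.commute)
    have "(\<Sum>i\<in>UNIV. pdy i E z * gi i l z) = (\<Sum>i\<in>UNIV. 2 * (gi l i z * (\<Sum>j\<in>UNIV. g i j z * snd z $ j)))"
      by (rule sum.cong[OF refl]) (simp add: pE gi_sym[OF z, of _ l])
    also have "\<dots> = 2 * (\<Sum>i\<in>UNIV. gi l i z * (\<Sum>j\<in>UNIV. g i j z * snd z $ j))"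
      by (simp only: sum_distrib_left)
    finally show ?thesis by (simp add: raise_lower[OF z])
  qed
  have yY: "(\<Sum>l\<in>UNIV. snd z $ l * f_Y l z) = 0"
  proof -
    have "(\<Sum>l\<in>UNIV. snd z $ l * f_Y l z) = (\<Sum>k\<in>UNIV. (\<Sum>l\<in>UNIV. snd z $ l * pdy k (pdy l f) z) * f_up k z)"
      unfolding f_Y_def sum_distrib_left sum_distrib_right by (subst sum.swap) (simp add: mult_ac)
    moreover have "(\<Sum>l\<in>UNIV. snd z $ l * pdy k (pdy l f) z) = 0" for k
    proof -
      have "pdy k (pdy l f) z = pdy l (pdy k f) z" for l by (rule pdy_pdy) (use z in auto)
      then show ?thesis using homogD[OF homog_pdy[OF sm_f hom_f] z, of k] by simp
    qed
    ultimately show ?thesis by simp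
  qed
  have "(\<Sum>i\<in>UNIV. pdy i E z * f_X i z) = (\<Sum>i\<in>UNIV. \<Sum>l\<in>UNIV. dt z * ((pdy i E z * gi i l z) * f_Y l z))"
    unfolding f_X_def sum_distrib_left by (simp add: mult_ac)
  also have "\<dots> = (\<Sum>l\<in>UNIV. dt z * ((\<Sum>i\<in>UNIV. pdy i E z * gi i l z) * f_Y l z))"
    unfolding sum_distrib_right sum_distrib_left by (rule sum.swap)
  also have "\<dots> = 2 * dt z * (\<Sum>l\<in>UNIV. snd z $ l * f_Y l z)"
    unfolding yE by (simp add: sum_distrib_left mult_ac)
  finally show ?thesis using yY by simp
qed

theorem hessian_eq_0:
  assumes z0: "z0 \<in> S"
  shows "pdy a (pdy b f) z0 = 0"
proof -
  obtain x y0 where xy: "z0 = (x, y0)" "x \<in> U" "y0 \<noteq> 0" using z0 by (auto simp: S_def)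
  define c where "c = E z0"
  have c: "c > 0" unfolding c_def using E_pos[OF z0] .
  \<comment> \<open>A cutoff in the values of \<open>E\<close>: positive at \<open>c = E z0\<close>
    and zero outside the interval from \<open>c / 2\<close> to \<open>2 * c\<close>. Squaring the
    positive part makes it continuously differentiable, which is enough for the integration.\<close>
  define p where "p t = (t - c/2) * (2 * c - t)" for t :: real
  define \<phi> where "\<phi> t = (max 0 (p t))\<^sup>2" for t
  define \<phi>' where "\<phi>' t = 2 * max 0 (p t) * (2 * c - t - (t - c/2))" for t
  have \<phi>': "(\<phi> has_real_derivative \<phi>' t) (at t)" for t
  proof -
    have sq: "((\<lambda>s. (max 0 s)\<^sup>2) has_real_derivative 2 * max 0 s) (at s)" for s :: real
    proof (cases "s = 0")
      case False
      show ?thesis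
      proof (cases "s > 0")
        case True
        have "((\<lambda>s. s\<^sup>2) has_real_derivative 2 * max 0 s) (at s)"
          using True by (auto intro!: derivative_eq_intros)
        then show ?thesis
          by (rule has_field_derivative_transform_within_open[where S = "{0<..}"]) (use True in auto)
      next
        case neg: False
        have "((\<lambda>s. 0) has_real_derivative 2 * max 0 s) (at s)"
          using neg by (auto intro!: derivative_eq_intros)
        then show ?thesis
          by (rule has_field_derivative_transform_within_open[where S = "{..<0}"]) (use neg False in auto)
      qed
    next
      case True
      have "((\<lambda>h. (max 0 h)\<^sup>2 / h) \<longlongrightarrow> 0) (at (0::real))"
      proof (rule tendsto_rabs_zero_cancel, rule tendsto_sandwich)
        show "\<forall>\<^sub>F h in at (0::real). 0 \<le> \<bar>(max 0 h)\<^sup>2 / h\<bar>" by simp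
        show "\<forall>\<^sub>F h in at (0::real). \<bar>(max 0 h)\<^sup>2 / h\<bar> \<le> \<bar>h\<bar>"
          by (rule always_eventually) (auto simp: max_def power2_eq_square)
        show "((\<lambda>h. \<bar>h\<bar>) \<longlongrightarrow> 0) (at (0::real))"
          by (rule tendsto_rabs_zero) (rule tendsto_ident_at)
      qed simp
      then show ?thesis using True by (simp add: has_field_derivative_iff)
    qed
    have "(p has_real_derivative (2 * c - t - (t - c/2))) (at t)"
      unfolding p_def[abs_def] by (auto intro!: derivative_eq_intros)
    from DERIV_chain2[OF sq this] show ?thesis unfolding \<phi>_def[abs_def] \<phi>'_def .
  qed
  have \<phi>_zero: "\<phi> t = 0" "\<phi>' t = 0" if "t < c/2 \<or> t > 2 * c" for t
  proof -
    have "p t \<le> 0" unfolding p_def using that c by (auto intro: mult_nonpos_nonneg mult_nonneg_nonpos)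
    then show "\<phi> t = 0" "\<phi>' t = 0" by (auto simp: \<phi>_def \<phi>'_def max_def)
  qed
  have \<phi>_cont: "continuous_on T \<phi>" "continuous_on T \<phi>'" for T
    unfolding \<phi>_def[abs_def] \<phi>'_def[abs_def] p_def[abs_def] by (intro continuous_intros)+
  obtain m M where m: "m > 0" "M > 0"
    "\<And>y. y \<noteq> 0 \<Longrightarrow> m * (norm y)\<^sup>2 \<le> E (x, y) \<and> E (x, y) \<le> M * (norm y)\<^sup>2"
    using E_bounds[OF xy(2)] by blast
  \<comment> \<open>Chosen so that \<open>M * r1\<^sup>2 = c / 2\<close> and
    \<open>m * r2\<^sup>2 = 2 * c\<close>, the two ends of the support of the cutoff.\<close>
  define r1 where "r1 = sqrt (c / (2 * M))"
  define r2 where "r2 = sqrt (2 * c / m)"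
  have far: "E (x, y) < c/2 \<or> E (x, y) > 2 * c" if "y \<noteq> 0" "norm y < r1 \<or> norm y > r2" for y
    using that(2)
  proof
    assume "norm y < r1"
    then have "(norm y)\<^sup>2 < c / (2 * M)"
      unfolding r1_def using c m real_less_rsqrt
      by (metis norm_ge_zero power_strict_mono real_sqrt_pow2 divide_nonneg_pos less_imp_le mult_pos_pos zero_less_numeral pos2)
    then have "M * (norm y)\<^sup>2 < c / 2" using m(2) by (simp add: field_simps)
    then show ?thesis using m(3)[OF that(1)] by linarith
  next
    assume "norm y > r2"
    then have "2 * c / m < (norm y)\<^sup>2"
      unfolding r2_def using c m real_sqrt_less_iff
      by (metis abs_norm_cancel real_sqrt_abs)
    then have "2 * c < m * (norm y)\<^sup>2" using m(1) by (simp add: field_simps)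
    then show ?thesis using m(3)[OF that(1)] by linarith
  qed
  have inS: "(x, y) \<in> S" if "y \<noteq> 0" for y using xy that by (simp add: S_def)
  \<comment> \<open>In the divergence of the cut-off field the term with \<open>\<phi>'\<close>
    contains the derivative of \<open>E\<close> along \<open>f_X\<close>, which is zero by tangency;
    what is left is nonnegative.\<close>
  define v where "v i y = \<phi> (E (x, y)) * f_X i (x, y)" for i y
  define v' where "v' i y = \<phi>' (E (x, y)) * pdy i E (x, y) * f_X i (x, y)
      + \<phi> (E (x, y)) * pdy i (f_X i) (x, y)" for i y
  have line: "((\<lambda>t. q (x, y + t *\<^sub>R axis i 1)) has_real_derivative pdy i q (x, y)) (at 0)"
    if "sm q" "y \<noteq> 0" for q y i
  proof -
    have 1: "((\<lambda>t. y + t *\<^sub>R axis i 1) has_derivative (\<lambda>t. t *\<^sub>R axis i 1)) (at 0)"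
      by (auto intro!: derivative_eq_intros)
    have "((\<lambda>t. q (x, y + t *\<^sub>R axis i 1)) has_derivative
       (\<lambda>t. frechet_derivative q (at (x, y)) (0, t *\<^sub>R axis i 1))) (at 0)"
      by (rule has_derivative_compose[OF 1]) (use fibre_derivative[OF that(1) inS[OF that(2)]] in simp)
    moreover have "frechet_derivative q (at (x, y)) (0, t *\<^sub>R axis i 1) = pdy i q (x, y) * t" for t
      using linear_cmul[OF linear_frechet_derivative[OF sm_differentiable[OF that(1) inS[OF that(2)]]], of t "(0, axis i 1)"]
      by (simp add: pdy_def)
    ultimately show ?thesis by (simp add: has_field_derivative_def)
  qed
  have cont: "continuous_on (UNIV - {0}) (\<lambda>y. q (x, y))" if "sm q" for q
    by (rule continuous_on_compose2[OF smooth_on_continuous[OF that]])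
      (use inS in \<open>auto intro!: continuous_on_Pair\<close>)
  have sumv': "(\<Sum>i\<in>UNIV. v' i y) = \<phi> (E (x, y)) * (dt (x, y) * (\<Sum>i\<in>UNIV. \<Sum>l\<in>UNIV. \<Sum>k\<in>UNIV. \<Sum>j\<in>UNIV.
      gi i l (x, y) * gi k j (x, y) * pdy l (pdy k f) (x, y) * pdy i (pdy j f) (x, y)))" if "y \<noteq> 0" for y
  proof -
    have "(\<Sum>i\<in>UNIV. v' i y) = \<phi>' (E (x, y)) * (\<Sum>i\<in>UNIV. pdy i E (x, y) * f_X i (x, y))
       + \<phi> (E (x, y)) * (\<Sum>i\<in>UNIV. pdy i (f_X i) (x, y))"
      unfolding v'_def by (simp add: sum.distrib sum_distrib_left mult.assoc)
    then show ?thesis using f_X_tangent[OF inS[OF that]] div_f_X[OF inS[OF that]] by simp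
  qed
  note hn = hessian_norm[of "\<lambda>i j. gi i j (x, y)" "\<lambda>i j. pdy i (pdy j f) (x, y)" for y]
  have hn1: "gi i j (x, y) = gi j i (x, y)" "pdy i (pdy j f) (x, y) = pdy j (pdy i f) (x, y)"
    if "y \<noteq> 0" for i j y
    using gi_sym pdy_pdy[of f] inS[OF that] by auto
  have "(\<Sum>i\<in>UNIV. v' i y0) = 0"
  proof (rule annulus_divergence[of v v' r1 r2])
    fix i y assume y: "(y::real^'n) \<noteq> 0"
    have "((\<lambda>t. \<phi> (E (x, y + t *\<^sub>R axis i 1))) has_real_derivative \<phi>' (E (x, y)) * pdy i E (x, y)) (at 0)"
      using DERIV_chain2[OF _ line[OF sm_E y], of \<phi>] \<phi>' by simp
    from DERIV_mult[OF this line[OF sm_f_X y]]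
    show "((\<lambda>t. v i (y + t *\<^sub>R axis i 1)) has_real_derivative v' i y) (at 0)"
      unfolding v_def v'_def by (simp add: algebra_simps)
    show "v i y = 0" "v' i y = 0" if "norm y < r1 \<or> norm y > r2"
      using far[OF y that] \<phi>_zero by (auto simp: v_def v'_def)
  next
    fix i
    note c1 = continuous_on_compose2[OF \<phi>_cont(1) cont[OF sm_E] subset_UNIV]
      continuous_on_compose2[OF \<phi>_cont(2) cont[OF sm_E] subset_UNIV]
    show "continuous_on (UNIV - {0}) (v i)" "continuous_on (UNIV - {0}) (v' i)"
      unfolding v_def[abs_def] v'_def[abs_def]
      by (intro continuous_intros c1 cont; simp)+
  next
    show "r1 > 0" unfolding r1_def using c m by simp
    show "y0 \<noteq> 0" by (rule xy(3))
    show "0 \<le> (\<Sum>i\<in>UNIV. v' i y)" if "y \<noteq> 0" for y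
      unfolding sumv'[OF that]
      by (intro mult_nonneg_nonneg hn(1) hn1 that gi_posdef inS less_imp_le[OF dt_pos]) (auto simp: \<phi>_def)
  qed
  then have "\<phi> c * dt z0 * (\<Sum>i\<in>UNIV. \<Sum>l\<in>UNIV. \<Sum>k\<in>UNIV. \<Sum>j\<in>UNIV.
      gi i l (x, y0) * gi k j (x, y0) * pdy l (pdy k f) (x, y0) * pdy i (pdy j f) (x, y0)) = 0"
    unfolding sumv'[OF xy(3)] c_def xy(1) by (simp add: mult.assoc)
  moreover have "\<phi> c > 0"
    unfolding \<phi>_def p_def using c by (auto simp: max_def mult_le_0_iff)
  ultimately have "(\<Sum>i\<in>UNIV. \<Sum>l\<in>UNIV. \<Sum>k\<in>UNIV. \<Sum>j\<in>UNIV.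
      gi i l (x, y0) * gi k j (x, y0) * pdy l (pdy k f) (x, y0) * pdy i (pdy j f) (x, y0)) = 0"
    using dt_pos[OF z0] by simp
  then show ?thesis
    unfolding xy(1)
    by (intro hn(2) hn1 xy(3) gi_posdef inS)
qed

end

subsection \<open>Chern connection and curvature\<close>

definition chern_form :: "'n pt \<Rightarrow> 'n \<Rightarrow> 'n \<Rightarrow> 'n pt \<Rightarrow> real" where
  "chern_form z j i u = (\<Sum>k\<in>UNIV. Gam i j k z * dx k u)"

definition ver :: "'n pt \<Rightarrow> 'n \<Rightarrow> 'n pt \<Rightarrow> real" where
  "ver z m u = snd u $ m + (\<Sum>k\<in>UNIV. N m k z * fst u $ k)"

lemma delta_y_ver: "delta_y F z k u = ver z k u / F z"
  by (simp add: delta_y_def ver_def dx_def dy_def)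

lemma cartan_g: "z \<in> S \<Longrightarrow> cartan F i j k z = 1/2 * F z * pdy k (g i j) z"
  by (simp add: cartan_def g_def[abs_def] E_def[symmetric])

lemma cartan_delta_y:
  assumes "z \<in> S"
  shows "2 * (\<Sum>k\<in>UNIV. cartan F i j k z * delta_y F z k u) = (\<Sum>k\<in>UNIV. ver z k u * pdy k (g i j) z)"
  unfolding sum_distrib_left using F_pos[OF assms]
  by (intro sum.cong refl) (simp add: cartan_g[OF assms] delta_y_ver)

lemma fd_ver:
  assumes "sm f" "z \<in> S"
  shows "frechet_derivative f (at z) u = (\<Sum>k\<in>UNIV. fst u $ k * del k f z) + (\<Sum>m\<in>UNIV. ver z m u * pdy m f z)"
  unfolding ver_def by (rule fd_del[OF assms])

text \<open>The torsion equation is the symmetry of \<open>Gam\<close>. In the metric equation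
  \<open>compat\<close> accounts for the horizontal part of the differential of \<open>g\<close>,
  the Cartan tensor for the vertical part.\<close>

lemma is_chern_chern_form:
  assumes z: "z \<in> S"
  shows "is_chern F z (chern_form z)"
  unfolding is_chern_def
proof (intro conjI allI)
  fix i j u v
  show "linear (chern_form z j i)"
    by (rule linearI) (simp_all add: chern_form_def dx_def algebra_simps sum.distrib sum_distrib_left)
  have "(\<Sum>j\<in>UNIV. dx j u * (\<Sum>k\<in>UNIV. Gam i j k z * dx k v)) = (\<Sum>k\<in>UNIV. dx k v * (\<Sum>j\<in>UNIV. Gam i k j z * dx j u))"
    unfolding sum_distrib_left by (subst sum.swap) (simp add: Gam_sym[OF z] mult_ac)
  then show "(\<Sum>j\<in>UNIV. wedge (dx j) (chern_form z j i) u v) = 0"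
    by (simp add: wedge_def chern_form_def sum_subtractf)
  have 1: "(\<Sum>k\<in>UNIV. fund F z $ k $ j * chern_form z i k u) = (\<Sum>k\<in>UNIV. (\<Sum>m\<in>UNIV. g m j z * Gam m i k z) * fst u $ k)"
    unfolding chern_form_def fund_g dx_def sum_distrib_left sum_distrib_right
    by (subst sum.swap) (simp add: mult_ac)
  have 2: "(\<Sum>k\<in>UNIV. fund F z $ i $ k * chern_form z j k u) = (\<Sum>k\<in>UNIV. (\<Sum>m\<in>UNIV. g i m z * Gam m j k z) * fst u $ k)"
    unfolding chern_form_def fund_g dx_def sum_distrib_left sum_distrib_right
    by (subst sum.swap) (simp add: mult_ac)
  show "frechet_derivative (\<lambda>w. fund F w $ i $ j) (at z) u
          - (\<Sum>k\<in>UNIV. fund F z $ k $ j * chern_form z i k u) - (\<Sum>k\<in>UNIV. fund F z $ i $ k * chern_form z j k u)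
        = 2 * (\<Sum>k\<in>UNIV. cartan F i j k z * delta_y F z k u)"
    unfolding 1 2 cartan_delta_y[OF z] unfolding fund_g using fd_ver[OF sm_g z, of i j u] compat[OF z]
    by (simp add: algebra_simps sum.distrib)
qed

text \<open>The torsion equation on a coordinate and a fibre vector shows that the forms have no
  \<open>dy\<close> part, and on two coordinate vectors that the coefficients are symmetric below.
  The metric equation then fixes them by the usual cyclic sum.\<close>

lemma is_chern_unique:
  assumes z: "z \<in> S" and w: "is_chern F z \<omega>"
  shows "\<omega> = chern_form z"
proof (intro ext)
  fix j i u
  have lin: "linear (\<omega> j i)" for i j using w unfolding is_chern_def by blast
  have tor: "(\<Sum>j\<in>UNIV. wedge (dx j) (\<omega> j i) u v) = 0" for i u v using w unfolding is_chern_def by blast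
  have met: "frechet_derivative (g i j) (at z) u
          - (\<Sum>k\<in>UNIV. g k j z * \<omega> i k u) - (\<Sum>k\<in>UNIV. g i k z * \<omega> j k u)
        = (\<Sum>k\<in>UNIV. ver z k u * pdy k (g i j) z)" for i j u
  proof -
    have "frechet_derivative (\<lambda>w. fund F w $ i $ j) (at z) u
          - (\<Sum>k\<in>UNIV. fund F z $ k $ j * \<omega> i k u) - (\<Sum>k\<in>UNIV. fund F z $ i $ k * \<omega> j k u)
        = 2 * (\<Sum>k\<in>UNIV. cartan F i j k z * delta_y F z k u)"
      using w unfolding is_chern_def by blast
    then show ?thesis unfolding cartan_delta_y[OF z] unfolding fund_g .
  qed
  have vert: "\<omega> a i (0, q) = 0" for a i q
    using tor[of i "(axis a 1, 0)" "(0, q)"]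
    by (simp add: wedge_def dx_def axis_def if_distrib[of "\<lambda>x. x * _"] cong: if_cong)
  define \<gamma> where "\<gamma> i j k = \<omega> j i (axis k 1, 0)" for i j k
  have \<gamma>_sym: "\<gamma> i a b = \<gamma> i b a" for i a b
    using tor[of i "(axis a 1, 0)" "(axis b 1, 0)"]
    by (simp add: wedge_def dx_def \<gamma>_def axis_def if_distrib[of "\<lambda>x. x * _"] sum_subtractf cong: if_cong)
  define l where "l s j k = (\<Sum>m\<in>UNIV. g s m z * \<gamma> m j k)" for s j k
  have l_sym: "l s j k = l s k j" for s j k unfolding l_def by (simp add: \<gamma>_sym)
  have "del k (g i j) z = l j i k + l i j k" for i j k
  proof -
    have "ver z m (axis k 1, 0) = N m k z" for m
      by (simp add: ver_def axis_def if_distrib[of "\<lambda>x. _ * x"] cong: if_cong)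
    moreover have "(\<Sum>k'\<in>UNIV. axis k (1::real) $ k' * del k' (g i j) z) = del k (g i j) z"
      by (simp add: axis_def if_distrib[of "\<lambda>x. x * _"] cong: if_cong)
    moreover have "(\<Sum>m\<in>UNIV. g m j z * \<omega> i m (axis k 1, 0)) = l j i k"
      unfolding l_def \<gamma>_def by (simp add: g_sym[OF z])
    moreover have "(\<Sum>m\<in>UNIV. g i m z * \<omega> j m (axis k 1, 0)) = l i j k"
      unfolding l_def \<gamma>_def by simp
    ultimately show ?thesis
      using met[of i j "(axis k 1, 0)"] fd_ver[OF sm_g z, of i j "(axis k 1, 0)"] by simp
  qed
  then have "Gaml s j k z = l s j k" for s j k
    using l_sym[of j s k] l_sym[of k s j] l_sym[of s j k] l_sym[of j k s] l_sym[of k j s] by (simp add: Gaml_def)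
  then have \<gamma>: "\<gamma> i j k = Gam i j k z" for i j k
    unfolding Gam_def l_def by (simp add: raise_lower[OF z])
  have 1: "\<omega> j i (a *\<^sub>R x, 0) = a * \<omega> j i (x, 0)" and 2: "\<omega> j i (0, a *\<^sub>R x) = a * \<omega> j i (0, x)" for a x
    using linear_cmul[OF lin, of j i a "(x, 0)"] linear_cmul[OF lin, of j i a "(0, x)"] by simp_all
  have "\<omega> j i u = (\<Sum>k\<in>UNIV. fst u $ k * \<gamma> i j k)"
    by (subst pt_decomp[of u])
      (simp add: linear_add[OF lin] linear_sum[OF lin] 1 2 vert \<gamma>_def)
  then show "\<omega> j i u = chern_form z j i u"
    by (simp add: chern_form_def \<gamma> dx_def mult.commute)
qed

lemma chern_eq: "z \<in> S \<Longrightarrow> chern F z = chern_form z"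
  unfolding chern_def using is_chern_chern_form is_chern_unique by (intro the_equality) auto

section \<open>Curvature of the Chern connection\<close>

lemma chern_curv_eq:
  assumes z: "z \<in> S"
  shows "chern_curv F z j i u v =
    (\<Sum>k\<in>UNIV. frechet_derivative (Gam i j k) (at z) u * fst v $ k)
    - (\<Sum>k\<in>UNIV. frechet_derivative (Gam i j k) (at z) v * fst u $ k)
    - (\<Sum>m\<in>UNIV. wedge (chern_form z j m) (chern_form z m i) u v)"
proof -
  have "frechet_derivative (\<lambda>w. chern F w j i v) (at z) u
     = (\<Sum>k\<in>UNIV. frechet_derivative (Gam i j k) (at z) u * fst v $ k)" for u v
  proof -
    have "frechet_derivative (\<lambda>w. chern F w j i v) (at z)
        = frechet_derivative (\<lambda>w. \<Sum>k\<in>UNIV. Gam i j k w * fst v $ k) (at z)"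
      by (rule fd_cong) (use z chern_eq in \<open>auto simp: chern_form_def dx_def\<close>)
    then show ?thesis using z by (simp add: fd_sum fd_mult fd_const)
  qed
  then show ?thesis unfolding chern_curv_def ext_d_def chern_eq[OF z] by simp
qed

lemma dx_delta_x: "dx m (delta_x F z k) = (if m = k then 1 else 0)"
  by (simp add: dx_def delta_x_def axis_def)

lemma sum_axis_nth: "(\<Sum>j\<in>UNIV. a j *\<^sub>R axis j (1::real)) $ l = a l" for a :: "'n \<Rightarrow> real"
  by (simp add: axis_def if_distrib cong: if_cong)

lemma ver_delta_x: "ver z l (delta_x F z k) = 0"
  unfolding ver_def delta_x_def by (simp add: sum_axis_nth) (simp add: axis_def if_distrib cong: if_cong)

lemma ver_fibre: "ver z l (0, w) = w $ l" by (simp add: ver_def)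

lemma wedge_dx_delta_y:
  assumes "z \<in> S"
  shows "wedge (dx a) (delta_y F z b) (delta_x F z k) (0, axis l (F z))
      = (if b = l then if a = k then 1 else 0 else 0)"
  using F_pos[OF assms]
  by (simp add: wedge_def dx_delta_x delta_y_ver ver_delta_x ver_fibre) (simp add: axis_def)

text \<open>Evaluates on the frame dual to \<open>dx\<close> and \<open>delta_y\<close>; the length
  \<open>F z\<close> of the fibre vector undoes the factor \<open>1 / F\<close> in
  \<open>delta_y\<close>. Both forms in the wedges of the first sum kill a fibre vector together, so
  \<open>R\<close> drops out.\<close>

lemma curv_decomp_unique:
  assumes z: "z \<in> S"
    and P: "\<And>i j u v. chern_curv F z j i u v =
       1/2 * (\<Sum>k\<in>UNIV. \<Sum>l\<in>UNIV. R j i k l * wedge (dx k) (dx l) u v)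
       + (\<Sum>k\<in>UNIV. \<Sum>l\<in>UNIV. P j i k l * wedge (dx k) (delta_y F z l) u v)"
  shows "P j i k l = chern_curv F z j i (delta_x F z k) (0, axis l (F z))"
proof -
  have 1: "wedge (dx a) (dx b) (delta_x F z k) (0, axis l (F z)) = 0" for a b
    by (simp add: wedge_def dx_def)
  show ?thesis unfolding P 1 wedge_dx_delta_y[OF z]
    by (simp add: if_distrib[of "\<lambda>x. _ * x"] cong: if_cong)
qed

text \<open>The mixed part comes only from the fibre derivative of \<open>Gam\<close>, since the
  quadratic term is built from \<open>dx\<close> alone. Reordering \<open>delta_y\<close> behind
  \<open>dx\<close> gives the sign, and \<open>ver\<close> being \<open>F\<close> times
  \<open>delta_y\<close> gives the factor.\<close>

lemma P_curv_eq:
  assumes z: "z \<in> S"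
  shows "P_curv F z j i k l = - F z * pdy l (Gam i j k) z"
proof -
  define Pv where "Pv j i k l = - F z * pdy l (Gam i j k) z" for j i k l
  \<comment> \<open>Left without antisymmetrization, as the wedge sees only the antisymmetric part;
    the factor 2 cancels the \<open>1/2\<close> of the decomposition.\<close>
  define R where "R j i k l = 2 * (del k (Gam i j l) z - (\<Sum>m\<in>UNIV. Gam m j k z * Gam i m l z))" for j i k l
  have 1: "chern_curv F z j i u v =
       1/2 * (\<Sum>k\<in>UNIV. \<Sum>l\<in>UNIV. R j i k l * wedge (dx k) (dx l) u v)
       + (\<Sum>k\<in>UNIV. \<Sum>l\<in>UNIV. Pv j i k l * wedge (dx k) (delta_y F z l) u v)" for i j u v
  proof -
    define D :: "'n pt \<Rightarrow> 'n pt \<Rightarrow> real" where "D u v = (\<Sum>k\<in>UNIV. \<Sum>l\<in>UNIV. fst u $ k * fst v $ l * del k (Gam i j l) z)" for u v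
    define V :: "'n pt \<Rightarrow> 'n pt \<Rightarrow> real" where "V u v = (\<Sum>k\<in>UNIV. \<Sum>l\<in>UNIV. ver z l u * fst v $ k * pdy l (Gam i j k) z)" for u v
    define W :: "'n pt \<Rightarrow> 'n pt \<Rightarrow> real" where "W u v = (\<Sum>k\<in>UNIV. \<Sum>l\<in>UNIV. \<Sum>m\<in>UNIV. Gam m j k z * Gam i m l z * fst u $ k * fst v $ l)" for u v
    have a: "(\<Sum>k\<in>UNIV. frechet_derivative (Gam i j k) (at z) u * fst v $ k) = D u v + V u v" for u v
    proof -
      have "(\<Sum>k\<in>UNIV. frechet_derivative (Gam i j k) (at z) u * fst v $ k) =
         (\<Sum>k\<in>UNIV. \<Sum>l\<in>UNIV. fst u $ l * fst v $ k * del l (Gam i j k) z) + V u v"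
        unfolding fd_ver[OF sm_Gam z] V_def
        by (simp add: sum.distrib distrib_left sum_distrib_left mult_ac)
      also have "(\<Sum>k\<in>UNIV. \<Sum>l\<in>UNIV. fst u $ l * fst v $ k * del l (Gam i j k) z) = D u v"
        unfolding D_def by (rule sum.swap)
      finally show ?thesis .
    qed
    have b: "(\<Sum>m\<in>UNIV. chern_form z j m u * chern_form z m i v) = W u v" for u v
    proof -
      have "(\<Sum>m\<in>UNIV. chern_form z j m u * chern_form z m i v)
        = (\<Sum>m\<in>UNIV. \<Sum>k\<in>UNIV. \<Sum>l\<in>UNIV. Gam m j k z * Gam i m l z * fst u $ k * fst v $ l)"
        unfolding chern_form_def dx_def sum_product by (simp add: mult_ac)
      also have "\<dots> = W u v" unfolding W_def by (rule sum_rot3)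
      finally show ?thesis .
    qed
    have "chern_curv F z j i u v = D u v - D v u + (V u v - V v u) - (W u v - W v u)"
      unfolding chern_curv_eq[OF z] a wedge_def sum_subtractf b[symmetric] by (simp add: mult_ac)
    moreover have "1/2 * (\<Sum>k\<in>UNIV. \<Sum>l\<in>UNIV. R j i k l * wedge (dx k) (dx l) u v)
        = D u v - D v u - (W u v - W v u)"
      unfolding R_def D_def W_def wedge_def dx_def
      by (simp add: algebra_simps sum.distrib sum_subtractf sum_distrib_left)
    moreover have "(\<Sum>k\<in>UNIV. \<Sum>l\<in>UNIV. Pv j i k l * wedge (dx k) (delta_y F z l) u v) = V u v - V v u"
    proof -
      have "Pv j i k l * wedge (dx k) (delta_y F z l) u v
        = ver z l u * fst v $ k * pdy l (Gam i j k) z - ver z l v * fst u $ k * pdy l (Gam i j k) z" for k l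
        unfolding Pv_def wedge_def delta_y_ver dx_def using F_pos[OF z] by (simp add: field_simps)
      then show ?thesis unfolding V_def by (simp add: sum_subtractf)
    qed
    ultimately show ?thesis by simp
  qed
  have "P_curv F z = Pv"
    unfolding P_curv_def
  proof (rule the_equality)
    show "\<exists>R. \<forall>i j u v. chern_curv F z j i u v =
       1/2 * (\<Sum>k\<in>UNIV. \<Sum>l\<in>UNIV. R j i k l * wedge (dx k) (dx l) u v)
       + (\<Sum>k\<in>UNIV. \<Sum>l\<in>UNIV. Pv j i k l * wedge (dx k) (delta_y F z l) u v)"
      using 1 by blast
    fix P assume "\<exists>R. \<forall>i j u v. chern_curv F z j i u v =
       1/2 * (\<Sum>k\<in>UNIV. \<Sum>l\<in>UNIV. R j i k l * wedge (dx k) (dx l) u v)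
       + (\<Sum>k\<in>UNIV. \<Sum>l\<in>UNIV. P j i k l * wedge (dx k) (delta_y F z l) u v)"
    then obtain R' where "\<And>i j u v. chern_curv F z j i u v =
       1/2 * (\<Sum>k\<in>UNIV. \<Sum>l\<in>UNIV. R' j i k l * wedge (dx k) (dx l) u v)
       + (\<Sum>k\<in>UNIV. \<Sum>l\<in>UNIV. P j i k l * wedge (dx k) (delta_y F z l) u v)"
      by blast
    from curv_decomp_unique[OF z this] curv_decomp_unique[OF z 1]
    show "P = Pv" by (intro ext) simp
  qed
  then show ?thesis by (simp add: Pv_def)
qed

lemma P_curv_eq_0_iff: "z \<in> S \<Longrightarrow> P_curv F z j i k l = 0 \<longleftrightarrow> pdy l (Gam i j k) z = 0"
  using F_pos[of z] by (simp add: P_curv_eq)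

text \<open>The base components of \<open>delta_x\<close> are the coordinate axes, so the first
  component of the vector-valued form already displays its coefficients.\<close>

lemma landsberg_curv_eq_0_imp:
  assumes z: "z \<in> S" and L: "\<And>u v. landsberg_curv F z u v = 0"
  shows "(\<Sum>j\<in>UNIV. snd z $ j * pdy l (Gam i j k) z) = 0"
proof -
  define c where "c i = (\<Sum>j\<in>UNIV. \<Sum>a\<in>UNIV. \<Sum>b\<in>UNIV. snd z $ j / F z * P_curv F z j i a b
      * wedge (dx a) (delta_y F z b) (delta_x F z k) (0, axis l (F z)))" for i
  have "fst (delta_x F z i) = axis i 1" for i by (simp add: delta_x_def)
  then have "fst (landsberg_curv F z (delta_x F z k) (0, axis l (F z))) = (\<Sum>i\<in>UNIV. c i *\<^sub>R axis i 1)"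
    unfolding landsberg_curv_def c_def by (simp add: fst_sum scaleR_sum_left)
  then have "fst (landsberg_curv F z (delta_x F z k) (0, axis l (F z))) $ i = c i"
    by (simp only: sum_axis_nth)
  then have "c i = 0" using L by simp
  also have "c i = (\<Sum>j\<in>UNIV. snd z $ j / F z * P_curv F z j i k l)"
    unfolding c_def wedge_dx_delta_y[OF z] by (simp add: if_distrib[of "\<lambda>x. _ * x"] cong: if_cong)
  also have "\<dots> = - (\<Sum>j\<in>UNIV. snd z $ j * pdy l (Gam i j k) z)"
    using F_pos[OF z] by (simp add: P_curv_eq[OF z] sum_negf)
  finally show ?thesis by simp
qed

lemma pdy_Gam_sym12: "z \<in> S \<Longrightarrow> pdy l (Gam i j k) z = pdy l (Gam i k j) z"
  by (rule pdy_cong) (auto simp: Gam_sym)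

subsection \<open>Landsberg metrics with closed Cartan-type form\<close>

context
  assumes lands: "\<And>z i k l. z \<in> S \<Longrightarrow> (\<Sum>j\<in>UNIV. snd z $ j * pdy l (Gam i j k) z) = 0"
begin

text \<open>Differentiates \<open>y_Gam\<close>; the term in which the derivative falls on
  \<open>Gam\<close> is the Landsberg condition. In other words, the Chern and Berwald connections
  coincide.\<close>

lemma pdy_N:
  assumes z: "z \<in> S"
  shows "pdy l (N i k) z = Gam i l k z"
proof -
  have "pdy l (\<lambda>z. \<Sum>j\<in>UNIV. snd z $ j * Gam i j k z) z = pdy l (N i k) z"
    by (rule pdy_cong) (use z y_Gam in auto)
  then show ?thesis
    using z lands[OF z, of l i k] by (simp add: sum.distrib if_distrib[of "\<lambda>x. x * _"] cong: if_cong)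
qed

lemma pdy_Gam_N: "z \<in> S \<Longrightarrow> pdy l (Gam i j k) z = pdy l (pdy j (N i k)) z"
  by (rule pdy_cong) (auto simp: pdy_N)

lemma pdy_Gam_sym13: "z \<in> S \<Longrightarrow> pdy l (Gam i j k) z = pdy j (Gam i l k) z"
  using pdy_pdy[of "N i k" z l j] by (simp add: pdy_Gam_N)

definition T :: "'n \<Rightarrow> 'n \<Rightarrow> 'n \<Rightarrow> 'n \<Rightarrow> 'n pt \<Rightarrow> real" where
  "T s j k l z = (\<Sum>i\<in>UNIV. g s i z * pdy l (Gam i j k) z)"

lemma T_sym: "z \<in> S \<Longrightarrow> T s j k l z = T s k j l z" "z \<in> S \<Longrightarrow> T s j k l z = T s l k j z"
  unfolding T_def using pdy_Gam_sym12 pdy_Gam_sym13 by auto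

text \<open>The fibre derivative of \<open>compat\<close>, solved for the terms where it falls on
  \<open>Gam\<close>. It also falls on the \<open>N\<close> inside \<open>del\<close>, and by
  \<open>pdy_N\<close> this supplies the third \<open>Gam\<close> term without which the right-hand
  side would not be symmetric.\<close>

lemma T_plus_T:
  assumes z: "z \<in> S"
  shows "T j i k l z + T i j k l z = pdx k (pdy l (g i j)) z
     - (\<Sum>m\<in>UNIV. N m k z * pdy m (pdy l (g i j)) z) - (\<Sum>m\<in>UNIV. Gam m l k z * pdy m (g i j) z)
     - (\<Sum>m\<in>UNIV. Gam m i k z * pdy l (g m j) z) - (\<Sum>m\<in>UNIV. Gam m j k z * pdy l (g i m) z)"
proof -
  have "pdy l (del k (g i j)) z
     = pdy l (\<lambda>z. (\<Sum>m\<in>UNIV. g m j z * Gam m i k z) + (\<Sum>m\<in>UNIV. g i m z * Gam m j k z)) z"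
    by (rule pdy_cong) (use z compat in auto)
  also have "\<dots> = (\<Sum>m\<in>UNIV. Gam m i k z * pdy l (g m j) z) + (\<Sum>m\<in>UNIV. Gam m j k z * pdy l (g i m) z)
      + T j i k l z + T i j k l z"
    using z by (simp add: T_def sum.distrib g_sym[OF z, of _ j] mult.commute)
  also have "pdy l (del k (g i j)) z = pdx k (pdy l (g i j)) z
     - (\<Sum>m\<in>UNIV. N m k z * pdy m (pdy l (g i j)) z) - (\<Sum>m\<in>UNIV. Gam m l k z * pdy m (g i j) z)"
    unfolding del_def[abs_def]
    using z pdy_pdy[OF sm_g z, of l _ i j] by (simp add: sum.distrib pdy_pdx pdy_N)
  finally show ?thesis by simp
qed

text \<open>The right-hand side of the previous identity is totally symmetric in \<open>i\<close>, \<open>j\<close>, \<open>l\<close>.\<close>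

lemma T_sym14:
  assumes z: "z \<in> S"
  shows "T j i k l z = T l i k j z"
proof -
  have 1: "pdx k (pdy l (g i j)) z = pdx k (pdy j (g i l)) z"
    by (rule pdx_cong) (use z pdy_g_sym23 in auto)
  have 2: "pdy m (pdy l (g i j)) z = pdy m (pdy j (g i l)) z" for m
    by (rule pdy_cong) (use z pdy_g_sym23 in auto)
  have 3: "pdy m (g i j) z = pdy j (g i m) z" for m j by (rule pdy_g_sym23[OF z])
  have 4: "pdy l (g m j) z = pdy j (g m l) z" for m by (rule pdy_g_sym23[OF z])
  \<comment> \<open>Exchanging \<open>j\<close> and \<open>l\<close> preserves the right-hand side.
    The second summands agree by the symmetry in lower indices, so the first ones do.\<close>
  have "T j i k l z + T i j k l z = T l i k j z + T i l k j z"
    unfolding T_plus_T[OF z] 1 2 3[of _ j] 3[of _ l] 4 by simp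
  then show ?thesis using T_sym(2)[OF z, of i j k l] by simp
qed

lemma berwald_if_trace_0:
  assumes tr: "\<And>z k l. z \<in> S \<Longrightarrow> (\<Sum>m\<in>UNIV. pdy l (Gam m m k) z) = 0"
    and z: "z \<in> S"
  shows "pdy l (Gam i j k) z = 0"
proof -
  have "(\<Sum>a\<in>UNIV. \<Sum>b\<in>UNIV. gi a b z * pdy a (pdy b (N i k)) z) = 0" if z: "z \<in> S" for z
  proof -
    \<comment> \<open>Exchanging the outer indices of \<open>T\<close> moves the free index
      \<open>s\<close> to the end and turns the metric trace over lower indices into the trace of
      \<open>Gam\<close>, differentiated in direction \<open>s\<close>.\<close>
    have "(\<Sum>a\<in>UNIV. \<Sum>b\<in>UNIV. gi a b z * T s b k a z) = 0" for s
    proof -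
      have "(\<Sum>a\<in>UNIV. \<Sum>b\<in>UNIV. gi a b z * T s b k a z) = (\<Sum>a\<in>UNIV. \<Sum>b\<in>UNIV. gi b a z * T a b k s z)"
      proof (intro sum.cong refl)
        fix a b
        show "gi a b z * T s b k a z = gi b a z * T a b k s z"
          by (simp add: T_sym14[OF z, of s b k a] gi_sym[OF z, of a b])
      qed
      also have "\<dots> = (\<Sum>b\<in>UNIV. \<Sum>a\<in>UNIV. gi b a z * T a b k s z)" by (rule sum.swap)
      also have "\<dots> = (\<Sum>b\<in>UNIV. pdy s (Gam b b k) z)"
        unfolding T_def by (simp add: raise_lower[OF z])
      finally show ?thesis using tr[OF z] by simp
    qed
    moreover have "(\<Sum>i\<in>UNIV. g s i z * (\<Sum>a\<in>UNIV. \<Sum>b\<in>UNIV. gi a b z * pdy a (Gam i b k) z))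
       = (\<Sum>a\<in>UNIV. \<Sum>b\<in>UNIV. gi a b z * T s b k a z)" for s
      unfolding T_def sum_distrib_left by (subst sum_rot3) (simp add: mult_ac)
    ultimately have "(\<Sum>a\<in>UNIV. \<Sum>b\<in>UNIV. gi a b z * pdy a (Gam i b k) z) = 0"
      using lower_inj[OF z, of "\<lambda>i. \<Sum>a\<in>UNIV. \<Sum>b\<in>UNIV. gi a b z * pdy a (Gam i b k) z" "\<lambda>i. 0" i] by simp
    then show ?thesis by (simp add: pdy_Gam_N[OF z])
  qed
  then show ?thesis
    unfolding pdy_Gam_N[OF z] by (intro hessian_eq_0[OF sm_N homog_N _ z])
qed

end

subsection \<open>The Cartan-type form and the S-curvature\<close>

definition tau0 :: "'n pt \<Rightarrow> real" where "tau0 z = ln (dt z) / 2"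

definition H :: "'n \<Rightarrow> 'n pt \<Rightarrow> real" where "H k z = (\<Sum>m\<in>UNIV. Gam m m k z)"

lemma sm_tau0 [simp]: "sm tau0"
  unfolding tau0_def[abs_def] by (rule sm_divide, rule smooth_on_ln_compose[OF open_S sm_dt dt_pos])

lemma sm_H [simp]: "sm (H k)" unfolding H_def[abs_def] by simp

lemma fd_tau0:
  assumes z: "z \<in> S"
  shows "frechet_derivative tau0 (at z) v
    = (\<Sum>i\<in>UNIV. \<Sum>j\<in>UNIV. gi i j z * frechet_derivative (g i j) (at z) v) / 2"
proof -
  have "(dt has_derivative frechet_derivative dt (at z)) (at z)"
    using sm_differentiable[OF sm_dt z] frechet_derivative_works by blast
  moreover have "(ln has_derivative (\<lambda>h. inverse (dt z) * h)) (at (dt z))"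
    using DERIV_ln[OF dt_pos[OF z]] by (simp add: has_field_derivative_def)
  ultimately have "((\<lambda>w. ln (dt w)) has_derivative (\<lambda>v. inverse (dt z) * frechet_derivative dt (at z) v)) (at z)"
    by (rule has_derivative_compose)
  from bounded_linear.has_derivative[OF bounded_linear_divide[of 2] this]
  have "(tau0 has_derivative (\<lambda>v. inverse (dt z) * frechet_derivative dt (at z) v / 2)) (at z)"
    unfolding tau0_def[abs_def] .
  from fun_cong[OF frechet_derivative_at[OF this], of v] show ?thesis
    using dt_pos[OF z] by (simp add: fd_dt[OF z] mult.assoc[symmetric])
qed

lemma pdy_tau0: "z \<in> S \<Longrightarrow> pdy k tau0 z = (\<Sum>i\<in>UNIV. \<Sum>j\<in>UNIV. gi i j z * pdy k (g i j) z) / 2"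
  unfolding pdy_def by (rule fd_tau0)

lemma fd_delta_x:
  assumes "sm f" "z \<in> S"
  shows "frechet_derivative f (at z) (delta_x F z k) = del k f z"
proof -
  have "(\<Sum>a\<in>UNIV. fst (delta_x F z k) $ a * del a f z) = del k f z"
    by (simp add: dx_delta_x[unfolded dx_def] if_distrib[of "\<lambda>x. x * _"] cong: if_cong)
  then show ?thesis unfolding fd_ver[OF assms] by (simp add: ver_delta_x)
qed

text \<open>Half the metric trace of \<open>compat\<close>, whose two summands have the same trace
  \<open>H\<close>.\<close>

lemma del_tau0:
  assumes z: "z \<in> S"
  shows "del k tau0 z = H k z"
proof -
  have "del k tau0 z = (\<Sum>i\<in>UNIV. \<Sum>j\<in>UNIV. gi i j z * del k (g i j) z) / 2"
    unfolding fd_delta_x[OF sm_tau0 z, symmetric] fd_tau0[OF z] fd_delta_x[OF sm_g z] ..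
  also have "(\<Sum>i\<in>UNIV. \<Sum>j\<in>UNIV. gi i j z * del k (g i j) z)
    = (\<Sum>i\<in>UNIV. \<Sum>j\<in>UNIV. gi i j z * (\<Sum>m\<in>UNIV. g j m z * Gam m i k z))
    + (\<Sum>j\<in>UNIV. \<Sum>i\<in>UNIV. gi j i z * (\<Sum>m\<in>UNIV. g i m z * Gam m j k z))"
  proof -
    have "(\<Sum>j\<in>UNIV. \<Sum>i\<in>UNIV. gi j i z * (\<Sum>m\<in>UNIV. g i m z * Gam m j k z))
       = (\<Sum>i\<in>UNIV. \<Sum>j\<in>UNIV. gi i j z * (\<Sum>m\<in>UNIV. g i m z * Gam m j k z))"
      by (subst sum.swap) (intro sum.cong refl, simp add: gi_sym[OF z])
    moreover have "(\<Sum>m\<in>UNIV. g m j z * Gam m i k z) = (\<Sum>m\<in>UNIV. g j m z * Gam m i k z)" for i j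
      by (intro sum.cong refl) (simp add: g_sym[OF z, of j])
    ultimately show ?thesis
      unfolding compat[OF z] by (simp add: distrib_left sum.distrib)
  qed
  also have "\<dots> = 2 * H k z" unfolding raise_lower[OF z] H_def by simp
  finally show ?thesis by simp
qed

text \<open>The metric trace of the Cartan tensor is the fibre derivative of \<open>tau0\<close>,
  the factors \<open>F\<close> cancelling. So the form is the vertical part of the differential of
  \<open>tau0\<close>, and \<open>del_tau0\<close> names the horizontal part to subtract.\<close>

lemma cartan_form_eq:
  assumes z: "z \<in> S"
  shows "cartan_form F z u = frechet_derivative tau0 (at z) u - (\<Sum>k\<in>UNIV. H k z * fst u $ k)"
proof -
  have "cartan_form F z u = (\<Sum>i\<in>UNIV. \<Sum>j\<in>UNIV. \<Sum>k\<in>UNIV. gi i j z * pdy k (g i j) z / 2 * ver z k u)"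
    unfolding cartan_form_def using F_pos[OF z]
    by (intro sum.cong refl) (simp add: cartan_g[OF z] delta_y_ver gi_def)
  also have "\<dots> = (\<Sum>k\<in>UNIV. \<Sum>i\<in>UNIV. \<Sum>j\<in>UNIV. gi i j z * pdy k (g i j) z / 2 * ver z k u)"
    by (rule sum_rot3[symmetric])
  also have "\<dots> = (\<Sum>k\<in>UNIV. ver z k u * pdy k tau0 z)"
    unfolding pdy_tau0[OF z] by (simp add: sum_distrib_left sum_divide_distrib mult_ac)
  finally show ?thesis
    unfolding fd_ver[OF sm_tau0 z] by (simp add: del_tau0[OF z] mult.commute)
qed

lemma ext_d_cartan_form:
  assumes z: "z \<in> S"
  shows "ext_d (cartan_form F) z u v = (\<Sum>k\<in>UNIV. frechet_derivative (H k) (at z) v * fst u $ k)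
     - (\<Sum>k\<in>UNIV. frechet_derivative (H k) (at z) u * fst v $ k)"
proof -
  have "frechet_derivative (\<lambda>w. cartan_form F w v) (at z) u
     = frechet_derivative (\<lambda>w. frechet_derivative tau0 (at w) v) (at z) u
     - (\<Sum>k\<in>UNIV. frechet_derivative (H k) (at z) u * fst v $ k)" for u v
  proof -
    have sm: "sm (\<lambda>w. frechet_derivative tau0 (at w) v)" by (rule smooth_on_frechet[OF sm_tau0])
    have "frechet_derivative (\<lambda>w. cartan_form F w v) (at z)
        = frechet_derivative (\<lambda>w. frechet_derivative tau0 (at w) v - (\<Sum>k\<in>UNIV. H k w * fst v $ k)) (at z)"
      by (rule fd_cong) (use z sm cartan_form_eq in auto)
    then show ?thesis using z sm by (simp add: fd_diff fd_sum fd_mult fd_const)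
  qed
  then show ?thesis unfolding ext_d_def using fd_commute[OF sm_tau0 z, of v u] by simp
qed

text \<open>On a fibre vector and a coordinate vector the exterior derivative sees only the fibre
  derivative of \<open>H\<close>.\<close>

lemma closed_imp_pdy_H:
  assumes z: "z \<in> S" and c: "\<And>u v. ext_d (cartan_form F) z u v = 0"
  shows "pdy l (H k) z = 0"
proof -
  have "(\<Sum>a\<in>UNIV. frechet_derivative (H a) (at z) (0, axis l 1) * axis k 1 $ a)
      = frechet_derivative (H k) (at z) (0, axis l 1)"
    by (simp add: axis_def if_distrib[of "\<lambda>x. _ * x"] cong: if_cong)
  then show ?thesis
    using c[of "(0, axis l 1)" "(axis k 1, 0)"] by (simp add: ext_d_cartan_form[OF z] pdy_def)
qed

lemma berwald_if_landsberg_closed: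
  assumes L: "\<And>z u v. z \<in> S \<Longrightarrow> landsberg_curv F z u v = 0"
    and c: "\<And>z u v. z \<in> S \<Longrightarrow> ext_d (cartan_form F) z u v = 0"
    and z: "z \<in> S"
  shows "P_curv F z j i k l = 0"
proof -
  have "(\<Sum>m\<in>UNIV. pdy l (Gam m m k) z) = 0" if "z \<in> S" for z k l
    using closed_imp_pdy_H[OF that c[OF that], of l k] that by (simp add: H_def[abs_def])
  then show ?thesis
    using berwald_if_trace_0[OF landsberg_curv_eq_0_imp[OF _ L] _ z]
    by (simp add: P_curv_eq_0_iff[OF z])
qed

lemma exact_imp_closed:
  assumes f: "sm f" and ex: "\<And>z u. z \<in> S \<Longrightarrow> cartan_form F z u = frechet_derivative f (at z) u"
    and z: "z \<in> S"
  shows "ext_d (cartan_form F) z u v = 0"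
proof -
  have "frechet_derivative (\<lambda>w. cartan_form F w v) (at z)
      = frechet_derivative (\<lambda>w. frechet_derivative f (at w) v) (at z)" for v
    by (rule fd_cong) (use z ex smooth_on_frechet[OF f] in auto)
  then show ?thesis unfolding ext_d_def using fd_commute[OF f z, of v u] by simp
qed

lemma fst_in_U: "z \<in> S \<Longrightarrow> fst z \<in> U"
  by (auto simp: S_def)

lemma sm_fst:
  fixes \<psi> :: "real^'n \<Rightarrow> real"
  assumes "smooth_on U \<psi>"
  shows "sm (\<lambda>z. \<psi> (fst z))"
  by (rule smooth_on_compose[OF open_S smooth_on_bounded_linear[OF open_S bounded_linear_fst] assms])
    (auto simp: S_def)

lemma fd_fst:
  fixes \<psi> :: "real^'n \<Rightarrow> real"
  assumes "smooth_on U \<psi>" "z \<in> S"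
  shows "frechet_derivative (\<lambda>z. \<psi> (fst z)) (at z) u = frechet_derivative \<psi> (at (fst z)) (fst u)"
proof -
  have "fst z \<in> U" using assms(2) by (auto simp: S_def)
  then have "(\<psi> has_derivative frechet_derivative \<psi> (at (fst z))) (at (fst z))"
    using smooth_on_differentiable[OF assms(1)] frechet_derivative_works by blast
  from has_derivative_compose[OF bounded_linear_imp_has_derivative[OF bounded_linear_fst] this]
  show ?thesis using frechet_derivative_at by metis
qed

text \<open>Subtracting \<open>\<psi>\<close> cancels the horizontal part left over in
  \<open>cartan_form_eq\<close>. It serves for \<open>ln \<sigma>\<close> when the S-curvature
  vanishes and for \<open>psi\<close> on Berwald manifolds.\<close>

lemma cartan_form_exact_local:
  assumes \<psi>: "smooth_on U \<psi>"
    and H: "\<And>k. frechet_derivative \<psi> (at (fst z)) (axis k 1) = H k z" and z: "z \<in> S"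
  shows "cartan_form F z u = frechet_derivative (\<lambda>z. tau0 z - \<psi> (fst z)) (at z) u"
proof -
  have l: "linear (frechet_derivative \<psi> (at (fst z)))"
    by (rule linear_frechet_derivative[OF smooth_on_differentiable[OF \<psi> fst_in_U[OF z]]])
  have "fst u = (\<Sum>k\<in>UNIV. fst u $ k *\<^sub>R axis k 1)" by (simp add: vec_eq_iff sum_axis_nth del: sum_component)
  then have e: "(\<Sum>k\<in>UNIV. fst u $ k *\<^sub>R axis k 1) = fst u" by (rule sym)
  have "frechet_derivative \<psi> (at (fst z)) (\<Sum>k\<in>UNIV. fst u $ k *\<^sub>R axis k 1) = (\<Sum>k\<in>UNIV. fst u $ k * H k z)"
    by (simp add: linear_sum[OF l] linear_cmul[OF l] H)
  then have "frechet_derivative \<psi> (at (fst z)) (fst u) = (\<Sum>k\<in>UNIV. fst u $ k * H k z)"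
    unfolding e .
  then show ?thesis
    unfolding cartan_form_eq[OF z]
    using z sm_fst[OF \<psi>] by (simp add: fd_diff fd_fst[OF \<psi>] mult.commute)
qed

text \<open>By \<open>y_N\<close> the spray field is horizontal, namely \<open>y\<close> contracted
  with \<open>del\<close>, and \<open>del\<close> of the distortion is known from
  \<open>del_tau0\<close>.\<close>

lemma S_curv_eq:
  assumes \<sigma>: "smooth_on U \<sigma>" "\<And>x. x \<in> U \<Longrightarrow> \<sigma> x > 0" and z: "z \<in> S"
  shows "S_curv F \<sigma> z = (\<Sum>k\<in>UNIV. snd z $ k * (H k z - frechet_derivative (\<lambda>x. ln (\<sigma> x)) (at (fst z)) (axis k 1)))"
proof -
  define \<phi> where "\<phi> x = ln (\<sigma> x)" for x
  have \<phi>: "smooth_on U \<phi>" unfolding \<phi>_def[abs_def] by (rule smooth_on_ln_compose[OF open_U \<sigma>])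
  define \<tau> where "\<tau> z = tau0 z - \<phi> (fst z)" for z
  have sm\<tau>: "sm \<tau>" unfolding \<tau>_def[abs_def] using sm_fst[OF \<phi>] by simp
  have "distortion F \<sigma> w = \<tau> w" if "w \<in> S" for w
  proof -
    have "\<sigma> (fst w) > 0" using \<sigma> that by (auto simp: S_def)
    then show ?thesis using dt_pos[OF that]
      by (simp add: distortion_def \<tau>_def tau0_def \<phi>_def dt_def[symmetric] ln_div ln_sqrt)
  qed
  then have e: "\<tau> w = distortion F \<sigma> w" if "w \<in> S" for w using that by simp
  have "pdx i (distortion F \<sigma>) z = pdx i \<tau> z" "pdy i (distortion F \<sigma>) z = pdy i \<tau> z" for i
    by (rule pdx_cong[OF sm\<tau> z e] pdy_cong[OF sm\<tau> z e], assumption)+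
  then have "S_curv F \<sigma> z = (\<Sum>i\<in>UNIV. snd z $ i * pdx i \<tau> z) - (\<Sum>m\<in>UNIV. (2 * G m z) * pdy m \<tau> z)"
    unfolding S_curv_def by (simp add: sum_distrib_left mult.assoc)
  also have "(\<Sum>m\<in>UNIV. (2 * G m z) * pdy m \<tau> z) = (\<Sum>i\<in>UNIV. snd z $ i * (\<Sum>m\<in>UNIV. N m i z * pdy m \<tau> z))"
    unfolding y_N[OF z, symmetric] sum_distrib_left sum_distrib_right
    by (subst sum.swap) (simp add: mult_ac)
  finally have "S_curv F \<sigma> z = (\<Sum>i\<in>UNIV. snd z $ i * del i \<tau> z)"
    by (simp add: del_def right_diff_distrib sum_subtractf)
  moreover have "del k \<tau> z = H k z - frechet_derivative \<phi> (at (fst z)) (axis k 1)" for k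
  proof -
    have "del k \<tau> z = frechet_derivative \<tau> (at z) (delta_x F z k)" by (rule fd_delta_x[OF sm\<tau> z, symmetric])
    also have "\<dots> = frechet_derivative tau0 (at z) (delta_x F z k) - frechet_derivative \<phi> (at (fst z)) (fst (delta_x F z k))"
      unfolding \<tau>_def[abs_def] using z sm_fst[OF \<phi>] by (simp add: fd_diff fd_fst[OF \<phi> z])
    finally show ?thesis
      unfolding fd_delta_x[OF sm_tau0 z] del_tau0[OF z] by (simp add: delta_x_def)
  qed
  ultimately show ?thesis by (simp add: \<phi>_def[abs_def])
qed

lemma landsberg_S_imp_closed:
  assumes L: "\<And>z u v. z \<in> S \<Longrightarrow> landsberg_curv F z u v = 0"
    and \<sigma>: "smooth_on U \<sigma>" "\<And>x. x \<in> U \<Longrightarrow> \<sigma> x > 0"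
    and S0: "\<And>z. z \<in> S \<Longrightarrow> S_curv F \<sigma> z = 0"
    and z: "z \<in> S"
  shows "ext_d (cartan_form F) z u v = 0"
proof -
  define \<phi> where "\<phi> x = ln (\<sigma> x)" for x
  have \<phi>: "smooth_on U \<phi>" unfolding \<phi>_def[abs_def] by (rule smooth_on_ln_compose[OF open_U \<sigma>])
  define d where "d k = (\<lambda>z::'n pt. frechet_derivative \<phi> (at (fst z)) (axis k 1))" for k
  have smd: "sm (d k)" for k unfolding d_def by (rule sm_fst[OF smooth_on_frechet[OF \<phi>]])
  have pd: "pdy j (d k) z = 0" if "z \<in> S" for j k z
    unfolding pdy_def d_def using fd_fst[OF smooth_on_frechet[OF \<phi>] that, of "axis k 1" "(0, axis j 1)"]
      linear_0[OF linear_frechet_derivative[OF smooth_on_differentiable[OF smooth_on_frechet[OF \<phi>]]], of "fst z"] that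
    by (auto simp: S_def)
  have H: "d k z = H k z" if z: "z \<in> S" for k z
  proof -
    have "pdy k (\<lambda>z. \<Sum>j\<in>UNIV. snd z $ j * (H j z - d j z)) z = pdy k (\<lambda>z. 0) z"
      by (rule pdy_cong) (use z S0 S_curv_eq[OF \<sigma>] in \<open>auto simp: d_def \<phi>_def[abs_def]\<close>)
    then have "(\<Sum>j\<in>UNIV. snd z $ j * pdy k (H j) z + (if k = j then 1 else 0) * (H j z - d j z)) = 0"
      using z smd by (simp add: pd)
    then have "(\<Sum>j\<in>UNIV. snd z $ j * pdy k (H j) z) + (H k z - d k z) = 0"
      by (simp add: sum.distrib if_distrib[of "\<lambda>x. x * _"] cong: if_cong)
    \<comment> \<open>The Landsberg condition with its upper index contracted against the remaining
      lower one.\<close>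
    moreover have "(\<Sum>j\<in>UNIV. snd z $ j * pdy k (H j) z) = 0"
    proof -
      have "(\<Sum>j\<in>UNIV. snd z $ j * pdy k (H j) z) = (\<Sum>m\<in>UNIV. \<Sum>j\<in>UNIV. snd z $ j * pdy k (Gam m j m) z)"
        using z pdy_Gam_sym12[OF z]
        by (subst sum.swap) (simp add: H_def[abs_def] sum_distrib_left)
      then show ?thesis using landsberg_curv_eq_0_imp[OF z L[OF z]] by simp
    qed
    ultimately show ?thesis by simp
  qed
  show ?thesis
  proof (rule exact_imp_closed[OF _ _ z])
    show "sm (\<lambda>z. tau0 z - \<phi> (fst z))" using sm_fst[OF \<phi>] by simp
    show "cartan_form F z u = frechet_derivative (\<lambda>z. tau0 z - \<phi> (fst z)) (at z) u" if "z \<in> S" for z u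
      using cartan_form_exact_local[OF \<phi> _ that] H[OF that] by (simp add: d_def)
  qed
qed

subsection \<open>The maximum of the distortion on Berwald manifolds\<close>

lemma homog_tau0: "homog 0 tau0"
  unfolding homog_def
proof
  fix z assume z: "z \<in> S"
  have "(\<Sum>k\<in>UNIV. snd z $ k * pdy k tau0 z)
     = (\<Sum>k\<in>UNIV. \<Sum>i\<in>UNIV. \<Sum>j\<in>UNIV. gi i j z / 2 * (snd z $ k * pdy k (g i j) z))"
    unfolding pdy_tau0[OF z] by (simp add: sum_distrib_left sum_divide_distrib mult_ac)
  also have "\<dots> = (\<Sum>i\<in>UNIV. \<Sum>j\<in>UNIV. gi i j z / 2 * (\<Sum>k\<in>UNIV. snd z $ k * pdy k (g i j) z))"
    unfolding sum_distrib_left by (rule sum_rot3)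
  finally show "(\<Sum>k\<in>UNIV. snd z $ k * pdy k tau0 z) = 0 * tau0 z"
    using y_dg(1)[OF z] by simp
qed

lemma fd_fibre:
  "sm q \<Longrightarrow> z \<in> S \<Longrightarrow> frechet_derivative q (at z) (0, v) = (\<Sum>k\<in>UNIV. v $ k * pdy k q z)"
  by (simp add: fd_pd)

lemma homog_0_scale:
  assumes q: "sm q" "homog 0 q" and x: "x \<in> U" "y \<noteq> 0" and a: "a > 0"
  shows "q (x, a *\<^sub>R y) = q (x, y)"
proof -
  have "((\<lambda>a. q (x, a *\<^sub>R y)) has_derivative (\<lambda>h. 0)) (at a within {0<..})" if "a > 0" for a
  proof -
    have inS: "(x, a *\<^sub>R y) \<in> S" using that x by (simp add: S_def)
    have "((\<lambda>a. a *\<^sub>R y) has_derivative (\<lambda>h. h *\<^sub>R y)) (at a)"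
      by (auto intro!: derivative_eq_intros)
    from has_derivative_compose[OF this fibre_derivative[OF q(1) inS]]
    have "((\<lambda>a. q (x, a *\<^sub>R y)) has_derivative
        (\<lambda>h. frechet_derivative q (at (x, a *\<^sub>R y)) (0, h *\<^sub>R y))) (at a)" .
    moreover have "frechet_derivative q (at (x, a *\<^sub>R y)) (0, h *\<^sub>R y) = 0" for h
    proof -
      have "frechet_derivative q (at (x, a *\<^sub>R y)) (0, h *\<^sub>R y)
        = h / a * (\<Sum>k\<in>UNIV. snd (x, a *\<^sub>R y) $ k * pdy k q (x, a *\<^sub>R y))"
        using that unfolding fd_fibre[OF q(1) inS] by (simp add: sum_distrib_left mult.assoc)
      then show ?thesis using homogD[OF q(2) inS] by simp
    qed
    ultimately show ?thesis by (simp add: has_derivative_at_withinI)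
  qed
  then have "\<exists>c. \<forall>a\<in>{0<..}. q (x, a *\<^sub>R y) = c"
    by (intro has_derivative_zero_constant) auto
  then obtain c where c: "\<forall>a\<in>{0<..}. q (x, a *\<^sub>R y) = c" by blast
  from bspec[OF c, of a] bspec[OF c, of 1] a show ?thesis by simp
qed

text \<open>Taken over the punctured fibre, which every linear change of fibre coordinates
  preserves; by homogeneity it is a maximum over the unit sphere.\<close>

definition psi :: "real^'n \<Rightarrow> real" where "psi x = (SUP y\<in>UNIV-{0}. tau0 (x, y))"

lemma sphere_in_S: "x \<in> U \<Longrightarrow> {x} \<times> sphere 0 1 \<subseteq> S" by (auto simp: S_def)

lemma psi_attained:
  assumes x: "x \<in> U"
  obtains y where "norm y = 1" "psi x = tau0 (x, y)" "\<And>y'. y' \<noteq> 0 \<Longrightarrow> tau0 (x, y') \<le> psi x"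
proof -
  let ?S = "sphere (0::real^'n) 1"
  have cont: "continuous_on ?S (\<lambda>y. tau0 (x, y))"
    by (rule continuous_on_compose2[OF smooth_on_continuous[OF sm_tau0]])
      (use x in \<open>auto intro!: continuous_on_Pair simp: S_def\<close>)
  obtain e :: "real^'n" where "e \<in> Basis" using nonempty_Basis by blast
  then have ne: "?S \<noteq> {}" by (auto intro!: exI[of _ e])
  obtain b where b: "b \<in> ?S" "\<And>y. y \<in> ?S \<Longrightarrow> tau0 (x, y) \<le> tau0 (x, b)"
    using continuous_attains_sup[OF compact_sphere ne cont] by blast
  have le: "tau0 (x, y) \<le> tau0 (x, b)" if "y \<noteq> 0" for y
  proof -
    define u where "u = inverse (norm y) *\<^sub>R y"
    have u: "u \<in> ?S" "u \<noteq> 0" "y = norm y *\<^sub>R u" using that by (auto simp: u_def)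
    have "tau0 (x, y) = tau0 (x, u)"
      by (subst u(3)) (use homog_0_scale[OF sm_tau0 homog_tau0 x u(2), of "norm y"] that in simp)
    then show ?thesis using b(2)[OF u(1)] by simp
  qed
  have "psi x = tau0 (x, b)"
    unfolding psi_def using b le by (intro cSup_eq_maximum) auto
  then show thesis using that[of b] b(1) le by simp
qed

lemma pdy_tau0_max:
  assumes x: "x \<in> U" and y: "y \<noteq> 0" and max: "\<And>y'. y' \<noteq> 0 \<Longrightarrow> tau0 (x, y') \<le> tau0 (x, y)"
  shows "pdy i tau0 (x, y) = 0"
proof -
  have inS: "(x, y) \<in> S" using x y by (simp add: S_def)
  have "(\<lambda>v. frechet_derivative tau0 (at (x, y)) (0, v)) = (\<lambda>v. 0)"
  proof (rule differential_zero_maxmin[OF _ _ fibre_derivative[OF sm_tau0 inS]])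
    show "y \<in> - {0}" "open (- {0} :: (real^'n) set)" using y by (auto simp: open_Compl)
    show "(\<forall>y'\<in>- {0}. tau0 (x, y') \<le> tau0 (x, y)) \<or> (\<forall>y'\<in>- {0}. tau0 (x, y) \<le> tau0 (x, y'))"
      using max by auto
  qed
  from fun_cong[OF this, of "axis i 1"] show ?thesis by (simp add: pdy_def)
qed

context
  assumes bw: "\<And>z i j k l. z \<in> S \<Longrightarrow> pdy l (Gam i j k) z = 0" and dim: "2 \<le> CARD('n)"
begin

text \<open>All fibre derivatives of \<open>H k\<close> vanish, and the punctured fibre is connected
  in dimension at least two.\<close>

lemma H_fibre_const:
  assumes "x \<in> U" "y \<noteq> 0" "y' \<noteq> 0"
  shows "H k (x, y) = H k (x, y')"
proof (rule has_derivative_zero_unique_connected[of "- {0}" "\<lambda>y. H k (x, y)"])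
  show "open (- {0} :: (real^'n) set)" by (simp add: open_Compl)
  show "connected (- {0} :: (real^'n) set)" using dim by (intro connected_punctured_universe) simp
  show "((\<lambda>y. H k (x, y)) has_derivative (\<lambda>h. 0)) (at y)" if "y \<in> - {0}" for y
  proof -
    have inS: "(x, y) \<in> S" using that assms(1) by (simp add: S_def)
    have "pdy l (H k) (x, y) = 0" for l using inS bw by (simp add: H_def[abs_def])
    then show ?thesis using fibre_derivative[OF sm_H inS, of k] by (simp add: fd_fibre[OF sm_H inS])
  qed
qed (use assms in auto)

text \<open>Bounds, uniformly over the unit sphere, the fibre displacement that accompanies a step
  \<open>w\<close> in the base.\<close>

lemma N_bound:
  assumes x: "x \<in> U"
  obtains C where "C \<ge> 0" "\<And>y w. norm y = 1 \<Longrightarrow> norm (\<chi> m. \<Sum>k\<in>UNIV. N m k (x, y) * w $ k) \<le> C * norm w"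
proof -
  have "\<exists>B. \<forall>y\<in>sphere 0 1. \<bar>N m k (x, y)\<bar> \<le> B" for m k
  proof -
    have "continuous_on (sphere 0 1) (\<lambda>y. N m k (x, y))"
      by (rule continuous_on_compose2[OF smooth_on_continuous[OF sm_N]])
        (use x in \<open>auto intro!: continuous_on_Pair simp: S_def\<close>)
    then have "bounded ((\<lambda>y. N m k (x, y)) ` sphere 0 1)"
      by (intro compact_imp_bounded compact_continuous_image compact_sphere)
    then show ?thesis by (auto simp: bounded_iff)
  qed
  then obtain B where B: "\<And>m k y. norm y = 1 \<Longrightarrow> \<bar>N m k (x, y)\<bar> \<le> B m k"
    by (metis dist_0_norm mem_sphere)
  define C where "C = (\<Sum>m\<in>UNIV. \<Sum>k\<in>UNIV. \<bar>B m k\<bar>)"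
  have "norm (\<chi> m. \<Sum>k\<in>UNIV. N m k (x, y) * w $ k) \<le> C * norm w" if "norm y = 1" for y w
  proof -
    have "norm (\<chi> m. \<Sum>k\<in>UNIV. N m k (x, y) * w $ k) \<le> (\<Sum>m\<in>UNIV. \<bar>\<Sum>k\<in>UNIV. N m k (x, y) * w $ k\<bar>)"
      using norm_le_l1_cart[of "\<chi> m. \<Sum>k\<in>UNIV. N m k (x, y) * w $ k"] by simp
    also have "\<dots> \<le> (\<Sum>m\<in>UNIV. \<Sum>k\<in>UNIV. \<bar>B m k\<bar> * norm w)"
    proof (intro sum_mono order_trans[OF sum_abs])
      fix m k
      show "\<bar>N m k (x, y) * w $ k\<bar> \<le> \<bar>B m k\<bar> * norm w"
        unfolding abs_mult using B[OF that, of m k] component_le_norm_cart[of w k]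
        by (intro mult_mono) auto
    qed
    also have "\<dots> = C * norm w" by (simp add: C_def sum_distrib_right)
    finally show ?thesis .
  qed
  moreover have "C \<ge> 0" unfolding C_def by (intro sum_nonneg) auto
  ultimately show thesis using that by blast
qed

text \<open>An envelope argument: to first order, \<open>tau0 (x + w, y)\<close> exceeds \<open>tau0 (x, y + N w)\<close> by \<open>H w\<close>,
  uniformly in \<open>y\<close>, which bounds \<open>psi\<close> from above; the lower bound comes from a maximum point.\<close>

lemma psi_has_derivative:
  assumes x: "x \<in> U" and y1: "y1 \<noteq> 0"
  shows "(psi has_derivative (\<lambda>w. \<Sum>k\<in>UNIV. w $ k * H k (x, y1))) (at x)"
  unfolding has_derivative_at_alt
proof (intro conjI allI impI)
  show "bounded_linear (\<lambda>w. \<Sum>k\<in>UNIV. w $ k * H k (x, y1))"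
    by (intro bounded_linear_sum bounded_linear_mult_const[OF bounded_linear_vec_nth] bounded_linear_vec_nth)
  fix e :: real assume e: "e > 0"
  obtain C where C: "C \<ge> 0" "\<And>y w. norm y = 1 \<Longrightarrow> norm (\<chi> m. \<Sum>k\<in>UNIV. N m k (x, y) * w $ k) \<le> C * norm w"
    using N_bound[OF x] by blast
  \<comment> \<open>The base step and the fibre displacement together cost
    \<open>e1 * (1 + C) * norm w = e * norm w\<close>.\<close>
  define e1 where "e1 = e / (1 + C)"
  have e1: "e1 > 0" unfolding e1_def using e C by simp
  have e1C: "e1 * (1 + C) = e" unfolding e1_def using C by simp
  have "0 \<le> e1 * C" using e1 C by simp
  then have e1e: "e1 \<le> e" using e1C by (simp add: algebra_simps)
  have comp: "compact ({x} \<times> sphere (0::real^'n) 1)" by (intro compact_Times) auto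
  obtain \<delta> where \<delta>: "\<delta> > 0" "\<And>z z'. z \<in> {x} \<times> sphere 0 1 \<Longrightarrow> norm (z' - z) < \<delta> \<Longrightarrow>
     z' \<in> S \<and> \<bar>tau0 z' - tau0 z - frechet_derivative tau0 (at z) (z' - z)\<bar> \<le> e1 * norm (z' - z)"
    using uniform_linear_approximation[OF open_S sm_tau0 comp sphere_in_S[OF x] e1] by blast
  show "\<exists>d>0. \<forall>x'. norm (x' - x) < d \<longrightarrow>
     norm (psi x' - psi x - (\<Sum>k\<in>UNIV. (x' - x) $ k * H k (x, y1))) \<le> e * norm (x' - x)"
  proof (intro exI[of _ "\<delta> / (1 + C)"] conjI allI impI)
    show "\<delta> / (1 + C) > 0" using \<delta> C by simp
    fix x' assume x': "norm (x' - x) < \<delta> / (1 + C)"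
    define w where "w = x' - x"
    define h where "h = (\<Sum>k\<in>UNIV. w $ k * H k (x, y1))"
    have w: "norm w * (1 + C) < \<delta>" using x' C by (simp add: w_def field_simps)
    have "norm w \<le> norm w * (1 + C)" using C mult_left_mono[of 1 "1 + C" "norm w"] by simp
    then have w1: "norm w < \<delta>" using w by linarith
    have hy: "(\<Sum>k\<in>UNIV. w $ k * H k (x, y)) = h" if "norm y = 1" for y
      unfolding h_def using H_fibre_const[OF x _ y1, of y] that by (metis norm_zero zero_neq_one)
    have A: "x' \<in> U \<and> \<bar>tau0 (x', y) - tau0 (x, y) - frechet_derivative tau0 (at (x, y)) (w, 0)\<bar> \<le> e1 * norm w"
      if "norm y = 1" for y
      using \<delta>(2)[of "(x, y)" "(x', y)"] that w1 by (simp add: w_def norm_Pair S_def)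
    have x'U: "x' \<in> U" using A[of "axis undefined 1"] by simp
    have inS: "(x, y) \<in> S" if "norm y = 1" for y using x that by (auto simp: S_def)
    have up: "tau0 (x', y) \<le> psi x + h + e * norm w" if y: "norm y = 1" for y
    proof -
      define n where "n = (\<chi> m. \<Sum>k\<in>UNIV. N m k (x, y) * w $ k)"
      have n: "norm n \<le> C * norm w" unfolding n_def using C(2)[OF y] .
      have "norm w * (1 + C) = norm w + C * norm w" by (simp add: algebra_simps)
      then have "norm n < \<delta>" using n w norm_ge_zero[of w] by linarith
      then have B: "(x, y + n) \<in> S \<and> \<bar>tau0 (x, y + n) - tau0 (x, y) - frechet_derivative tau0 (at (x, y)) (0, n)\<bar> \<le> e1 * norm n"
        using \<delta>(2)[of "(x, y)" "(x, y + n)"] y by (simp add: norm_Pair)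
      have l: "linear (frechet_derivative tau0 (at (x, y)))"
        using linear_frechet_derivative[OF sm_differentiable[OF sm_tau0 inS[OF y]]] .
      \<comment> \<open>\<open>(w, - n)\<close> is the horizontal lift of \<open>w\<close>, so only
        \<open>del_tau0\<close> contributes.\<close>
      have "frechet_derivative tau0 (at (x, y)) (w, - n) = h"
        unfolding fd_ver[OF sm_tau0 inS[OF y]] using hy[OF y] inS[OF y]
        by (simp add: del_tau0 ver_def n_def)
      then have D: "frechet_derivative tau0 (at (x, y)) (w, 0) - frechet_derivative tau0 (at (x, y)) (0, n) = h"
        using linear_diff[OF l, of "(w, 0)" "(0, n)"] by simp
      obtain ym where ym: "\<And>y'. y' \<noteq> 0 \<Longrightarrow> tau0 (x, y') \<le> psi x" using psi_attained[OF x] by blast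
      have "tau0 (x, y + n) \<le> psi x" using B by (intro ym) (auto simp: S_def)
      moreover have "e1 * norm w + e1 * norm n \<le> e * norm w"
      proof -
        have "e1 * norm n \<le> e1 * (C * norm w)" using n e1 by (intro mult_left_mono) auto
        moreover have "e1 * norm w + e1 * (C * norm w) = e * norm w"
          unfolding e1C[symmetric] by (simp add: algebra_simps)
        ultimately show ?thesis by linarith
      qed
      ultimately show ?thesis using A[OF y] B D by (auto simp: abs_le_iff)
    qed
    obtain y' where y': "norm y' = 1" "psi x' = tau0 (x', y')" using psi_attained[OF x'U] by blast
    obtain y where y: "norm y = 1" "psi x = tau0 (x, y)" "\<And>y'. y' \<noteq> 0 \<Longrightarrow> tau0 (x, y') \<le> psi x"
      using psi_attained[OF x] by blast
    obtain ym where ym: "\<And>y. y \<noteq> 0 \<Longrightarrow> tau0 (x', y) \<le> psi x'" using psi_attained[OF x'U] by blast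
    have "y \<noteq> 0" using y(1) by auto
    \<comment> \<open>At a maximum point the fibre derivatives of \<open>tau0\<close> vanish, so
      here no displacement in the fibre is required.\<close>
    have "frechet_derivative tau0 (at (x, y)) (w, 0) = h"
      unfolding fd_ver[OF sm_tau0 inS[OF y(1)]] using hy[OF y(1)] inS[OF y(1)]
      by (simp add: del_tau0 pdy_tau0_max[OF x \<open>y \<noteq> 0\<close> y(3)[unfolded y(2)]])
    moreover have "e1 * norm w \<le> e * norm w"
      using e1e by (intro mult_right_mono) auto
    ultimately have "psi x + h - e * norm w \<le> psi x'"
      using A[OF y(1)] ym[OF \<open>y \<noteq> 0\<close>] y(2) by (auto simp: abs_le_iff)
    moreover have "psi x' \<le> psi x + h + e * norm w" using up[OF y'(1)] y'(2) by simp
    ultimately show "norm (psi x' - psi x - (\<Sum>k\<in>UNIV. (x' - x) $ k * H k (x, y1))) \<le> e * norm (x' - x)"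
      unfolding w_def[symmetric] h_def[symmetric] by (simp add: abs_le_iff)
  qed
qed

lemma fd_psi:
  assumes "(x, y) \<in> S"
  shows "frechet_derivative psi (at x) (axis k 1) = H k (x, y)"
proof -
  have "x \<in> U" "y \<noteq> 0" using assms by (auto simp: S_def)
  from frechet_derivative_at[OF psi_has_derivative[OF this]]
  have "frechet_derivative psi (at x) (axis k 1) = (\<Sum>j\<in>UNIV. axis k 1 $ j * H j (x, y))" by metis
  then show ?thesis by (simp add: axis_def if_distrib[of "\<lambda>x. x * _"] cong: if_cong)
qed

text \<open>The differential is \<open>H\<close> at a fixed fibre vector, already known to be
  smooth, so a single differentiation gives all orders.\<close>

lemma smooth_psi: "smooth_on U psi"
proof -
  obtain e :: "real^'n" where "e \<in> Basis" using nonempty_Basis by blast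
  then have e: "e \<noteq> 0" by auto
  have "smooth_on U (\<lambda>x. H k (x, e))" for k
  proof (rule smooth_on_compose[OF open_U _ sm_H])
    have "bounded_linear (\<lambda>x. (x, 0) :: 'n pt)"
      by (intro bounded_linear_Pair bounded_linear_ident bounded_linear_zero)
    from smooth_on_add[OF open_U smooth_on_bounded_linear[OF open_U this] smooth_on_const[OF open_U, of "(0, e)"]]
    show "smooth_on U (\<lambda>x. (x, e))" by simp
  qed (use e in \<open>auto simp: S_def\<close>)
  then have "smooth_on U (\<lambda>x. \<Sum>k\<in>UNIV. w $ k * H k (x, e))" for w
    by (intro smooth_on_sum smooth_on_mult smooth_on_const open_U)
  then have "Ck_on (Suc m) U psi" for m
    using Ck_on_SucI[OF open_U psi_has_derivative[OF _ e]] smooth_onD by blast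
  then show ?thesis using Ck_on_SucD smooth_onI by blast
qed

lemma S_curv_exp_psi:
  assumes "z \<in> S"
  shows "S_curv F (\<lambda>x. exp (psi x)) z = 0"
  using S_curv_eq[OF smooth_on_exp_compose[OF open_U smooth_psi] _ assms] fd_psi[of "fst z" "snd z"] assms
  by simp

lemma cartan_form_tau0_psi:
  assumes "z \<in> S"
  shows "cartan_form F z u = frechet_derivative (\<lambda>z. tau0 z - psi (fst z)) (at z) u"
  using cartan_form_exact_local[OF smooth_psi _ assms] fd_psi[of "fst z" "snd z"] assms by simp

end

end

section \<open>Change of charts\<close>

text \<open>Along a fibre a change of charts acts by the fixed linear map \<open>J\<close>, so
  derivatives of the Jacobian in \<open>x\<close> never enter.\<close>

lemma fd_fibre_change:
  fixes P Q :: "'n::finite pt \<Rightarrow> real"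
  assumes J: "linear J" "\<And>y. J y = 0 \<Longrightarrow> y = 0"
    and P: "\<And>y. y \<noteq> 0 \<Longrightarrow> P differentiable (at (x, y))"
    and Q: "\<And>y. y \<noteq> 0 \<Longrightarrow> Q differentiable (at (x', y))"
    and eq: "\<And>y. y \<noteq> 0 \<Longrightarrow> P (x, y) = Q (x', J y)" and y: "y \<noteq> 0"
  shows "frechet_derivative P (at (x, y)) (0, v) = frechet_derivative Q (at (x', J y)) (0, J v)"
proof -
  have Jy: "J y \<noteq> 0" if "y \<noteq> 0" for y using J(2) that by blast
  have 1: "((\<lambda>y. (x, y)) has_derivative (\<lambda>v. (0, v))) (at y)"
    by (auto intro!: derivative_eq_intros)
  have "(J has_derivative J) (at y)"
    using J(1) by (intro bounded_linear_imp_has_derivative linear_conv_bounded_linear[THEN iffD1])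
  then have 2: "((\<lambda>y. (x', J y)) has_derivative (\<lambda>v. (0, J v))) (at y)"
    by (intro has_derivative_Pair has_derivative_const)
  have "((\<lambda>y. P (x, y)) has_derivative (\<lambda>v. frechet_derivative P (at (x, y)) (0, v))) (at y)"
    using has_derivative_compose[OF 1] P[OF y] frechet_derivative_works by blast
  moreover have "((\<lambda>y. Q (x', J y)) has_derivative (\<lambda>v. frechet_derivative Q (at (x', J y)) (0, J v))) (at y)"
    using has_derivative_compose[OF 2] Q[OF Jy[OF y]] frechet_derivative_works by blast
  then have "((\<lambda>y. P (x, y)) has_derivative (\<lambda>v. frechet_derivative Q (at (x', J y)) (0, J v))) (at y)"
    by (rule has_derivative_transform_within_open[where s = "- {0}"])
      (use y eq in \<open>auto simp: open_Compl\<close>)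
  ultimately have "(\<lambda>v. frechet_derivative P (at (x, y)) (0, v)) = (\<lambda>v. frechet_derivative Q (at (x', J y)) (0, J v))"
    by (rule has_derivative_unique)
  then show ?thesis by metis
qed

text \<open>The fibre Hessian transforms as a bilinear form, \<open>g = M^T g' M\<close>, so its
  determinant gains \<open>(det M)\<^sup>2\<close>; as both determinants of the metric are positive,
  \<open>det M\<close> is nonzero.\<close>

lemma tau0_change:
  fixes F F' :: "'n::finite pt \<Rightarrow> real"
  assumes "local_finsler F U" "local_finsler F' U'" and x: "x \<in> U" "x' \<in> U'"
    and J: "linear J" "\<And>y. J y = 0 \<Longrightarrow> y = 0"
    and eq: "\<And>y. y \<noteq> 0 \<Longrightarrow> F (x, y) = F' (x', J y)" and y: "y \<noteq> 0"
  shows "local_finsler.tau0 F (x, y) = local_finsler.tau0 F' (x', J y) + ln \<bar>det (matrix J)\<bar>"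
    "det (matrix J) \<noteq> 0"
proof -
  interpret C: local_finsler F U by fact
  interpret D: local_finsler F' U' by fact
  define M where "M = matrix J"
  have M: "J (axis i 1) $ a = M $ a $ i" for i a by (simp add: M_def matrix_def)
  have inC: "(x, y) \<in> C.S" if "y \<noteq> 0" for y using that x by (simp add: C.S_def)
  have inD: "(x', y) \<in> D.S" if "y \<noteq> 0" for y using that x by (simp add: D.S_def)
  have Jy: "J y \<noteq> 0" if "y \<noteq> 0" for y using J(2) that by blast
  have eqE: "C.E (x, y) = D.E (x', J y)" if "y \<noteq> 0" for y using eq[OF that] by (simp add: C.E_def D.E_def)
  have d1: "frechet_derivative C.E (at (x, y)) (0, v) = frechet_derivative D.E (at (x', J y)) (0, J v)"
    if "y \<noteq> 0" for y v
    by (rule fd_fibre_change[where P = C.E and Q = D.E and J = J]) (use J inC inD eqE that in auto)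
  have d2: "frechet_derivative (\<lambda>z. frechet_derivative C.E (at z) (0, v)) (at (x, y)) (0, w)
    = frechet_derivative (\<lambda>z. frechet_derivative D.E (at z) (0, J v)) (at (x', J y)) (0, J w)"
    if "y \<noteq> 0" for y v w
    by (rule fd_fibre_change[where P = "\<lambda>z. frechet_derivative C.E (at z) (0, v)"
          and Q = "\<lambda>z. frechet_derivative D.E (at z) (0, J v)" and J = J])
      (use J that inC inD d1 smooth_on_frechet[OF C.sm_E] smooth_on_frechet[OF D.sm_E] in auto)
  have g: "C.g i j (x, y) = (\<Sum>b\<in>UNIV. \<Sum>a\<in>UNIV. M $ b $ j * (M $ a $ i * D.g a b (x', J y)))" for i j
  proof -
    have "2 * C.g i j (x, y) = frechet_derivative (\<lambda>z. frechet_derivative C.E (at z) (0, axis i 1)) (at (x, y)) (0, axis j 1)"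
      by (simp add: C.g_def pdy_def[abs_def])
    also have "\<dots> = frechet_derivative (\<lambda>z. frechet_derivative D.E (at z) (0, J (axis i 1))) (at (x', J y)) (0, J (axis j 1))"
      by (rule d2[OF y])
    also have "frechet_derivative (\<lambda>z. frechet_derivative D.E (at z) (0, J (axis i 1))) (at (x', J y))
       = frechet_derivative (\<lambda>z. \<Sum>a\<in>UNIV. M $ a $ i * pdy a D.E z) (at (x', J y))"
      by (rule D.fd_cong) (use inD[OF Jy[OF y]] D.fd_fibre[OF D.sm_E] in \<open>auto simp: M\<close>)
    also have "\<dots> (0, J (axis j 1)) = (\<Sum>b\<in>UNIV. M $ b $ j * pdy b (\<lambda>z. \<Sum>a\<in>UNIV. M $ a $ i * pdy a D.E z) (x', J y))"
      using inD[OF Jy[OF y]] by (subst D.fd_fibre) (simp_all add: M)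
    also have "\<dots> = (\<Sum>b\<in>UNIV. M $ b $ j * (\<Sum>a\<in>UNIV. M $ a $ i * (2 * D.g a b (x', J y))))"
      using inD[OF Jy[OF y]] by (simp add: D.pdy_E2)
    also have "\<dots> = 2 * (\<Sum>b\<in>UNIV. \<Sum>a\<in>UNIV. M $ b $ j * (M $ a $ i * D.g a b (x', J y)))"
      by (simp add: sum_distrib_left mult_ac)
    finally show ?thesis by simp
  qed
  have "fund F (x, y) = transpose M ** (fund F' (x', J y) ** M)"
    unfolding vec_eq_iff
  proof (intro allI)
    fix i j
    show "fund F (x, y) $ i $ j = (transpose M ** (fund F' (x', J y) ** M)) $ i $ j"
      by (simp add: C.fund_g D.fund_g g matrix_matrix_mult_def transpose_def sum_distrib_left)
        (subst sum.swap, simp add: mult_ac)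
  qed
  then have dt: "C.dt (x, y) = (det M)\<^sup>2 * D.dt (x', J y)"
    by (simp add: C.dt_def D.dt_def det_mul det_transpose power2_eq_square mult_ac)
  moreover have pos: "C.dt (x, y) > 0" "D.dt (x', J y) > 0"
    using C.dt_pos D.dt_pos inC inD Jy y by auto
  ultimately have nz: "det M \<noteq> 0" by auto
  then show "det (matrix J) \<noteq> 0" by (simp add: M_def)
  have "ln (C.dt (x, y)) = ln ((det M)\<^sup>2) + ln (D.dt (x', J y))"
    unfolding dt using nz pos by (intro ln_mult_pos) auto
  moreover have "ln ((det M)\<^sup>2) = 2 * ln \<bar>det M\<bar>"
    using nz ln_realpow[of "\<bar>det M\<bar>" 2] by simp
  ultimately show "C.tau0 (x, y) = D.tau0 (x', J y) + ln \<bar>det (matrix J)\<bar>"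
    by (simp add: C.tau0_def D.tau0_def M_def)
qed

text \<open>The shift in \<open>tau0_change\<close> is the same for all \<open>y\<close>, and
  \<open>J\<close> is a bijection of the punctured fibres, so maxima correspond.\<close>

lemma psi_change:
  fixes F F' :: "'n::finite pt \<Rightarrow> real"
  assumes F: "local_finsler F U" "local_finsler F' U'" and x: "x \<in> U" "x' \<in> U'"
    and J: "linear J" "\<And>y. J y = 0 \<Longrightarrow> y = 0"
    and eq: "\<And>y. y \<noteq> 0 \<Longrightarrow> F (x, y) = F' (x', J y)"
  shows "local_finsler.psi F x = local_finsler.psi F' x' + ln \<bar>det (matrix J)\<bar>"
proof -
  interpret C: local_finsler F U by fact
  interpret D: local_finsler F' U' by fact
  obtain y where y: "norm y = 1" "C.psi x = C.tau0 (x, y)" "\<And>y'. y' \<noteq> 0 \<Longrightarrow> C.tau0 (x, y') \<le> C.psi x"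
    using C.psi_attained[OF x(1)] by blast
  obtain u where u: "norm u = 1" "D.psi x' = D.tau0 (x', u)" "\<And>y'. y' \<noteq> 0 \<Longrightarrow> D.tau0 (x', y') \<le> D.psi x'"
    using D.psi_attained[OF x(2)] by blast
  have "surj J" using linear_injective_imp_surjective[OF J(1)] linear_injective_0[OF J(1)] J(2) by blast
  then obtain u' where u': "u = J u'" by (metis surjD)
  have "u \<noteq> 0" "y \<noteq> 0" using u(1) y(1) by auto
  then have "u' \<noteq> 0" using u' linear_0[OF J(1)] by auto
  have tau: "C.tau0 (x, y) = D.tau0 (x', J y) + ln \<bar>det (matrix J)\<bar>" if "y \<noteq> 0" for y
    by (rule tau0_change(1)[OF F x J(1) _ _ that]) (use J(2) eq in auto)
  have "J y \<noteq> 0" using J(2) \<open>y \<noteq> 0\<close> by blast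
  then have "C.psi x \<le> D.psi x' + ln \<bar>det (matrix J)\<bar>"
    using tau[OF \<open>y \<noteq> 0\<close>] y(2) u(3)[of "J y"] by simp
  moreover have "D.psi x' + ln \<bar>det (matrix J)\<bar> \<le> C.psi x"
    using tau[OF \<open>u' \<noteq> 0\<close>] u(2) u' y(3)[OF \<open>u' \<noteq> 0\<close>] by simp
  ultimately show ?thesis by simp
qed

section \<open>Finsler manifolds\<close>

locale finsler_mfd =
  fixes X :: "'m topology" and A :: "('m, 'n::finite) chart set"
    and \<F> :: "'m \<times> ('m, 'n) tvec \<Rightarrow> real"
  assumes mfd: "smooth_manifold X A" and fins: "finsler_structure X A \<F>"
begin

lemma chart_open: "c \<in> A \<Longrightarrow> openin X (fst c)"
  using mfd by (simp add: smooth_manifold_def)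

lemma chart_image_open: "c \<in> A \<Longrightarrow> open (chart_image c)"
  using mfd by (simp add: smooth_manifold_def)

lemma chart_homeo:
  "c \<in> A \<Longrightarrow> homeomorphic_map (subtopology X (fst c)) (top_of_set (chart_image c)) (snd c)"
  using mfd by (simp add: smooth_manifold_def)

lemma chart_subset: "c \<in> A \<Longrightarrow> fst c \<subseteq> topspace X"
  using chart_open openin_subset by blast

lemma chart_inj: "c \<in> A \<Longrightarrow> inj_on (snd c) (fst c)"
  using homeomorphic_imp_injective_map[OF chart_homeo] chart_subset
  by (simp add: topspace_subtopology Int_absorb1)

lemma open_image:
  assumes c: "c \<in> A" and W: "openin X W" "W \<subseteq> fst c"
  shows "open (snd c ` W)"
proof -
  have "openin (subtopology X (fst c)) W"
    using W by (auto simp: openin_subtopology intro!: exI[of _ W])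
  then have "openin (top_of_set (chart_image c)) (snd c ` W)"
    using homeomorphic_imp_open_map[OF chart_homeo[OF c]] by (simp add: open_map_def)
  then show ?thesis using chart_image_open[OF c] openin_open_eq by blast
qed

lemma transition_chart: "c \<in> A \<Longrightarrow> p \<in> fst c \<Longrightarrow> transition c d (snd c p) = snd d p"
  using chart_inj by (simp add: transition_def)

definition J :: "('m, 'n) chart \<Rightarrow> ('m, 'n) chart \<Rightarrow> 'm \<Rightarrow> real^'n \<Rightarrow> real^'n" where
  "J c d p = frechet_derivative (transition c d) (at (snd c p))"

lemma transition_differentiable:
  assumes "c \<in> A" "d \<in> A" "p \<in> fst c" "p \<in> fst d"
  shows "transition c d differentiable (at (snd c p))"
proof -
  have "smooth_on (snd c ` (fst c \<inter> fst d)) (transition c d)"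
    using mfd assms(1,2) by (simp add: smooth_manifold_def)
  then show ?thesis by (rule smooth_on_differentiable) (use assms in auto)
qed

lemma linear_J: "c \<in> A \<Longrightarrow> d \<in> A \<Longrightarrow> p \<in> fst c \<Longrightarrow> p \<in> fst d \<Longrightarrow> linear (J c d p)"
  unfolding J_def by (intro linear_frechet_derivative transition_differentiable)

lemma J_cocycle:
  assumes "c \<in> A" "d \<in> A" "e \<in> A" "p \<in> fst c" "p \<in> fst d" "p \<in> fst e"
  shows "J c e p y = J d e p (J c d p y)"
proof -
  have d: "transition d e differentiable (at (transition c d (snd c p)))"
    using transition_differentiable[of d e p] transition_chart[of c p d] assms by simp
  have "frechet_derivative (transition c e) (at (snd c p))
      = frechet_derivative (transition d e \<circ> transition c d) (at (snd c p))"
  proof (rule frechet_derivative_transform_within_open[where X = "snd c ` (fst c \<inter> fst d \<inter> fst e)"])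
    show "open (snd c ` (fst c \<inter> fst d \<inter> fst e))"
      by (rule open_image[OF assms(1)]) (intro openin_Int chart_open assms, auto)
    show "transition c e x = (transition d e \<circ> transition c d) x"
      if "x \<in> snd c ` (fst c \<inter> fst d \<inter> fst e)" for x
      using that assms by (auto simp: transition_chart)
  qed (use assms transition_differentiable in auto)
  also have "\<dots> = J d e p \<circ> J c d p"
    using frechet_derivative_compose[OF transition_differentiable d] assms
    by (simp add: J_def transition_chart)
  finally show ?thesis by (simp add: J_def)
qed

lemma J_self:
  assumes "c \<in> A" "p \<in> fst c"
  shows "J c c p y = y"
proof -
  have "frechet_derivative (\<lambda>x. x) (at (snd c p)) = frechet_derivative (transition c c) (at (snd c p))"
    by (rule frechet_derivative_transform_within_open[where X = "chart_image c"])
      (use assms chart_image_open in \<open>auto simp: chart_image_def transition_chart\<close>)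
  then have "J c c p = frechet_derivative (\<lambda>x. x) (at (snd c p))" unfolding J_def by (rule sym)
  then show ?thesis by simp
qed

lemma J_inj:
  assumes "c \<in> A" "d \<in> A" "p \<in> fst c" "p \<in> fst d" "J c d p y = 0"
  shows "y = 0"
  using J_cocycle[of c d c p y] J_self[of c p y] linear_0[OF linear_J[of d c p]] assms by simp

section \<open>Tangent vectors and functions on the tangent bundle in a chart\<close>

definition lift :: "('m, 'n) chart \<Rightarrow> 'm \<Rightarrow> real^'n \<Rightarrow> ('m, 'n) tvec" where
  "lift c p y = (\<lambda>d. if d \<in> A \<and> p \<in> fst d then J c d p y else 0)"

lemma lift_tangent:
  assumes "c \<in> A" "p \<in> fst c"
  shows "lift c p y \<in> tangent_space A p"
  unfolding tangent_space_def
proof (intro CollectI conjI ballI allI impI)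
  fix d e assume "d \<in> A" "e \<in> A" "p \<in> fst d" "p \<in> fst e"
  then show "lift c p y e = frechet_derivative (transition d e) (at (snd d p)) (lift c p y d)"
    using J_cocycle[of c d e p y] assms by (simp add: lift_def J_def)
qed (auto simp: lift_def)

lemma lift_self: "c \<in> A \<Longrightarrow> p \<in> fst c \<Longrightarrow> lift c p y c = y"
  by (simp add: lift_def J_self)

lemma lift_unique:
  assumes "v \<in> tangent_space A p" "c \<in> A" "p \<in> fst c"
  shows "v = lift c p (v c)"
proof
  fix d
  show "v d = lift c p (v c) d"
  proof (cases "d \<in> A \<and> p \<in> fst d")
    case True
    then have "v d = frechet_derivative (transition c d) (at (snd c p)) (v c)"
      using assms unfolding tangent_space_def by blast
    then show ?thesis using True by (simp add: lift_def J_def)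
  next
    case False
    then have "v d = 0" using assms(1) unfolding tangent_space_def by blast
    then show ?thesis using False by (auto simp: lift_def)
  qed
qed

lemma lift_change:
  assumes "c \<in> A" "d \<in> A" "p \<in> fst c" "p \<in> fst d"
  shows "lift c p y = lift d p (J c d p y)"
  using lift_unique[OF lift_tangent[OF assms(1,3)] assms(2,4), of y] assms by (simp add: lift_def)

lemma lift_scale:
  assumes "c \<in> A" "p \<in> fst c"
  shows "lift c p (a *\<^sub>R y) = (\<lambda>d. a *\<^sub>R lift c p y d)"
  using linear_cmul[OF linear_J[of c _ p]] assms by (auto simp: lift_def)

lemma lift_bundle: "c \<in> A \<Longrightarrow> p \<in> fst c \<Longrightarrow> (p, lift c p y) \<in> tangent_bundle X A"
  using lift_tangent[of c p y] chart_subset[of c] by (auto simp: tangent_bundle_def)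

text \<open>A tangent vector is determined by its component in one chart, so the coordinate map is
  injective and its \<open>inv_into\<close> can be evaluated at a lift.\<close>

lemma in_coords_lift:
  assumes c: "c \<in> A" and p: "p \<in> fst c"
  shows "in_coords X A c f (snd c p, y) = f (p, lift c p y)"
proof -
  let ?T = "{t \<in> tangent_bundle X A. fst t \<in> fst c}"
  have "inj_on (\<lambda>(p, v). (snd c p, v c)) ?T"
  proof (rule inj_onI)
    fix s t assume st: "s \<in> ?T" "t \<in> ?T" "(\<lambda>(p, v). (snd c p, v c)) s = (\<lambda>(p, v). (snd c p, v c)) t"
    obtain p v q w where pq: "s = (p, v)" "t = (q, w)" by (meson surj_pair)
    have "p = q" using st pq chart_inj[OF c] by (auto simp: inj_on_def)
    moreover have vw: "v \<in> tangent_space A p" "p \<in> fst c" "w \<in> tangent_space A q" "q \<in> fst c" "v c = w c"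
      using st pq by (auto simp: tangent_bundle_def)
    ultimately have "v = w"
      using lift_unique[OF vw(1) c vw(2)] lift_unique[OF vw(3) c vw(4)] by metis
    with \<open>p = q\<close> show "s = t" using pq by simp
  qed
  then have "inv_into ?T (\<lambda>(p, v). (snd c p, v c)) (snd c p, y) = (p, lift c p y)"
    by (rule inv_into_f_eq) (use assms lift_bundle lift_self in auto)
  then show ?thesis by (simp add: in_coords_def)
qed

abbreviation Fc :: "('m, 'n) chart \<Rightarrow> 'n pt \<Rightarrow> real" where "Fc c \<equiv> in_coords X A c \<F>"

lemma local:
  assumes c: "c \<in> A"
  shows "local_finsler (Fc c) (chart_image c)"
proof
  show "open (chart_image c)" by (rule chart_image_open[OF c])
  show "smooth_on (chart_image c \<times> (UNIV - {0})) (Fc c)"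
    using fins c by (simp add: finsler_structure_def smooth_on_TM0_def slit_image_def)
  show "0 < w \<bullet> (fund (Fc c) z *v w)" if "z \<in> chart_image c \<times> (UNIV - {0})" "w \<noteq> 0" for z w
    using fins c that unfolding finsler_structure_def slit_image_def by blast
  show "Fc c (x, a *\<^sub>R y) = a * Fc c (x, y)" if x: "x \<in> chart_image c" and "y \<noteq> 0" "a > 0" for x y a
  proof -
    obtain p where p: "p \<in> fst c" "x = snd c p" using x by (auto simp: chart_image_def)
    have "\<F> (p, \<lambda>d. a *\<^sub>R lift c p y d) = a * \<F> (p, lift c p y)"
      using fins lift_bundle[OF c p(1), of y] that(3) unfolding finsler_structure_def by blast
    then show ?thesis unfolding p(2) in_coords_lift[OF c p(1)] lift_scale[OF c p(1)] .
  qed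
  show "0 \<le> Fc c z" if "z \<in> chart_image c \<times> (UNIV - {0})" for z
  proof -
    obtain x y where z: "z = (x, y)" "x \<in> chart_image c" using \<open>z \<in> _\<close> by auto
    then obtain p where p: "p \<in> fst c" "z = (snd c p, y)" by (auto simp: chart_image_def)
    have "0 \<le> \<F> (p, lift c p y)"
      using fins lift_bundle[OF c p(1), of y] unfolding finsler_structure_def by blast
    then show ?thesis unfolding p(2) in_coords_lift[OF c p(1)] .
  qed
qed

lemma Fc_change:
  assumes "c \<in> A" "d \<in> A" "p \<in> fst c" "p \<in> fst d"
  shows "Fc c (snd c p, y) = Fc d (snd d p, J c d p y)"
  using assms by (simp add: in_coords_lift lift_change[of c d])

lemma slit_image_S: "c \<in> A \<Longrightarrow> slit_image c = local_finsler.S (chart_image c)"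
  using local_finsler.S_def[OF local] by (simp add: slit_image_def)

lemma chart_change:
  assumes c: "c \<in> A" and d: "d \<in> A" and p: "p \<in> fst c" "p \<in> fst d"
  shows "y \<noteq> 0 \<Longrightarrow> local_finsler.tau0 (Fc c) (snd c p, y)
      = local_finsler.tau0 (Fc d) (snd d p, J c d p y) + ln \<bar>det (matrix (J c d p))\<bar>"
    and "local_finsler.psi (Fc c) (snd c p)
      = local_finsler.psi (Fc d) (snd d p) + ln \<bar>det (matrix (J c d p))\<bar>"
    and "det (matrix (J c d p)) \<noteq> 0"
proof -
  have x: "snd c p \<in> chart_image c" "snd d p \<in> chart_image d"
    using p by (auto simp: chart_image_def)
  note args = local[OF c] local[OF d] x linear_J[OF c d p]
  show "y \<noteq> 0 \<Longrightarrow> local_finsler.tau0 (Fc c) (snd c p, y)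
      = local_finsler.tau0 (Fc d) (snd d p, J c d p y) + ln \<bar>det (matrix (J c d p))\<bar>"
    by (rule tau0_change(1)[OF args]) (erule J_inj[OF c d p], rule Fc_change[OF c d p])
  show "local_finsler.psi (Fc c) (snd c p)
      = local_finsler.psi (Fc d) (snd d p) + ln \<bar>det (matrix (J c d p))\<bar>"
    by (rule psi_change[OF args]) (erule J_inj[OF c d p], rule Fc_change[OF c d p])
  obtain e :: "real^'n" where "e \<in> Basis" using nonempty_Basis by blast
  then have "e \<noteq> 0" by auto
  then show "det (matrix (J c d p)) \<noteq> 0"
    by (rule tau0_change(2)[OF args, rotated 2]) (erule J_inj[OF c d p], rule Fc_change[OF c d p])
qed

section \<open>The implications on the manifold\<close>

lemma landsberg_closed_imp_berwald:
  assumes "landsberg X A \<F>" "cartan_form_closed X A \<F>"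
  shows "berwald X A \<F>"
  unfolding berwald_def
proof (intro ballI allI)
  fix c z i j k l assume c: "c \<in> A" and z: "z \<in> slit_image c"
  show "P_curv (Fc c) z j i k l = 0"
    by (rule local_finsler.berwald_if_landsberg_closed[OF local[OF c]])
      (use assms c z in \<open>auto simp: landsberg_def cartan_form_closed_def slit_image_S\<close>)
qed

lemma exact_imp_closed:
  assumes "cartan_form_exact X A \<F>"
  shows "cartan_form_closed X A \<F>"
proof -
  obtain f where f: "smooth_on_TM0 X A f" "\<forall>c\<in>A. \<forall>z\<in>slit_image c. \<forall>u. cartan_form (Fc c) z u =
       frechet_derivative (in_coords X A c f) (at z) u"
    using assms unfolding cartan_form_exact_def by (elim exE conjE)
  show ?thesis
    unfolding cartan_form_closed_def
  proof (intro ballI allI)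
    fix c z u v assume c: "c \<in> A" and z: "z \<in> slit_image c"
    show "ext_d (cartan_form (Fc c)) z u v = 0"
      by (rule local_finsler.exact_imp_closed[OF local[OF c], of "in_coords X A c f"])
        (use f c z in \<open>auto simp: smooth_on_TM0_def slit_image_S[symmetric]\<close>)
  qed
qed

lemma landsberg_S_imp_closed:
  assumes L: "landsberg X A \<F>" and \<sigma>: "volume_form A \<sigma>" and S: "vanishing_S X A \<F> \<sigma>"
  shows "cartan_form_closed X A \<F>"
  unfolding cartan_form_closed_def
proof (intro ballI allI)
  fix c z u v assume c: "c \<in> A" and z: "z \<in> slit_image c"
  show "ext_d (cartan_form (Fc c)) z u v = 0"
    by (rule local_finsler.landsberg_S_imp_closed[OF local[OF c], of "\<sigma> c"])
      (use L \<sigma> S c z in \<open>auto simp: landsberg_def volume_form_def vanishing_S_def slit_image_S\<close>)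
qed

context
  assumes bw: "berwald X A \<F>"
begin

lemma berwald_landsberg: "landsberg X A \<F>"
  unfolding landsberg_def landsberg_curv_def using bw by (simp add: berwald_def)

lemma berwald_Gam:
  "c \<in> A \<Longrightarrow> z \<in> local_finsler.S (chart_image c) \<Longrightarrow> pdy l (local_finsler.Gam (Fc c) i j k) z = 0"
  using local_finsler.P_curv_eq_0_iff[OF local, of c z j i k l] bw
  by (simp add: berwald_def slit_image_S)

definition \<psi> :: "('m, 'n) chart \<Rightarrow> real^'n \<Rightarrow> real" where "\<psi> c = local_finsler.psi (Fc c)"

lemma berwald_S:
  assumes dim: "2 \<le> CARD('n)"
  shows "volume_form A (\<lambda>c x. exp (\<psi> c x))" "vanishing_S X A \<F> (\<lambda>c x. exp (\<psi> c x))"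
proof -
  show "volume_form A (\<lambda>c x. exp (\<psi> c x))"
    unfolding volume_form_def
  proof (intro conjI ballI)
    fix c assume c: "c \<in> A"
    show "smooth_on (chart_image c) (\<lambda>x. exp (\<psi> c x))"
      unfolding \<psi>_def
      by (intro smooth_on_exp_compose chart_image_open local_finsler.smooth_psi[OF local] berwald_Gam c dim)
    fix d p assume d: "d \<in> A" and p: "p \<in> fst c \<inter> fst d"
    show "exp (\<psi> c (snd c p)) = \<bar>det (matrix (frechet_derivative (transition c d) (at (snd c p))))\<bar> * exp (\<psi> d (snd d p))"
      using chart_change(2,3)[OF c d] p by (simp add: \<psi>_def J_def exp_add)
  qed simp
  show "vanishing_S X A \<F> (\<lambda>c x. exp (\<psi> c x))"
    unfolding vanishing_S_def
  proof (intro ballI)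
    fix c z assume c: "c \<in> A" and z: "z \<in> slit_image c"
    show "S_curv (Fc c) (\<lambda>x. exp (\<psi> c x)) z = 0"
      unfolding \<psi>_def
      by (rule local_finsler.S_curv_exp_psi[OF local[OF c] berwald_Gam[OF c] dim])
        (use z c in \<open>auto simp: slit_image_S\<close>)
  qed
qed

lemma berwald_exact:
  assumes dim: "2 \<le> CARD('n)"
  shows "cartan_form_exact X A \<F>"
proof -
  define f0 where "f0 c = (\<lambda>z. local_finsler.tau0 (Fc c) z - \<psi> c (fst z))" for c
  \<comment> \<open>The choice of the chart is immaterial: \<open>tau0\<close> and
    \<open>\<psi>\<close> gain the same \<open>ln |det J|\<close>, so \<open>f0\<close> takes the
    same value in every chart around \<open>p\<close>.\<close>
  define f where "f = (\<lambda>(p, v). let c = SOME c. c \<in> A \<and> p \<in> fst c in f0 c (snd c p, v c))"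
  have eq: "f0 d z = in_coords X A d f z" if d: "d \<in> A" and z: "z \<in> slit_image d" for d z
  proof -
    obtain p y where p: "p \<in> fst d" "z = (snd d p, y)" "y \<noteq> 0"
      using z by (auto simp: slit_image_def chart_image_def)
    define c where "c = (SOME c. c \<in> A \<and> p \<in> fst c)"
    have "c \<in> A \<and> p \<in> fst c" unfolding c_def by (rule someI[of _ d]) (use d p in auto)
    then have c: "c \<in> A" "p \<in> fst c" by auto
    have "in_coords X A d f z = f0 c (snd c p, J d c p y)"
      unfolding p(2) in_coords_lift[OF d p(1)] f_def using c by (simp add: c_def[symmetric] lift_def)
    then show ?thesis
      unfolding f0_def p(2) using chart_change(1,2)[OF d c(1) p(1) c(2)] p(3) by (simp add: \<psi>_def)
  qed
  have sm: "smooth_on (slit_image c) (f0 c)" if c: "c \<in> A" for c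
  proof -
    interpret C: local_finsler "Fc c" "chart_image c" by (rule local[OF c])
    show ?thesis
      unfolding f0_def \<psi>_def slit_image_S[OF c]
      by (intro C.sm_diff C.sm_tau0 C.sm_fst C.smooth_psi berwald_Gam[OF c] dim)
  qed
  have op: "open (slit_image c)" if "c \<in> A" for c
    using local_finsler.open_S[OF local[OF that]] slit_image_S[OF that] by simp
  have "smooth_on_TM0 X A f"
    unfolding smooth_on_TM0_def using smooth_on_cong[OF op eq sm] by blast
  moreover have "cartan_form (Fc c) z u = frechet_derivative (in_coords X A c f) (at z) u"
    if c: "c \<in> A" and z: "z \<in> slit_image c" for c z u
  proof -
    have "frechet_derivative (f0 c) (at z) = frechet_derivative (in_coords X A c f) (at z)"
      by (rule frechet_derivative_transform_within_open[OF smooth_on_differentiable[OF sm[OF c] z] op[OF c] z])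
        (rule eq[OF c])
    moreover have "cartan_form (Fc c) z u = frechet_derivative (f0 c) (at z) u"
      unfolding f0_def \<psi>_def
      by (rule local_finsler.cartan_form_tau0_psi[OF local[OF c] berwald_Gam[OF c] dim])
        (use z c in \<open>auto simp: slit_image_S\<close>)
    ultimately show ?thesis by simp
  qed
  ultimately show ?thesis unfolding cartan_form_exact_def by blast
qed

end

end

theorem theorem3:
  fixes X :: "'m topology"
    and A :: "('m, 'n::finite) chart set"
    and \<F> :: "'m \<times> ('m, 'n) tvec \<Rightarrow> real"
  assumes "finsler_manifold X A \<F>" and "CARD('n) > 2"
  shows "(landsberg X A \<F> \<and> (\<exists>\<sigma>. volume_form A \<sigma> \<and> vanishing_S X A \<F> \<sigma>)
            \<longleftrightarrow> landsberg X A \<F> \<and> cartan_form_exact X A \<F>) \<and>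
         (landsberg X A \<F> \<and> cartan_form_exact X A \<F>
            \<longleftrightarrow> landsberg X A \<F> \<and> cartan_form_closed X A \<F>) \<and>
         (landsberg X A \<F> \<and> cartan_form_closed X A \<F>
            \<longleftrightarrow> berwald X A \<F>)"
proof -
  interpret finsler_mfd X A \<F>
    using assms(1) by unfold_locales (auto simp: finsler_manifold_def)
  have dim: "2 \<le> CARD('n)" using assms(2) by simp
  \<comment> \<open>Statements (1) and (2) both lead to (3), which gives (4), and (4) gives the
    rest.\<close>
  have "landsberg X A \<F> \<and> cartan_form_closed X A \<F> \<Longrightarrow> berwald X A \<F>"
    using landsberg_closed_imp_berwald by blast
  moreover have "cartan_form_exact X A \<F> \<Longrightarrow> cartan_form_closed X A \<F>"
    by (rule exact_imp_closed)
  moreover have "landsberg X A \<F> \<and> (\<exists>\<sigma>. volume_form A \<sigma> \<and> vanishing_S X A \<F> \<sigma>) \<Longrightarrow> cartan_form_closed X A \<F>"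
    using landsberg_S_imp_closed by blast
  moreover have "berwald X A \<F> \<Longrightarrow> landsberg X A \<F> \<and> cartan_form_exact X A \<F>
      \<and> (\<exists>\<sigma>. volume_form A \<sigma> \<and> vanishing_S X A \<F> \<sigma>)"
    using berwald_landsberg berwald_exact[OF _ dim] berwald_S[OF _ dim] by blast
  ultimately show ?thesis by blast
qed

end
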